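(* Let $(X,Y)$ be an $\mathbb R^2$-valued Gaussian random vector with $\sigma_1^2=\mathrm{Var}(X)>0$, $\sigma_2^2=\mathrm{Var}(Y)>0$ and correlation coefficient $\rho$, i.e. $\mathrm{Cov}(X,Y)=\rho\sigma_1\sigma_2$, and let $(X_i,Y_i)_{i=1,\dots,n}$ be an i.i.d. sample of $(X,Y)$ with empirical Pearson correlation coefficient $r_n$. Let $\rho_0=\frac{\sqrt{3+2\sqrt3}}{3}$. For any $0\le\rho<c<1$ with $|\rho|\le\rho_0$, as $n\to\infty$, $$P(r_n\ge c)=\frac{\exp\Big(-nL^*(c)+\log\overline g_\rho(r_0(\lambda_c))-\frac12\log|\overline h''(r_0(\lambda_c))|\Big)}{\lambda_c\,\sigma_c\sqrt{2\pi n}}\,(1+o(1)),$$ where for any $-1<y<1$, $$L^*(y)=\log\left(\frac{1-\rho y}{\sqrt{1-\rho^2}\,\sqrt{1-y^2}}\right).$$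
   Context: The empirical Pearson correlation coefficient is $$r_n=\frac{\sum_{i=1}^n(X_i-\bar X_n)(Y_i-\bar Y_n)}{\sqrt{\sum_{i=1}^n(X_i-\bar X_n)^2\,\sum_{i=1}^n(Y_i-\bar Y_n)^2}},\qquad \bar X_n=\frac1n\sum_{k=1}^nX_k,\quad \bar Y_n=\frac1n\sum_{k=1}^nY_k .$$ For $\lambda\in\mathbb R$ and $r\in]-1,1[$ set $\overline h(r)=\lambda r-\log(1-\rho r)+\frac12\log(1-r^2)$ (so $\overline h''$ does not depend on $\lambda$) and $\overline g_\rho(r)=(1-\rho^2)^{-1/2}(1-\rho r)^{3/2}(1-r^2)^{-2}$; $r_0(\lambda)$ is the unique real root in $]-1,1[$ of $\overline h'(r)=0$. Set $L(\lambda)=\overline h(r_0(\lambda))+\frac12\log(1-\rho^2)$ (with $\overline h$ taken at the same $\lambda$). Then $\lambda_c$ is the unique $\lambda$ with $L'(\lambda)=c$ (equivalently $r_0(\lambda_c)=c$), and $\sigma_c>0$ is given by $\sigma_c^2=L''(\lambda_c)$. *)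

theory Defs
  imports "HOL-Probability.Probability" "HOL-Library.Landau_Symbols"
begin

(* A Dirac mass counts as a (degenerate) Gaussian law. *)
definition gaussian_rv :: "'a measure \<Rightarrow> ('a \<Rightarrow> real) \<Rightarrow> bool" where
  "gaussian_rv M Z \<longleftrightarrow> Z \<in> borel_measurable M \<and>
     ((\<exists>m. distr M borel Z = return borel m) \<or>
      (\<exists>m s. s > 0 \<and> distributed M lborel Z (normal_density m s)))"

(* (X, Y) is a Gaussian vector: every real linear combination of its
   coordinates is a real Gaussian variable. *)
definition gaussian_vector2 :: "'a measure \<Rightarrow> ('a \<Rightarrow> real) \<Rightarrow> ('a \<Rightarrow> real) \<Rightarrow> bool" where
  "gaussian_vector2 M X Y \<longleftrightarrow> (\<forall>a b. gaussian_rv M (\<lambda>\<omega>. a * X \<omega> + b * Y \<omega>))"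

definition covariance :: "'a measure \<Rightarrow> ('a \<Rightarrow> real) \<Rightarrow> ('a \<Rightarrow> real) \<Rightarrow> real" where
  "covariance M X Y =
     (\<integral>\<omega>. (X \<omega> - (\<integral>\<omega>'. X \<omega>' \<partial>M)) * (Y \<omega> - (\<integral>\<omega>'. Y \<omega>' \<partial>M)) \<partial>M)"

(* The sample is indexed by i \<ge> 1; the random vectors (Xs i, Ys i) are
   mutually independent and each has the joint law of (X, Y). *)
definition iid_sample ::
  "'a measure \<Rightarrow> ('a \<Rightarrow> real) \<Rightarrow> ('a \<Rightarrow> real) \<Rightarrow> (nat \<Rightarrow> 'a \<Rightarrow> real) \<Rightarrow> (nat \<Rightarrow> 'a \<Rightarrow> real) \<Rightarrow> bool"
  where
  "iid_sample M X Y Xs Ys \<longleftrightarrow>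
     prob_space.indep_vars M (\<lambda>_. borel) (\<lambda>i \<omega>. (Xs i \<omega>, Ys i \<omega>)) {1..} \<and>
     (\<forall>i\<ge>1. distr M borel (\<lambda>\<omega>. (Xs i \<omega>, Ys i \<omega>)) = distr M borel (\<lambda>\<omega>. (X \<omega>, Y \<omega>)))"

definition emp_mean :: "(nat \<Rightarrow> real) \<Rightarrow> nat \<Rightarrow> real" where
  "emp_mean x n = (\<Sum>k=1..n. x k) / real n"

definition pearson :: "(nat \<Rightarrow> real) \<Rightarrow> (nat \<Rightarrow> real) \<Rightarrow> nat \<Rightarrow> real" where
  "pearson x y n =
     (\<Sum>i=1..n. (x i - emp_mean x n) * (y i - emp_mean y n)) /
     sqrt ((\<Sum>i=1..n. (x i - emp_mean x n)\<^sup>2) * (\<Sum>i=1..n. (y i - emp_mean y n)\<^sup>2))"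

(* hbar and gbar are used on the open interval (-1, 1) only.  For |rho| <= rho0
   the map hbar rho l is strictly concave there with derivative running from
   +infinity to -infinity, so r0 is a genuine unique root; then Lfun rho is
   differentiable on the whole line with derivative r0 rho, a strictly
   increasing bijection onto (-1, 1), so lambda_c is a genuine unique solution
   for every c in (-1, 1). *)
definition hbar :: "real \<Rightarrow> real \<Rightarrow> real \<Rightarrow> real" where
  "hbar \<rho> l r = l * r - ln (1 - \<rho> * r) + 1/2 * ln (1 - r\<^sup>2)"

definition gbar :: "real \<Rightarrow> real \<Rightarrow> real" where
  "gbar \<rho> r = (1 - \<rho>\<^sup>2) powr (-1/2) * (1 - \<rho> * r) powr (3/2) * (1 - r\<^sup>2) powi (-2)"

definition r0 :: "real \<Rightarrow> real \<Rightarrow> real" where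
  "r0 \<rho> l = (THE r. -1 < r \<and> r < 1 \<and> deriv (hbar \<rho> l) r = 0)"

definition Lfun :: "real \<Rightarrow> real \<Rightarrow> real" where
  "Lfun \<rho> l = hbar \<rho> l (r0 \<rho> l) + 1/2 * ln (1 - \<rho>\<^sup>2)"

definition lambda_c :: "real \<Rightarrow> real \<Rightarrow> real" where
  "lambda_c \<rho> c = (THE l. deriv (Lfun \<rho>) l = c)"

definition sigma_c :: "real \<Rightarrow> real \<Rightarrow> real" where
  "sigma_c \<rho> c = sqrt (deriv (deriv (Lfun \<rho>)) (lambda_c \<rho> c))"

definition Lstar :: "real \<Rightarrow> real \<Rightarrow> real" where
  "Lstar \<rho> y = ln ((1 - \<rho> * y) / (sqrt (1 - \<rho>\<^sup>2) * sqrt (1 - y\<^sup>2)))"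

definition rho0 :: real where
  "rho0 = sqrt (3 + 2 * sqrt 3) / 3"

end

theory Submission
  imports Defs "HOL-Real_Asymp.Real_Asymp"
begin

text \<open>
  The correlation coefficient is invariant under affine changes of scale, so the sample may be
  replaced by \<open>(U, \<rho> U + sqrt (1 - \<rho>\<^sup>2) V)\<close> with \<open>U\<close>, \<open>V\<close> independent and centred. Adding one observation
  at a time and rotating in the plane (Welford's update for the means, Bartlett's decomposition for
  the centred Gram matrix) gives independent \<open>a\<close>, \<open>z\<close>, \<open>b\<close> with \<open>a\<close>, \<open>b\<close> of chi type with \<open>n - 1\<close> and
  \<open>n - 2\<close> degrees of freedom and \<open>z\<close> Gaussian, such that \<open>r_n \<ge> c\<close> becomes
  \<open>z \<ge> \<tau> b - \<theta> a\<close> with \<open>\<theta> = \<rho> / sqrt (1 - \<rho>\<^sup>2)\<close> and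
  \<open>\<tau> = c / sqrt (1 - c\<^sup>2)\<close>. Linear substitutions turn this
  probability into \<open>(n - 2) 2\<^sup>n\<^sup>-\<^sup>2 / \<pi>\<close> times the integral of \<open>1 / (u phase(t, u)\<^sup>n\<^sup>-\<^sup>1)\<close> over
  \<open>t \<ge> \<tau>\<close>, \<open>u > 0\<close>, where
  \<open>phase(t, u) = sqrt ((1 + \<theta>\<^sup>2) (1 + t\<^sup>2)) (u + 1 / u) - 2 \<theta> t\<close>.
  Its minimum \<open>2 exp (Lstar \<rho> c)\<close> is attained at the boundary point \<open>(\<tau>, 1)\<close>, linearly in \<open>t\<close> and
  quadratically in \<open>u\<close>, and the scaling \<open>t = \<tau> + x / N\<close>, \<open>u = 1 + y / sqrt N\<close> with dominated convergence
  gives the asymptotics. The constants are identified through the Legendre transform: \<open>\<lambda>_c\<close> is the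
  derivative of \<open>Lstar\<close> at \<open>c\<close>, and \<open>\<sigma>_c\<^sup>2\<close> is the inverse of \<open>\<bar>hbar''(c)\<bar>\<close>, so these two factors cancel.
\<close>

section \<open>Gaussian and chi laws\<close>

text \<open>The tail is not approached through the Laplace transform of \<open>r_n\<close>: the
  Cholesky factor of the Gram matrix has an explicit law, so the probability is an exact double
  integral and a single Laplace argument remains. The unconstrained minimum of \<open>phase\<close>
  is at \<open>(\<theta>, 1)\<close>; since \<open>\<rho> < c\<close> gives
  \<open>\<theta> < \<tau>\<close>, the minimum over \<open>t \<ge> \<tau>\<close> moves to the
  boundary. With \<open>N = n - 1\<close>, the boundary direction contributes \<open>1 / N\<close>,
  the interior direction \<open>1 / sqrt N\<close>, and the prefactor is of order \<open>N\<close>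
  once the powers of two cancel; this is the \<open>1 / sqrt n\<close> of the result. The mismatch
  between \<open>n - 1\<close> and \<open>n\<close> in the exponent costs one factor
  \<open>exp (Lstar \<rho> c)\<close>, which enters the constant. Integrals in the reduction of the
  tail are nonnegative throughout, so every exchange of order is an instance of Tonelli. The bound
  \<open>rho0\<close> enters through the definite descriptions: it makes \<open>hbar\<close>
  strictly concave on the open interval, so that \<open>r0\<close> and \<open>lambda_c\<close>
  denote the intended values.\<close>

lemma nn_integral_swap:
  fixes f :: "'a \<Rightarrow> 'b \<Rightarrow> ennreal"
  assumes "sigma_finite_measure M" "sigma_finite_measure N"
    and "case_prod f \<in> borel_measurable (M \<Otimes>\<^sub>M N)"
  shows "(\<integral>\<^sup>+x. \<integral>\<^sup>+y. f x y \<partial>N \<partial>M) = (\<integral>\<^sup>+y. \<integral>\<^sup>+x. f x y \<partial>M \<partial>N)"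
  using pair_sigma_finite.Fubini'[of M N f] assms by (simp add: pair_sigma_finite_def)

text \<open>Variance \<open>1 / 2\<close>: with the weight \<open>exp (- x\<^sup>2)\<close> no powers of two enter the chi densities.\<close>

definition gauss :: "real measure" where
  "gauss = density lborel (\<lambda>x. ennreal (exp (- x\<^sup>2) / sqrt pi))"

lemma sets_gauss [measurable_cong, simp]: "sets gauss = sets borel"
  by (simp add: gauss_def)

lemma space_gauss [simp]: "space gauss = UNIV"
  by (simp add: gauss_def)

lemma gauss_eq_normal_density:
  "gauss = density lborel (normal_density 0 (1 / sqrt 2))"
  by (simp add: gauss_def normal_density_def power_divide real_sqrt_mult algebra_simps)

lemma prob_space_gauss: "prob_space gauss"
  unfolding gauss_eq_normal_density by (rule prob_space_normal_density) simp

interpretation gauss: prob_space gauss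
  by (rule prob_space_gauss)

lemma nn_integral_gauss:
  assumes "f \<in> borel_measurable borel"
  shows "(\<integral>\<^sup>+x. f x \<partial>gauss) = (\<integral>\<^sup>+x. ennreal (exp (- x\<^sup>2) / sqrt pi) * f x \<partial>lborel)"
  using assms unfolding gauss_def by (subst nn_integral_density) auto

lemma gauss_uminus:
  assumes [measurable]: "f \<in> borel_measurable borel"
  shows "(\<integral>\<^sup>+x. f (- x) \<partial>gauss) = (\<integral>\<^sup>+x. f x \<partial>gauss)"
  unfolding nn_integral_gauss[OF assms]
  by (subst nn_integral_gauss, simp, subst (2) nn_integral_real_affine[where c = "-1" and t = 0]) simp_all

text \<open>The rotation is factored into two one-dimensional affine substitutions: the first, in
  \<open>q\<close>, turns the second argument of \<open>f\<close> into the integration variable; the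
  second, in \<open>p\<close>, does the same for the first argument. Their Jacobians
  \<open>1 / c\<close> and \<open>c\<close> cancel, and the Gaussian weight depends on the sum of
  squares alone, which the rotation preserves.\<close>

lemma gauss_rotation:
  assumes [measurable]: "case_prod f \<in> borel_measurable (borel \<Otimes>\<^sub>M borel)"
    and cs: "c\<^sup>2 + s\<^sup>2 = 1" and c: "c > 0"
  shows "(\<integral>\<^sup>+p. \<integral>\<^sup>+q. f (c * p + s * q) (c * q - s * p) \<partial>gauss \<partial>gauss) =
    (\<integral>\<^sup>+p. \<integral>\<^sup>+q. f p q \<partial>gauss \<partial>gauss)"
proof -
  define F where "F p q = ennreal (exp (- p\<^sup>2 - q\<^sup>2) / pi) * f p q" for p q
  have [measurable]: "case_prod F \<in> borel_measurable (borel \<Otimes>\<^sub>M borel)"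
    unfolding F_def by measurable
  have two: "(\<integral>\<^sup>+p. \<integral>\<^sup>+q. g p q \<partial>gauss \<partial>gauss) =
      (\<integral>\<^sup>+p. \<integral>\<^sup>+q. ennreal (exp (- p\<^sup>2 - q\<^sup>2) / pi) * g p q \<partial>lborel \<partial>lborel)"
    if [measurable]: "case_prod g \<in> borel_measurable (borel \<Otimes>\<^sub>M borel)" for g
  proof -
    have "ennreal (exp (- p\<^sup>2 - q\<^sup>2) / pi) = ennreal (exp (- p\<^sup>2) / sqrt pi) * ennreal (exp (- q\<^sup>2) / sqrt pi)" for p q :: real
      by (simp add: exp_add[symmetric] ennreal_mult[symmetric])
    then show ?thesis
      by (simp add: nn_integral_gauss nn_integral_cmult[symmetric] mult.assoc)
  qed
  have sq: "(c * p + s * q)\<^sup>2 + (c * q - s * p)\<^sup>2 = p\<^sup>2 + q\<^sup>2" for p q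
  proof -
    have "(c * p + s * q)\<^sup>2 + (c * q - s * p)\<^sup>2 = (c\<^sup>2 + s\<^sup>2) * (p\<^sup>2 + q\<^sup>2)" by algebra
    then show ?thesis by (simp add: cs)
  qed
  have e1: "c * p + s * (s / c * p + 1 / c * q) = p / c + s / c * q" for p q
    using c cs by (simp add: field_simps power2_eq_square) (metis distrib_left mult.left_commute mult.right_neutral)
  have e2: "c * (s / c * p + 1 / c * q) - s * p = q" for p q
    using c by (simp add: field_simps)
  have e3: "(- s * q + c * p) / c + s / c * q = p" for p q
    using c by (simp add: field_simps)
  have "(\<integral>\<^sup>+p. \<integral>\<^sup>+q. f (c * p + s * q) (c * q - s * p) \<partial>gauss \<partial>gauss) =
      (\<integral>\<^sup>+p. \<integral>\<^sup>+q. F (c * p + s * q) (c * q - s * p) \<partial>lborel \<partial>lborel)"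
  proof (subst two)
    have "- (c * p + s * q)\<^sup>2 - (c * q - s * p)\<^sup>2 = - p\<^sup>2 - q\<^sup>2" for p q
      using sq[of p q] by simp
    then show "(\<integral>\<^sup>+p. \<integral>\<^sup>+q. ennreal (exp (- p\<^sup>2 - q\<^sup>2) / pi) * f (c * p + s * q) (c * q - s * p) \<partial>lborel \<partial>lborel) =
      (\<integral>\<^sup>+p. \<integral>\<^sup>+q. F (c * p + s * q) (c * q - s * p) \<partial>lborel \<partial>lborel)"
      by (simp add: F_def)
  qed measurable
  also have "\<dots> = (\<integral>\<^sup>+p. \<integral>\<^sup>+q. ennreal (1 / c) * F (p / c + s / c * q) q \<partial>lborel \<partial>lborel)"
  proof (rule nn_integral_cong)
    fix p
    have "(\<integral>\<^sup>+q. F (c * p + s * q) (c * q - s * p) \<partial>lborel) =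
        ennreal \<bar>1 / c\<bar> * (\<integral>\<^sup>+q. F (c * p + s * (s / c * p + 1 / c * q)) (c * (s / c * p + 1 / c * q) - s * p) \<partial>lborel)"
      using c by (intro nn_integral_real_affine) auto
    then show "(\<integral>\<^sup>+q. F (c * p + s * q) (c * q - s * p) \<partial>lborel) =
        (\<integral>\<^sup>+q. ennreal (1 / c) * F (p / c + s / c * q) q \<partial>lborel)"
      using c unfolding e1 e2 by (simp add: nn_integral_cmult)
  qed
  also have "\<dots> = (\<integral>\<^sup>+q. \<integral>\<^sup>+p. ennreal (1 / c) * F (p / c + s / c * q) q \<partial>lborel \<partial>lborel)"
    by (rule nn_integral_swap) (auto intro: lborel.sigma_finite_measure_axioms)
  also have "\<dots> = (\<integral>\<^sup>+q. \<integral>\<^sup>+p. F p q \<partial>lborel \<partial>lborel)"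
  proof (rule nn_integral_cong)
    fix q
    have "(\<integral>\<^sup>+p. ennreal (1 / c) * F (p / c + s / c * q) q \<partial>lborel) =
        ennreal \<bar>c\<bar> * (\<integral>\<^sup>+p. ennreal (1 / c) * F ((- s * q + c * p) / c + s / c * q) q \<partial>lborel)"
      using c by (intro nn_integral_real_affine) auto
    then show "(\<integral>\<^sup>+p. ennreal (1 / c) * F (p / c + s / c * q) q \<partial>lborel) = (\<integral>\<^sup>+p. F p q \<partial>lborel)"
      using c unfolding e3 by (simp add: nn_integral_cmult mult.assoc[symmetric] ennreal_mult[symmetric])
  qed
  also have "\<dots> = (\<integral>\<^sup>+p. \<integral>\<^sup>+q. F p q \<partial>lborel \<partial>lborel)"
    by (rule nn_integral_swap) (auto intro: lborel.sigma_finite_measure_axioms)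
  also have "\<dots> = (\<integral>\<^sup>+p. \<integral>\<^sup>+q. f p q \<partial>gauss \<partial>gauss)"
    unfolding F_def by (subst two) simp_all
  finally show ?thesis .
qed

section \<open>Half-line Gaussian moments and chi laws\<close>

definition half_moment :: "nat \<Rightarrow> real" where
  "half_moment k = (LINT x|lborel. indicator {0..} x *\<^sub>R (exp (- x\<^sup>2) * x ^ k))"

lemma half_moment_even: "half_moment (2 * k) = sqrt pi / 2 * (fact (2 * k) / (2 ^ (2 * k) * fact k))"
  unfolding half_moment_def by (rule has_bochner_integral_integral_eq[OF gaussian_moment_even_pos])

lemma half_moment_odd: "half_moment (Suc (2 * k)) = fact k / 2"
  unfolding half_moment_def Suc_eq_plus1 by (rule has_bochner_integral_integral_eq[OF gaussian_moment_odd_pos])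

lemma half_moment_0: "half_moment 0 = sqrt pi / 2"
  using half_moment_even[of 0] by simp

lemma half_moment_pos: "half_moment k > 0"
  by (cases "even k") (auto elim!: evenE oddE simp: half_moment_even half_moment_odd)

text \<open>Since \<open>half_moment k\<close> is \<open>Gamma ((k + 1) / 2) / 2\<close>, this is
  Legendre's duplication formula. It merges the normalising constants of two consecutive chi laws
  into one expression that no longer depends on the parity of \<open>k\<close>.\<close>

lemma half_moment_product: "half_moment k * half_moment (Suc k) = sqrt pi * fact k / (4 * 2 ^ k)"
proof (cases "even k")
  case True
  then obtain j where "k = 2 * j" by (auto elim: evenE)
  then show ?thesis
    by (simp add: half_moment_even half_moment_odd)
next
  case False
  then obtain j where k: "k = Suc (2 * j)" by (auto elim: oddE)
  then have "Suc k = 2 * Suc j" by simp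
  then have "half_moment (Suc k) = sqrt pi / 2 * (fact (2 * Suc j) / (2 ^ (2 * Suc j) * fact (Suc j)))"
    by (simp only: half_moment_even)
  also have "\<dots> = sqrt pi / 2 * ((2 * (1 + real j) * fact k) / (2 * 2 ^ k * ((1 + real j) * fact j)))"
    by (simp add: k algebra_simps)
  also have "\<dots> = sqrt pi / 2 * (fact k / (2 ^ k * fact j))"
    by (simp add: divide_simps)
  finally show ?thesis
    unfolding k half_moment_odd by simp
qed

lemma nn_integral_half_moment:
  "(\<integral>\<^sup>+x. ennreal (x ^ k * exp (- x\<^sup>2)) * indicator {0<..} x \<partial>lborel) = ennreal (half_moment k)"
proof -
  have "integrable lborel (\<lambda>x::real. indicator {0..} x *\<^sub>R (exp (- x\<^sup>2) * x ^ k))"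
  proof (cases "even k")
    case True
    then show ?thesis using gaussian_moment_even_pos by (auto elim!: evenE simp: has_bochner_integral_iff)
  next
    case False
    then show ?thesis using gaussian_moment_odd_pos by (auto elim!: oddE simp: has_bochner_integral_iff)
  qed
  then have "(\<integral>\<^sup>+x. ennreal (indicator {0..} x *\<^sub>R (exp (- x\<^sup>2) * x ^ k)) \<partial>lborel) = ennreal (half_moment k)"
    unfolding half_moment_def by (rule nn_integral_eq_integral) (auto simp: indicator_def)
  also have "(\<integral>\<^sup>+x. ennreal (indicator {0..} x *\<^sub>R (exp (- x\<^sup>2) * x ^ k)) \<partial>lborel) =
      (\<integral>\<^sup>+x. ennreal (x ^ k * exp (- x\<^sup>2)) * indicator {0<..} x \<partial>lborel)"
    by (intro nn_integral_cong_AE AE_I[where N = "{0}"]) (auto simp: indicator_def mult.commute split: if_splits)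
  finally show ?thesis .
qed

text \<open>\<open>chi k\<close> is the law of the Euclidean norm of \<open>k\<close> independent \<open>gauss\<close> variables;
  \<open>chi 0\<close> is the Dirac mass at \<open>0\<close>.\<close>

definition chi :: "nat \<Rightarrow> real measure" where
  "chi k = (case k of 0 \<Rightarrow> return borel 0 | Suc d \<Rightarrow>
     density lborel (\<lambda>x. ennreal (x ^ d * exp (- x\<^sup>2) / half_moment d) * indicator {0<..} x))"

lemma sets_chi [measurable_cong, simp]: "sets (chi k) = sets borel"
  by (simp add: chi_def split: nat.split)

lemma space_chi [simp]: "space (chi k) = UNIV"
  by (simp add: chi_def split: nat.split)

lemma nn_integral_chi_0:
  assumes "f \<in> borel_measurable borel"
  shows "(\<integral>\<^sup>+x. f x \<partial>chi 0) = f 0"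
  using assms by (simp add: chi_def nn_integral_return)

lemma nn_integral_chi_Suc:
  assumes "f \<in> borel_measurable borel"
  shows "(\<integral>\<^sup>+x. f x \<partial>chi (Suc d)) =
    (\<integral>\<^sup>+x. ennreal (x ^ d * exp (- x\<^sup>2) / half_moment d) * indicator {0<..} x * f x \<partial>lborel)"
  using assms unfolding chi_def nat.case by (subst nn_integral_density) auto

lemma prob_space_chi: "prob_space (chi k)"
proof (cases k)
  case 0
  then show ?thesis by (simp add: chi_def prob_space_return)
next
  case (Suc d)
  have "(\<integral>\<^sup>+x. 1 \<partial>chi (Suc d)) =
      (\<integral>\<^sup>+x. ennreal (1 / half_moment d) * (ennreal (x ^ d * exp (- x\<^sup>2)) * indicator {0<..} x) \<partial>lborel)"
    using half_moment_pos[of d] unfolding nn_integral_chi_Suc[OF borel_measurable_const]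
    by (intro nn_integral_cong) (auto simp: indicator_def ennreal_mult'[symmetric])
  also have "\<dots> = 1"
    using half_moment_pos[of d]
    by (simp add: nn_integral_cmult nn_integral_half_moment ennreal_mult[symmetric])
  finally show ?thesis
    unfolding Suc by (intro prob_spaceI) simp
qed

interpretation chi: prob_space "chi k" for k
  by (rule prob_space_chi)

lemma AE_chi_pos: "AE x in chi (Suc d). x > 0"
  unfolding chi_def nat.case by (subst AE_density) (auto simp: indicator_def split: if_splits)

text \<open>Substituting \<open>x = a w\<close> and then \<open>s = a sqrt (1 + w^2)\<close> makes
  the exponent depend on \<open>s\<close> alone, so the double integral splits into a radial
  integral and a constant. For \<open>k = 0\<close> the claim is the folding of \<open>gauss\<close>
  at the origin.\<close>

lemma chi_convolution:
  assumes [measurable]: "f \<in> borel_measurable borel"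
  shows "(\<integral>\<^sup>+a. \<integral>\<^sup>+x. f (sqrt (a\<^sup>2 + x\<^sup>2)) \<partial>gauss \<partial>chi k) = (\<integral>\<^sup>+a. f a \<partial>chi (Suc k))"
proof (cases k)
  case 0
  let ?g = "\<lambda>x. ennreal (exp (- x\<^sup>2) / sqrt pi) * f \<bar>x\<bar>"
  have "(\<integral>\<^sup>+x. ?g x \<partial>lborel) = (\<integral>\<^sup>+x. ?g x * indicator {0<..} x + ?g x * indicator {..<0} x \<partial>lborel)"
    by (intro nn_integral_cong_AE AE_I[where N = "{0}"]) (auto simp: indicator_def split: if_splits)
  also have "\<dots> = (\<integral>\<^sup>+x. ?g x * indicator {0<..} x \<partial>lborel) + (\<integral>\<^sup>+x. ?g x * indicator {..<0} x \<partial>lborel)"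
    by (rule nn_integral_add) auto
  also have "(\<integral>\<^sup>+x. ?g x * indicator {..<0} x \<partial>lborel) = (\<integral>\<^sup>+x. ?g x * indicator {0<..} x \<partial>lborel)"
    by (subst nn_integral_real_affine[where c = "-1" and t = 0]) (auto simp: indicator_def intro!: nn_integral_cong)
  also have "(\<integral>\<^sup>+x. ?g x * indicator {0<..} x \<partial>lborel) + (\<integral>\<^sup>+x. ?g x * indicator {0<..} x \<partial>lborel) =
      (\<integral>\<^sup>+x. 2 * (?g x * indicator {0<..} x) \<partial>lborel)"
    by (subst nn_integral_cmult) (auto simp: mult_2)
  also have "\<dots> = (\<integral>\<^sup>+x. ennreal (x ^ 0 * exp (- x\<^sup>2) / half_moment 0) * indicator {0<..} x * f x \<partial>lborel)"
    by (intro nn_integral_cong)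
      (auto simp: indicator_def half_moment_0 mult.commute[of 2] mult.assoc[symmetric] ennreal_mult[symmetric]
        simp flip: ennreal_numeral)
  finally show ?thesis
    by (simp add: 0 nn_integral_chi_0 nn_integral_chi_Suc nn_integral_gauss)
next
  case (Suc d)
  define h where "h = half_moment d"
  have h: "h > 0" by (simp add: h_def half_moment_pos)
  define \<kappa> where "\<kappa> = (\<integral>\<^sup>+w. ennreal (1 / (h * sqrt pi * sqrt (1 + w\<^sup>2) ^ (d + 2))) \<partial>lborel)"
  have main: "(\<integral>\<^sup>+a. \<integral>\<^sup>+x. f (sqrt (a\<^sup>2 + x\<^sup>2)) \<partial>gauss \<partial>chi (Suc d)) =
      \<kappa> * (\<integral>\<^sup>+s. ennreal (s ^ Suc d * exp (- s\<^sup>2)) * indicator {0<..} s * f s \<partial>lborel)"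
    if [measurable]: "f \<in> borel_measurable borel" for f
  proof -
    define G where "G a x = ennreal (a ^ d * exp (- a\<^sup>2) / h) * indicator {0<..} a *
      (ennreal (exp (- x\<^sup>2) / sqrt pi) * f (sqrt (a\<^sup>2 + x\<^sup>2)))" for a x
    have [measurable]: "case_prod G \<in> borel_measurable (borel \<Otimes>\<^sub>M borel)"
      unfolding G_def by measurable
    have "(\<integral>\<^sup>+a. \<integral>\<^sup>+x. f (sqrt (a\<^sup>2 + x\<^sup>2)) \<partial>gauss \<partial>chi (Suc d)) =
      (\<integral>\<^sup>+a. \<integral>\<^sup>+x. G a x \<partial>lborel \<partial>lborel)"
      by (simp add: nn_integral_chi_Suc nn_integral_gauss G_def h_def nn_integral_cmult)
    also have "\<dots> = (\<integral>\<^sup>+a. \<integral>\<^sup>+w. ennreal a * G a (a * w) \<partial>lborel \<partial>lborel)"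
    proof (rule nn_integral_cong)
      fix a :: real
      show "(\<integral>\<^sup>+x. G a x \<partial>lborel) = (\<integral>\<^sup>+w. ennreal a * G a (a * w) \<partial>lborel)"
      proof (cases "a > 0")
        case True
        then show ?thesis
          by (subst nn_integral_real_affine[where c = a and t = 0]) (auto simp: nn_integral_cmult)
      qed (simp add: G_def)
    qed
    also have "\<dots> = (\<integral>\<^sup>+w. \<integral>\<^sup>+a. ennreal a * G a (a * w) \<partial>lborel \<partial>lborel)"
      by (rule nn_integral_swap) (auto intro: lborel.sigma_finite_measure_axioms)
    also have "\<dots> = (\<integral>\<^sup>+w. \<integral>\<^sup>+s. ennreal (1 / (h * sqrt pi * sqrt (1 + w\<^sup>2) ^ (d + 2))) *
        (ennreal (s ^ Suc d * exp (- s\<^sup>2)) * indicator {0<..} s * f s) \<partial>lborel \<partial>lborel)"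
    proof (rule nn_integral_cong)
      fix w :: real
      define r where "r = sqrt (1 + w\<^sup>2)"
      have r: "r > 0" by (simp add: r_def add_pos_nonneg)
      have r2: "r\<^sup>2 = 1 + w\<^sup>2" by (simp add: r_def)
      have sq: "(s / r)\<^sup>2 + (s / r * w)\<^sup>2 = s\<^sup>2" for s
      proof -
        have "(s / r)\<^sup>2 + (s / r * w)\<^sup>2 = s\<^sup>2 * (1 + w\<^sup>2) / r\<^sup>2"
          by (simp add: power_divide power_mult_distrib add_divide_distrib algebra_simps)
        then show ?thesis using r by (simp add: r2[symmetric])
      qed
      have e: "exp (- (s / r)\<^sup>2) * exp (- (s / r * w)\<^sup>2) = exp (- s\<^sup>2)" for s
        using sq[of s] by (simp add: exp_add[symmetric])
      have "(\<integral>\<^sup>+a. ennreal a * G a (a * w) \<partial>lborel) =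
          ennreal \<bar>1 / r\<bar> * (\<integral>\<^sup>+s. ennreal (0 + 1 / r * s) * G (0 + 1 / r * s) ((0 + 1 / r * s) * w) \<partial>lborel)"
        using r by (intro nn_integral_real_affine) auto
      also have "\<dots> = (\<integral>\<^sup>+s. ennreal (1 / r) * (ennreal (s / r) * G (s / r) (s / r * w)) \<partial>lborel)"
        using r by (subst nn_integral_cmult[symmetric]) auto
      also have "\<dots> = (\<integral>\<^sup>+s. ennreal (1 / (h * sqrt pi * r ^ (d + 2))) *
        (ennreal (s ^ Suc d * exp (- s\<^sup>2)) * indicator {0<..} s * f s) \<partial>lborel)"
      proof (rule nn_integral_cong)
        fix s :: real
        show "ennreal (1 / r) * (ennreal (s / r) * G (s / r) (s / r * w)) =
          ennreal (1 / (h * sqrt pi * r ^ (d + 2))) * (ennreal (s ^ Suc d * exp (- s\<^sup>2)) * indicator {0<..} s * f s)"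
        proof (cases "s > 0")
          case True
          then have "1 / r * (s / r) * ((s / r) ^ d * exp (- (s / r)\<^sup>2) / h) * (exp (- (s / r * w)\<^sup>2) / sqrt pi) =
              1 / (h * sqrt pi * r ^ (d + 2)) * (s ^ Suc d * exp (- s\<^sup>2))"
            using r h by (simp add: e[symmetric] power_divide mult_ac)
          moreover have "sqrt ((s / r)\<^sup>2 + (s / r * w)\<^sup>2) = s"
            using True unfolding sq by simp
          ultimately show ?thesis
            using True r h by (simp add: G_def mult.assoc[symmetric] ennreal_mult[symmetric])
        qed (use r in \<open>auto simp: G_def indicator_def zero_less_divide_iff\<close>)
      qed
      finally show "(\<integral>\<^sup>+a. ennreal a * G a (a * w) \<partial>lborel) =
        (\<integral>\<^sup>+s. ennreal (1 / (h * sqrt pi * sqrt (1 + w\<^sup>2) ^ (d + 2))) *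
          (ennreal (s ^ Suc d * exp (- s\<^sup>2)) * indicator {0<..} s * f s) \<partial>lborel)"
        by (simp add: r_def)
    qed
    also have "\<dots> = \<kappa> * (\<integral>\<^sup>+s. ennreal (s ^ Suc d * exp (- s\<^sup>2)) * indicator {0<..} s * f s \<partial>lborel)"
      unfolding \<kappa>_def by (simp add: nn_integral_cmult nn_integral_multc)
    finally show ?thesis .
  qed
  \<comment> \<open>The integral over \<open>w\<close> is never evaluated: the choice
    \<open>f = 1\<close> compares total masses and thereby fixes it.\<close>
  have "\<kappa> * ennreal (half_moment (Suc d)) = 1"
    using main[of "\<lambda>_. 1"] nn_integral_half_moment[of "Suc d"] by (simp add: gauss.emeasure_space_1[simplified] chi.emeasure_space_1[simplified])
  then have \<kappa>: "\<kappa> = ennreal (1 / half_moment (Suc d))"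
    using half_moment_pos[of "Suc d"]
    by (metis divide_ennreal ennreal_1 ennreal_eq_0_iff ennreal_mult_divide_eq ennreal_neq_top less_le_not_le zero_le_one)
  have "(\<integral>\<^sup>+a. f a \<partial>chi (Suc (Suc d))) = \<kappa> * (\<integral>\<^sup>+s. ennreal (s ^ Suc d * exp (- s\<^sup>2)) *
    indicator {0<..} s * f s \<partial>lborel)"
    unfolding nn_integral_chi_Suc[OF assms] \<kappa> using half_moment_pos[of "Suc d"]
    by (subst nn_integral_cmult[symmetric])
      (auto intro!: nn_integral_cong simp: mult.assoc[symmetric] ennreal_mult'[symmetric] indicator_def)
  then show ?thesis
    using main[OF assms] Suc by simp
qed

section \<open>The Bartlett decomposition\<close>

abbreviation borel3 :: "(real \<times> real \<times> real) measure" where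
  "borel3 \<equiv> borel \<Otimes>\<^sub>M (borel \<Otimes>\<^sub>M borel)"

abbreviation gauss2 :: "(real \<times> real) measure" where
  "gauss2 \<equiv> gauss \<Otimes>\<^sub>M gauss"

text \<open>A state \<open>(a, z, b)\<close> encodes the Gram matrix with entries \<open>a\<^sup>2\<close>, \<open>a z\<close>, \<open>z\<^sup>2 + b\<^sup>2\<close>
  through its Cholesky factor. A step adds the rank one matrix of \<open>(x, y)\<close>; it rotates \<open>(z, y)\<close> by the angle of \<open>(a, x)\<close>.\<close>

definition bartlett_step :: "real \<times> real \<times> real \<Rightarrow> real \<times> real \<Rightarrow> real \<times> real \<times> real" where
  "bartlett_step = (\<lambda>(a, z, b) (x, y). let r = sqrt (a\<^sup>2 + x\<^sup>2) in
     if r = 0 then (0, z, sqrt (b\<^sup>2 + y\<^sup>2))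
     else (r, a / r * z + x / r * y, sqrt (b\<^sup>2 + (a / r * y - x / r * z)\<^sup>2)))"

text \<open>The degrees of freedom of \<open>b\<close> lag by one because a Gram matrix of a single
  increment has rank one, and \<open>chi 0\<close> then places \<open>b\<close> at 0. The zero
  matrix is a case of its own, since \<open>z\<close> is Gaussian only from the first increment
  on.\<close>

definition bartlett_law :: "nat \<Rightarrow> (real \<times> real \<times> real) measure" where
  "bartlett_law k = (case k of 0 \<Rightarrow> return borel3 (0, 0, 0) |
     Suc d \<Rightarrow> chi (Suc d) \<Otimes>\<^sub>M (gauss \<Otimes>\<^sub>M chi d))"

lemma sets_bartlett_law [measurable_cong]: "sets (bartlett_law k) = sets borel3"
proof (cases k)
  case (Suc d)
  then show ?thesis by (simp only: bartlett_law_def nat.case) (intro sets_pair_measure_cong sets_chi sets_gauss)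
qed (simp add: bartlett_law_def)

lemma prob_space_bartlett_law: "prob_space (bartlett_law k)"
proof (cases k)
  case (Suc d)
  interpret p1: pair_prob_space gauss "chi d" ..
  interpret p2: pair_prob_space "chi (Suc d)" "gauss \<Otimes>\<^sub>M chi d" ..
  show ?thesis unfolding Suc bartlett_law_def nat.case by (rule p2.prob_space_axioms)
qed (auto simp: bartlett_law_def space_pair_measure intro: prob_space_return)

interpretation bartlett_law: prob_space "bartlett_law k" for k
  by (rule prob_space_bartlett_law)

lemma bartlett_step_measurable [measurable]:
  "case_prod bartlett_step \<in> borel3 \<Otimes>\<^sub>M (borel \<Otimes>\<^sub>M borel) \<rightarrow>\<^sub>M borel3"
  unfolding bartlett_step_def Let_def split_beta' by measurable

lemma bartlett_step_Pair_measurable [measurable (raw)]: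
  assumes [measurable]: "f \<in> M \<rightarrow>\<^sub>M borel3" "g \<in> M \<rightarrow>\<^sub>M borel \<Otimes>\<^sub>M borel"
  shows "(\<lambda>x. bartlett_step (f x) (g x)) \<in> M \<rightarrow>\<^sub>M borel3"
  using measurable_compose[OF measurable_Pair[OF assms] bartlett_step_measurable] by simp

lemma nn_integral_bartlett_law_Suc:
  assumes "f \<in> borel_measurable borel3"
  shows "(\<integral>\<^sup>+d. f d \<partial>bartlett_law (Suc k)) = (\<integral>\<^sup>+a. \<integral>\<^sup>+z. \<integral>\<^sup>+b. f (a, z, b)
    \<partial>chi k \<partial>gauss \<partial>chi (Suc k))"
proof -
  interpret p1: pair_prob_space gauss "chi k" ..
  interpret p2: pair_prob_space "chi (Suc k)" "gauss \<Otimes>\<^sub>M chi k" ..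
  have [measurable]: "f \<in> borel_measurable (chi (Suc k) \<Otimes>\<^sub>M (gauss \<Otimes>\<^sub>M chi k))"
    using assms by (rule subst[OF measurable_cong_sets, rotated 2]) (intro sets_pair_measure_cong sets_chi sets_gauss sets_chi[symmetric] sets_gauss[symmetric] refl)+
  show ?thesis
    unfolding bartlett_law_def nat.case
    by (subst sigma_finite_measure.nn_integral_fst[OF p1.sigma_finite_measure_axioms, symmetric], simp,
        subst chi.nn_integral_fst[symmetric]) auto
qed

lemma nn_integral_gauss_gauss:
  assumes [measurable]: "f \<in> borel_measurable (borel \<Otimes>\<^sub>M borel)"
  shows "(\<integral>\<^sup>+w. f w \<partial>gauss2) = (\<integral>\<^sup>+x. \<integral>\<^sup>+y. f (x, y) \<partial>gauss \<partial>gauss)"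
  by (subst gauss.nn_integral_fst[symmetric]) auto

text \<open>From the zero state the rotation only carries the sign of \<open>x\<close> over to
  \<open>y\<close>, and the symmetry of \<open>gauss\<close> absorbs it. The default branch
  \<open>x = 0\<close> is a null event.\<close>

lemma bartlett_law_step_0:
  assumes [measurable]: "g \<in> borel_measurable borel3"
  shows "(\<integral>\<^sup>+w. \<integral>\<^sup>+d. g (bartlett_step d w) \<partial>bartlett_law 0 \<partial>gauss2) = (\<integral>\<^sup>+d. g d \<partial>bartlett_law (Suc 0))"
proof -
  have "(\<integral>\<^sup>+w. \<integral>\<^sup>+d. g (bartlett_step d w) \<partial>bartlett_law 0 \<partial>gauss2) =
      (\<integral>\<^sup>+w. g (bartlett_step (0, 0, 0) w) \<partial>gauss2)"
    by (intro nn_integral_cong) (simp add: bartlett_law_def nn_integral_return space_pair_measure)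
  also have "\<dots> = (\<integral>\<^sup>+x. \<integral>\<^sup>+y. g (bartlett_step (0, 0, 0) (x, y)) \<partial>gauss \<partial>gauss)"
    by (rule nn_integral_gauss_gauss) measurable
  also have "\<dots> = (\<integral>\<^sup>+x. \<integral>\<^sup>+y. g (\<bar>x\<bar>, y, 0) \<partial>gauss \<partial>gauss)"
  proof (rule nn_integral_cong_AE)
    have "AE x in gauss. x \<noteq> 0"
      unfolding gauss_def by (subst AE_density) (auto intro: AE_I[where N = "{0}"])
    then show "AE x in gauss. (\<integral>\<^sup>+y. g (bartlett_step (0, 0, 0) (x, y)) \<partial>gauss) = (\<integral>\<^sup>+y. g (\<bar>x\<bar>, y, 0) \<partial>gauss)"
    proof eventually_elim
      case (elim x)
      show ?case
      proof (cases "x > 0")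
        case True
        then show ?thesis by (simp add: bartlett_step_def)
      next
        case False
        then have "(\<integral>\<^sup>+y. g (bartlett_step (0, 0, 0) (x, y)) \<partial>gauss) = (\<integral>\<^sup>+y. g (\<bar>x\<bar>, - y, 0) \<partial>gauss)"
          using elim by (intro nn_integral_cong) (simp add: bartlett_step_def)
        also have "\<dots> = (\<integral>\<^sup>+y. g (\<bar>x\<bar>, y, 0) \<partial>gauss)"
          by (rule gauss_uminus) measurable
        finally show ?thesis .
      qed
    qed
  qed
  also have "\<dots> = (\<integral>\<^sup>+a. \<integral>\<^sup>+x. \<integral>\<^sup>+y. g (sqrt (a\<^sup>2 + x\<^sup>2), y, 0) \<partial>gauss \<partial>gauss \<partial>chi 0)"
    by (subst nn_integral_chi_0) auto
  also have "\<dots> = (\<integral>\<^sup>+a. \<integral>\<^sup>+y. g (a, y, 0) \<partial>gauss \<partial>chi (Suc 0))"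
    by (rule chi_convolution) measurable
  also have "\<dots> = (\<integral>\<^sup>+d. g d \<partial>bartlett_law (Suc 0))"
    by (subst nn_integral_bartlett_law_Suc) (auto intro!: nn_integral_cong simp: nn_integral_chi_0)
  finally show ?thesis .
qed

text \<open>The integrals are reordered until, for fixed \<open>a\<close> and \<open>x\<close>, the
  pair \<open>(z, y)\<close> is integrated outside \<open>b\<close>. As
  \<open>(a / r, x / r)\<close> is a unit vector with positive first entry, the rotation replaces
  \<open>(z, y)\<close> by a fresh Gaussian pair \<open>(z, w)\<close>. Then \<open>x\<close> is
  absorbed into \<open>a\<close> and \<open>w\<close> into \<open>b\<close>, each by one chi
  convolution.\<close>

lemma bartlett_law_step_Suc:
  assumes [measurable]: "g \<in> borel_measurable borel3"
  shows "(\<integral>\<^sup>+w. \<integral>\<^sup>+d. g (bartlett_step d w) \<partial>bartlett_law (Suc k) \<partial>gauss2) =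
    (\<integral>\<^sup>+d. g d \<partial>bartlett_law (Suc (Suc k)))"
proof -
  note sf = gauss.sigma_finite_measure_axioms chi.sigma_finite_measure_axioms
    bartlett_law.sigma_finite_measure_axioms
  interpret G2: pair_prob_space gauss gauss ..
  have "(\<integral>\<^sup>+w. \<integral>\<^sup>+d. g (bartlett_step d w) \<partial>bartlett_law (Suc k) \<partial>gauss2) =
      (\<integral>\<^sup>+d. \<integral>\<^sup>+w. g (bartlett_step d w) \<partial>gauss2 \<partial>bartlett_law (Suc k))"
    by (intro nn_integral_swap sf G2.sigma_finite_measure_axioms) measurable
  also have "\<dots> = (\<integral>\<^sup>+a. \<integral>\<^sup>+z. \<integral>\<^sup>+b. \<integral>\<^sup>+x. \<integral>\<^sup>+y. g
    (bartlett_step (a, z, b) (x, y)) \<partial>gauss \<partial>gauss \<partial>chi k \<partial>gauss \<partial>chi (Suc k))"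
    by (subst nn_integral_bartlett_law_Suc, measurable, intro nn_integral_cong nn_integral_gauss_gauss) measurable
  also have "\<dots> = (\<integral>\<^sup>+a. \<integral>\<^sup>+z. \<integral>\<^sup>+x. \<integral>\<^sup>+b. \<integral>\<^sup>+y. g
    (bartlett_step (a, z, b) (x, y)) \<partial>gauss \<partial>chi k \<partial>gauss \<partial>gauss \<partial>chi (Suc k))"
    by (intro nn_integral_cong nn_integral_swap sf) measurable
  also have "\<dots> = (\<integral>\<^sup>+a. \<integral>\<^sup>+z. \<integral>\<^sup>+x. \<integral>\<^sup>+y. \<integral>\<^sup>+b. g
    (bartlett_step (a, z, b) (x, y)) \<partial>chi k \<partial>gauss \<partial>gauss \<partial>gauss \<partial>chi (Suc k))"
    by (intro nn_integral_cong nn_integral_swap sf) measurable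
  also have "\<dots> = (\<integral>\<^sup>+a. \<integral>\<^sup>+x. \<integral>\<^sup>+z. \<integral>\<^sup>+y. \<integral>\<^sup>+b. g
    (bartlett_step (a, z, b) (x, y)) \<partial>chi k \<partial>gauss \<partial>gauss \<partial>gauss \<partial>chi (Suc k))"
    by (intro nn_integral_cong nn_integral_swap sf) measurable
  also have "\<dots> = (\<integral>\<^sup>+a. \<integral>\<^sup>+x. \<integral>\<^sup>+z. \<integral>\<^sup>+w. \<integral>\<^sup>+b. g (sqrt
    (a\<^sup>2 + x\<^sup>2), z, sqrt (b\<^sup>2 + w\<^sup>2)) \<partial>chi k \<partial>gauss \<partial>gauss \<partial>gauss \<partial>chi (Suc k))"
  proof (rule nn_integral_cong_AE)
    show "AE a in chi (Suc k). (\<integral>\<^sup>+x. \<integral>\<^sup>+z. \<integral>\<^sup>+y. \<integral>\<^sup>+b. g (bartlett_step (a, z, b)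
      (x, y)) \<partial>chi k \<partial>gauss \<partial>gauss \<partial>gauss) =
      (\<integral>\<^sup>+x. \<integral>\<^sup>+z. \<integral>\<^sup>+w. \<integral>\<^sup>+b. g (sqrt (a\<^sup>2 + x\<^sup>2), z, sqrt (b\<^sup>2 +
        w\<^sup>2)) \<partial>chi k \<partial>gauss \<partial>gauss \<partial>gauss)"
      using AE_chi_pos
    proof eventually_elim
      case (elim a)
      show ?case
      proof (rule nn_integral_cong)
        fix x :: real
        define r where "r = sqrt (a\<^sup>2 + x\<^sup>2)"
        have r: "r > 0" using elim by (simp add: r_def add_pos_nonneg)
        have r2: "r\<^sup>2 = a\<^sup>2 + x\<^sup>2" by (simp add: r_def)
        have "(\<integral>\<^sup>+z. \<integral>\<^sup>+y. \<integral>\<^sup>+b. g (bartlett_step (a, z, b) (x, y)) \<partial>chi k \<partial>gauss \<partial>gauss) =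
            (\<integral>\<^sup>+z. \<integral>\<^sup>+y. \<integral>\<^sup>+b. g (r, a / r * z + x / r * y, sqrt (b\<^sup>2 + (a / r * y - x / r *
              z)\<^sup>2)) \<partial>chi k \<partial>gauss \<partial>gauss)"
          using r by (intro nn_integral_cong) (simp add: bartlett_step_def r_def[symmetric] Let_def del: real_sqrt_eq_zero_cancel_iff)
        also have "\<dots> = (\<integral>\<^sup>+z. \<integral>\<^sup>+w. \<integral>\<^sup>+b. g (r, z, sqrt (b\<^sup>2 + w\<^sup>2)) \<partial>chi
          k \<partial>gauss \<partial>gauss)"
        proof (rule gauss_rotation)
          show "(a / r)\<^sup>2 + (x / r)\<^sup>2 = 1"
            using r by (simp add: power_divide add_divide_distrib[symmetric] r2[symmetric])
        qed (use r elim in auto)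
        finally show "(\<integral>\<^sup>+z. \<integral>\<^sup>+y. \<integral>\<^sup>+b. g (bartlett_step (a, z, b) (x, y)) \<partial>chi k \<partial>gauss \<partial>gauss) =
          (\<integral>\<^sup>+z. \<integral>\<^sup>+w. \<integral>\<^sup>+b. g (sqrt (a\<^sup>2 + x\<^sup>2), z, sqrt (b\<^sup>2 + w\<^sup>2))
            \<partial>chi k \<partial>gauss \<partial>gauss)"
          by (simp add: r_def)
      qed
    qed
  qed
  also have "\<dots> = (\<integral>\<^sup>+a. \<integral>\<^sup>+z. \<integral>\<^sup>+w. \<integral>\<^sup>+b. g (a, z, sqrt (b\<^sup>2 +
    w\<^sup>2)) \<partial>chi k \<partial>gauss \<partial>gauss \<partial>chi (Suc (Suc k)))"
    by (rule chi_convolution[where f = "\<lambda>a. (\<integral>\<^sup>+z. \<integral>\<^sup>+w. \<integral>\<^sup>+b. g (a, z, sqrt (b\<^sup>2 +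
      w\<^sup>2)) \<partial>chi k \<partial>gauss \<partial>gauss)"]) measurable
  also have "\<dots> = (\<integral>\<^sup>+a. \<integral>\<^sup>+z. \<integral>\<^sup>+b. g (a, z, b) \<partial>chi (Suc k) \<partial>gauss \<partial>chi (Suc (Suc k)))"
  proof (intro nn_integral_cong)
    fix a z :: real
    have "(\<integral>\<^sup>+w. \<integral>\<^sup>+b. g (a, z, sqrt (b\<^sup>2 + w\<^sup>2)) \<partial>chi k \<partial>gauss) =
      (\<integral>\<^sup>+b. \<integral>\<^sup>+w. g (a, z, sqrt (b\<^sup>2 + w\<^sup>2)) \<partial>gauss \<partial>chi k)"
      by (intro nn_integral_swap sf) measurable
    also have "\<dots> = (\<integral>\<^sup>+b. g (a, z, b) \<partial>chi (Suc k))"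
      by (rule chi_convolution) measurable
    finally show "(\<integral>\<^sup>+w. \<integral>\<^sup>+b. g (a, z, sqrt (b\<^sup>2 + w\<^sup>2)) \<partial>chi k \<partial>gauss) =
      (\<integral>\<^sup>+b. g (a, z, b) \<partial>chi (Suc k))" .
  qed
  also have "\<dots> = (\<integral>\<^sup>+d. g d \<partial>bartlett_law (Suc (Suc k)))"
    by (rule nn_integral_bartlett_law_Suc[symmetric]) measurable
  finally show ?thesis .
qed

lemma bartlett_law_step:
  assumes "g \<in> borel_measurable borel3"
  shows "(\<integral>\<^sup>+w. \<integral>\<^sup>+d. g (bartlett_step d w) \<partial>bartlett_law k \<partial>gauss2) = (\<integral>\<^sup>+d. g d \<partial>bartlett_law (Suc k))"
  using bartlett_law_step_0[OF assms] bartlett_law_step_Suc[OF assms] by (cases k) auto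

text \<open>One angle acts on both coordinates of two independent observations. With the scaled mean
  as \<open>p\<close> and a new observation as \<open>q\<close>, this makes the updated mean
  independent of the increment that is fed into the Gram matrix.\<close>

lemma gauss_gauss_rotation:
  assumes [measurable]: "f \<in> borel_measurable ((borel \<Otimes>\<^sub>M borel) \<Otimes>\<^sub>M (borel \<Otimes>\<^sub>M borel))"
    and cs: "c\<^sup>2 + s\<^sup>2 = 1" and c: "c > 0"
  shows "(\<integral>\<^sup>+p. \<integral>\<^sup>+q. f ((c * fst p + s * fst q, c * snd p + s * snd q), (c * fst q - s * fst p, c * snd q - s * snd
    p)) \<partial>gauss2 \<partial>gauss2) =
    (\<integral>\<^sup>+p. \<integral>\<^sup>+q. f (p, q) \<partial>gauss2 \<partial>gauss2)"
proof -
  note sf = gauss.sigma_finite_measure_axioms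
  interpret G2: pair_prob_space gauss gauss ..
  have four: "(\<integral>\<^sup>+p. \<integral>\<^sup>+q. h (p, q) \<partial>gauss2 \<partial>gauss2) =
      (\<integral>\<^sup>+p1. \<integral>\<^sup>+q1. \<integral>\<^sup>+p2. \<integral>\<^sup>+q2. h ((p1, p2), (q1, q2)) \<partial>gauss
        \<partial>gauss \<partial>gauss \<partial>gauss)"
    if [measurable]: "h \<in> borel_measurable ((borel \<Otimes>\<^sub>M borel) \<Otimes>\<^sub>M (borel \<Otimes>\<^sub>M borel))" for h
  proof -
    have "(\<integral>\<^sup>+p. \<integral>\<^sup>+q. h (p, q) \<partial>gauss2 \<partial>gauss2) =
        (\<integral>\<^sup>+p1. \<integral>\<^sup>+p2. \<integral>\<^sup>+q1. \<integral>\<^sup>+q2. h ((p1, p2), (q1, q2)) \<partial>gauss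
          \<partial>gauss \<partial>gauss \<partial>gauss)"
      by (subst nn_integral_gauss_gauss, measurable, intro nn_integral_cong nn_integral_gauss_gauss) measurable
    also have "\<dots> = (\<integral>\<^sup>+p1. \<integral>\<^sup>+q1. \<integral>\<^sup>+p2. \<integral>\<^sup>+q2. h ((p1, p2), (q1, q2))
      \<partial>gauss \<partial>gauss \<partial>gauss \<partial>gauss)"
      by (intro nn_integral_cong nn_integral_swap sf) measurable
    finally show ?thesis .
  qed
  have "(\<integral>\<^sup>+p. \<integral>\<^sup>+q. f ((c * fst p + s * fst q, c * snd p + s * snd q), (c * fst q - s * fst p, c * snd q - s * snd
    p)) \<partial>gauss2 \<partial>gauss2) =
      (\<integral>\<^sup>+p1. \<integral>\<^sup>+q1. \<integral>\<^sup>+p2. \<integral>\<^sup>+q2. f ((c * p1 + s * q1, c * p2 + s * q2), (c * q1 - s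
        * p1, c * q2 - s * p2)) \<partial>gauss \<partial>gauss \<partial>gauss \<partial>gauss)"
    using four[of "\<lambda>(p, q). f ((c * fst p + s * fst q, c * snd p + s * snd q), (c * fst q - s * fst p, c * snd q - s * snd p))"] by simp
  also have "\<dots> = (\<integral>\<^sup>+p1. \<integral>\<^sup>+q1. \<integral>\<^sup>+p2. \<integral>\<^sup>+q2. f ((p1, c * p2 + s * q2), (q1, c
    * q2 - s * p2)) \<partial>gauss \<partial>gauss \<partial>gauss \<partial>gauss)"
    by (rule gauss_rotation[OF _ cs c, where f = "\<lambda>p1 q1. \<integral>\<^sup>+p2. \<integral>\<^sup>+q2. f ((p1, c * p2 + s * q2), (q1, c * q2
      - s * p2)) \<partial>gauss \<partial>gauss"]) measurable
  also have "\<dots> = (\<integral>\<^sup>+p1. \<integral>\<^sup>+q1. \<integral>\<^sup>+p2. \<integral>\<^sup>+q2. f ((p1, p2), (q1, q2))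
    \<partial>gauss \<partial>gauss \<partial>gauss \<partial>gauss)"
    by (intro nn_integral_cong gauss_rotation[OF _ cs c, where f = "\<lambda>p2 q2. f ((_, p2), (_, q2))"]) measurable
  also have "\<dots> = (\<integral>\<^sup>+p. \<integral>\<^sup>+q. f (p, q) \<partial>gauss2 \<partial>gauss2)"
    by (rule four[symmetric]) measurable
  finally show ?thesis .
qed

section \<open>Reduction of the correlation coefficient\<close>

text \<open>\<open>suff_stat k\<close> refers to the sample \<open>x 1, \<dots>, x (k + 1)\<close>. The first component is \<open>sqrt (k + 1)\<close> times the
  mean, the second one is the Cholesky factor of the centred Gram matrix.\<close>

primrec suff_stat :: "nat \<Rightarrow> (nat \<Rightarrow> real \<times> real) \<Rightarrow> (real \<times> real) \<times> (real \<times> real \<times> real)" where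
  "suff_stat 0 x = (x 1, (0, 0, 0))"
| "suff_stat (Suc k) x =
     (let c = sqrt (real (Suc k) / real (Suc (Suc k))); s = sqrt (1 / real (Suc (Suc k)));
          p = fst (suff_stat k x); w = x (Suc (Suc k)) in
      ((c * fst p + s * fst w, c * snd p + s * snd w),
       bartlett_step (snd (suff_stat k x)) (c * fst w - s * fst p, c * snd w - s * snd p)))"

lemma suff_stat_cong:
  assumes "\<And>i. i \<in> {1..Suc k} \<Longrightarrow> x i = y i"
  shows "suff_stat k x = suff_stat k y"
  using assms
proof (induction k)
  case (Suc k)
  from Suc.prems have "x (Suc (Suc k)) = y (Suc (Suc k))" by simp
  with Suc show ?case by simp
qed simp

lemma suff_stat_measurable:
  assumes "\<And>i. i \<in> {1..Suc k} \<Longrightarrow> (\<lambda>\<omega>. X \<omega> i) \<in> M \<rightarrow>\<^sub>M borel \<Otimes>\<^sub>M borel"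
  shows "(\<lambda>\<omega>. suff_stat k (X \<omega>)) \<in> M \<rightarrow>\<^sub>M (borel \<Otimes>\<^sub>M borel) \<Otimes>\<^sub>M borel3"
  using assms
proof (induction k)
  case 0
  have "(\<lambda>\<omega>. X \<omega> 1) \<in> M \<rightarrow>\<^sub>M borel \<Otimes>\<^sub>M borel" using 0 by simp
  then show ?case by simp
next
  case (Suc k)
  have [measurable]: "(\<lambda>\<omega>. X \<omega> (Suc (Suc k))) \<in> M \<rightarrow>\<^sub>M borel \<Otimes>\<^sub>M borel" using Suc.prems by simp
  have [measurable]: "(\<lambda>\<omega>. suff_stat k (X \<omega>)) \<in> M \<rightarrow>\<^sub>M (borel \<Otimes>\<^sub>M borel) \<Otimes>\<^sub>M borel3"
    using Suc by simp
  show ?case by (simp add: Let_def)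
qed

lemma suff_stat_measurable_PiM [measurable]:
  "suff_stat k \<in> (\<Pi>\<^sub>M i\<in>{1..Suc k}. gauss2) \<rightarrow>\<^sub>M (borel \<Otimes>\<^sub>M borel) \<Otimes>\<^sub>M borel3"
proof (rule suff_stat_measurable[where X = "\<lambda>\<omega>. \<omega>"])
  fix i assume "i \<in> {1..Suc k}"
  then have "(\<lambda>\<omega>. \<omega> i) \<in> (\<Pi>\<^sub>M i\<in>{1..Suc k}. gauss2) \<rightarrow>\<^sub>M gauss2" by simp
  also have "measurable (\<Pi>\<^sub>M i\<in>{1..Suc k}. gauss2) gauss2 =
      measurable (\<Pi>\<^sub>M i\<in>{1..Suc k}. gauss2) (borel \<Otimes>\<^sub>M borel)"
    by (intro measurable_cong_sets refl sets_pair_measure_cong sets_gauss)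
  finally show "(\<lambda>\<omega>. \<omega> i) \<in> (\<Pi>\<^sub>M i\<in>{1..Suc k}. gauss2) \<rightarrow>\<^sub>M borel \<Otimes>\<^sub>M borel" .
qed

text \<open>Centring costs one observation: a sample of size \<open>k + 1\<close> leads to
  \<open>bartlett_law k\<close>. In the induction the newest observation is split off the product
  measure, the rotation turns it and the old mean into the new mean and an independent Gaussian
  increment, and this increment advances the Bartlett law by one step.\<close>

lemma suff_stat_law:
  assumes [measurable]: "f \<in> borel_measurable ((borel \<Otimes>\<^sub>M borel) \<Otimes>\<^sub>M borel3)"
  shows "(\<integral>\<^sup>+x. f (suff_stat k x) \<partial>(\<Pi>\<^sub>M i\<in>{1..Suc k}. gauss2)) =
    (\<integral>\<^sup>+p. \<integral>\<^sup>+d. f (p, d) \<partial>bartlett_law k \<partial>gauss2)"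
  using assms
proof (induction k arbitrary: f)
  case (0 f)
  note [measurable] = 0
  interpret G2: pair_prob_space gauss gauss ..
  interpret product_sigma_finite "\<lambda>_::nat. gauss2" ..
  have "{1..Suc 0} = {Suc 0}" by auto
  then have "(\<integral>\<^sup>+x. f (suff_stat 0 x) \<partial>(\<Pi>\<^sub>M i\<in>{1..Suc 0}. gauss2)) =
      (\<integral>\<^sup>+x. f (x (Suc 0), 0, 0, 0) \<partial>(\<Pi>\<^sub>M i\<in>{Suc 0}. gauss2))" by simp
  also have "\<dots> = (\<integral>\<^sup>+p. f (p, 0, 0, 0) \<partial>gauss2)"
    by (rule product_nn_integral_singleton[of "\<lambda>p. f (p, 0, 0, 0)"]) measurable
  finally show ?case
    by (simp add: bartlett_law_def nn_integral_return space_pair_measure)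
next
  case (Suc k f)
  note [measurable] = Suc.prems
  interpret G2: pair_prob_space gauss gauss ..
  interpret product_sigma_finite "\<lambda>_::nat. gauss2" ..
  let ?P = "\<lambda>k. \<Pi>\<^sub>M i\<in>{1..Suc k}. gauss2"
  define c where "c = sqrt (real (Suc k) / real (Suc (Suc k)))"
  define s where "s = sqrt (1 / real (Suc (Suc k)))"
  have cs: "c\<^sup>2 + s\<^sup>2 = 1" "c > 0"
    by (simp_all add: c_def s_def add_divide_distrib[symmetric])
  define F where "F t w = f ((c * fst (fst t) + s * fst w, c * snd (fst t) + s * snd w),
       bartlett_step (snd t) (c * fst w - s * fst (fst t), c * snd w - s * snd (fst t)))" for t w
  have Fm [measurable]: "case_prod F \<in> borel_measurable (((borel \<Otimes>\<^sub>M borel) \<Otimes>\<^sub>M borel3) \<Otimes>\<^sub>M (borel \<Otimes>\<^sub>M borel))"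
    unfolding F_def split_beta' by measurable
  have ins: "{1..Suc (Suc k)} = insert (Suc (Suc k)) {1..Suc k}" by auto
  have M: "(\<lambda>x. f (suff_stat (Suc k) x)) \<in> borel_measurable (?P (Suc k))"
    by (rule measurable_compose[OF suff_stat_measurable_PiM Suc.prems])
  have "(\<integral>\<^sup>+x. f (suff_stat (Suc k) x) \<partial>?P (Suc k)) =
      (\<integral>\<^sup>+x. \<integral>\<^sup>+w. f (suff_stat (Suc k) (x(Suc (Suc k) := w))) \<partial>gauss2 \<partial>?P k)"
    unfolding ins by (rule product_nn_integral_insert[OF _ _ M[unfolded ins]]) simp_all
  also have "\<dots> = (\<integral>\<^sup>+x. \<integral>\<^sup>+w. F (suff_stat k x) w \<partial>gauss2 \<partial>?P k)"
  proof (intro nn_integral_cong)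
    fix x w
    have "suff_stat k (x(Suc (Suc k) := w)) = suff_stat k x" by (rule suff_stat_cong) auto
    then show "f (suff_stat (Suc k) (x(Suc (Suc k) := w))) = F (suff_stat k x) w"
      by (simp add: F_def c_def s_def Let_def)
  qed
  also have "\<dots> = (\<integral>\<^sup>+p. \<integral>\<^sup>+d. \<integral>\<^sup>+w. F (p, d) w \<partial>gauss2 \<partial>bartlett_law k \<partial>gauss2)"
    by (rule Suc.IH) measurable
  also have "\<dots> = (\<integral>\<^sup>+p. \<integral>\<^sup>+w. \<integral>\<^sup>+d. F (p, d) w \<partial>bartlett_law k \<partial>gauss2 \<partial>gauss2)"
  proof (intro nn_integral_cong nn_integral_swap bartlett_law.sigma_finite_measure_axioms G2.sigma_finite_measure_axioms)
    fix p :: "real \<times> real"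
    have "(\<lambda>x. ((p, fst x), snd x)) \<in> borel3 \<Otimes>\<^sub>M (borel \<Otimes>\<^sub>M borel)
        \<rightarrow>\<^sub>M ((borel \<Otimes>\<^sub>M borel) \<Otimes>\<^sub>M borel3) \<Otimes>\<^sub>M (borel \<Otimes>\<^sub>M borel)"
      by (intro measurable_Pair measurable_fst measurable_snd measurable_const) (simp add: space_pair_measure)
    from measurable_compose[OF this Fm]
    have "(\<lambda>(d, w). F (p, d) w) \<in> borel_measurable (borel3 \<Otimes>\<^sub>M (borel \<Otimes>\<^sub>M borel))"
      by (simp add: split_beta')
    moreover have "sets (bartlett_law k \<Otimes>\<^sub>M gauss2) = sets (borel3 \<Otimes>\<^sub>M (borel \<Otimes>\<^sub>M borel))"
      by (intro sets_pair_measure_cong sets_bartlett_law sets_gauss)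
    ultimately show "(\<lambda>(d, w). F (p, d) w) \<in> borel_measurable (bartlett_law k \<Otimes>\<^sub>M gauss2)"
      using measurable_cong_sets by blast
  qed
  also have "\<dots> = (\<integral>\<^sup>+p. \<integral>\<^sup>+w. \<integral>\<^sup>+d. f (p, bartlett_step d w) \<partial>bartlett_law k \<partial>gauss2 \<partial>gauss2)"
    using gauss_gauss_rotation[OF _ cs, of "\<lambda>(p, w). \<integral>\<^sup>+d. f (p, bartlett_step d w) \<partial>bartlett_law k"]
    by (simp add: F_def)
  also have "\<dots> = (\<integral>\<^sup>+p. \<integral>\<^sup>+d. f (p, d) \<partial>bartlett_law (Suc k) \<partial>gauss2)"
    by (intro nn_integral_cong bartlett_law_step measurable_compose[OF _ Suc.prems] measurable_Pair1')
      (simp add: space_pair_measure)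
  finally show ?case .
qed

text \<open>The rotation preserves \<open>p^2 + u^2\<close>, \<open>q^2 + v^2\<close> and
  \<open>p q + u v\<close>, where \<open>(u, v)\<close> is the new observation. Hence the part of
  these sums that the new mean does not take up is exactly what the step adds to the Gram matrix.
  The signs of \<open>a\<close> and \<open>b\<close> select the Cholesky factor.\<close>

lemma suff_stat_eq:
  assumes "suff_stat k x = ((p, q), (a, z, b))"
  shows "sqrt (real (Suc k)) * p = (\<Sum>i=1..Suc k. fst (x i))"
    and "sqrt (real (Suc k)) * q = (\<Sum>i=1..Suc k. snd (x i))"
    and "a\<^sup>2 = (\<Sum>i=1..Suc k. (fst (x i))\<^sup>2) - p\<^sup>2"
    and "a * z = (\<Sum>i=1..Suc k. fst (x i) * snd (x i)) - p * q"
    and "z\<^sup>2 + b\<^sup>2 = (\<Sum>i=1..Suc k. (snd (x i))\<^sup>2) - q\<^sup>2"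
    and "a \<ge> 0" and "b \<ge> 0"
proof -
  have "sqrt (real (Suc k)) * p = (\<Sum>i=1..Suc k. fst (x i)) \<and>
    sqrt (real (Suc k)) * q = (\<Sum>i=1..Suc k. snd (x i)) \<and>
    a\<^sup>2 = (\<Sum>i=1..Suc k. (fst (x i))\<^sup>2) - p\<^sup>2 \<and>
    a * z = (\<Sum>i=1..Suc k. fst (x i) * snd (x i)) - p * q \<and>
    z\<^sup>2 + b\<^sup>2 = (\<Sum>i=1..Suc k. (snd (x i))\<^sup>2) - q\<^sup>2 \<and> a \<ge> 0 \<and> b \<ge> 0"
    using assms
  proof (induction k arbitrary: p q a z b)
    case 0
    then show ?case by (auto simp: power2_eq_square)
  next
    case (Suc k p' q' a' z' b')
    obtain p q a z b where st: "suff_stat k x = ((p, q), (a, z, b))" by (metis surj_pair)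
    obtain u v where w: "x (Suc (Suc k)) = (u, v)" by (metis surj_pair)
    define c where "c = sqrt (real (Suc k) / real (Suc (Suc k)))"
    define s where "s = sqrt (1 / real (Suc (Suc k)))"
    have cs: "c\<^sup>2 + s\<^sup>2 = 1"
      by (simp add: c_def s_def add_divide_distrib[symmetric])
    define xx where "xx = c * u - s * p"
    define yy where "yy = c * v - s * q"
    have p': "p' = c * p + s * u" and q': "q' = c * q + s * v"
      and br: "bartlett_step (a, z, b) (xx, yy) = (a', z', b')"
      using Suc.prems by (simp_all add: st w c_def s_def xx_def yy_def Let_def)
    note IH = Suc.IH[OF st]
    have rt: "sqrt (real (Suc (Suc k))) * c = sqrt (real (Suc k))" "sqrt (real (Suc (Suc k))) * s = 1"
      by (simp_all add: c_def s_def real_sqrt_divide)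
    have S1: "sqrt (real (Suc (Suc k))) * p' = sqrt (real (Suc k)) * p + u"
      unfolding p' distrib_left mult.assoc[symmetric] rt by simp
    have S2: "sqrt (real (Suc (Suc k))) * q' = sqrt (real (Suc k)) * q + v"
      unfolding q' distrib_left mult.assoc[symmetric] rt by simp
    have r1: "xx\<^sup>2 + p'\<^sup>2 = u\<^sup>2 + p\<^sup>2"
    proof -
      have "xx\<^sup>2 + p'\<^sup>2 = (c\<^sup>2 + s\<^sup>2) * (u\<^sup>2 + p\<^sup>2)" unfolding xx_def p' by algebra
      then show ?thesis by (simp add: cs)
    qed
    have r2: "yy\<^sup>2 + q'\<^sup>2 = v\<^sup>2 + q\<^sup>2"
    proof -
      have "yy\<^sup>2 + q'\<^sup>2 = (c\<^sup>2 + s\<^sup>2) * (v\<^sup>2 + q\<^sup>2)" unfolding yy_def q' by algebra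
      then show ?thesis by (simp add: cs)
    qed
    have r3: "xx * yy + p' * q' = u * v + p * q"
    proof -
      have "xx * yy + p' * q' = (c\<^sup>2 + s\<^sup>2) * (u * v + p * q)" unfolding xx_def yy_def p' q' by algebra
      then show ?thesis by (simp add: cs)
    qed
    have B: "a'\<^sup>2 = a\<^sup>2 + xx\<^sup>2 \<and> a' * z' = a * z + xx * yy \<and> z'\<^sup>2 + b'\<^sup>2 = z\<^sup>2 + b\<^sup>2 + yy\<^sup>2
      \<and> a' \<ge> 0 \<and> b' \<ge> 0"
    proof (cases "sqrt (a\<^sup>2 + xx\<^sup>2) = 0")
      case True
      \<comment> \<open>In the degenerate branch both sides of the identity for the cross product
        are 0, so it is consistent to keep the old \<open>z\<close>.\<close>
      then have "a = 0" "xx = 0" by (simp_all add: sum_power2_eq_zero_iff)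
      then show ?thesis using br by (auto simp: bartlett_step_def)
    next
      case False
      define r where "r = sqrt (a\<^sup>2 + xx\<^sup>2)"
      have r: "r > 0" using False by (simp add: r_def less_le)
      have rr: "r\<^sup>2 = a\<^sup>2 + xx\<^sup>2" by (simp add: r_def)
      have e: "a' = r" "z' = a / r * z + xx / r * yy" "b' = sqrt (b\<^sup>2 + (a / r * yy - xx / r * z)\<^sup>2)"
        using br[symmetric] r by (simp_all add: bartlett_step_def r_def[symmetric] Let_def del: real_sqrt_eq_zero_cancel_iff)
      have "(a / r * z + xx / r * yy)\<^sup>2 + (a / r * yy - xx / r * z)\<^sup>2 = ((a / r)\<^sup>2 + (xx / r)\<^sup>2) * (z\<^sup>2 + yy\<^sup>2)"
        by algebra
      also have "(a / r)\<^sup>2 + (xx / r)\<^sup>2 = 1"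
        using r by (simp add: power_divide add_divide_distrib[symmetric] rr[symmetric])
      finally have "z'\<^sup>2 + b'\<^sup>2 = z\<^sup>2 + b\<^sup>2 + yy\<^sup>2"
        unfolding e by simp
      moreover have "a' * z' = a * z + xx * yy"
        unfolding e using r by (simp add: distrib_left)
      ultimately show ?thesis using rr r e by simp
    qed
    from IH B S1 S2 r1 r2 r3 show ?case
      by (simp add: w)
  qed
  then show "sqrt (real (Suc k)) * p = (\<Sum>i=1..Suc k. fst (x i))"
    and "sqrt (real (Suc k)) * q = (\<Sum>i=1..Suc k. snd (x i))"
    and "a\<^sup>2 = (\<Sum>i=1..Suc k. (fst (x i))\<^sup>2) - p\<^sup>2"
    and "a * z = (\<Sum>i=1..Suc k. fst (x i) * snd (x i)) - p * q"
    and "z\<^sup>2 + b\<^sup>2 = (\<Sum>i=1..Suc k. (snd (x i))\<^sup>2) - q\<^sup>2"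
    and "a \<ge> 0" and "b \<ge> 0" by blast+
qed

section \<open>Algebra of the correlation coefficient\<close>

lemma sum_centered_product:
  assumes "n > 0"
  shows "(\<Sum>i=1..n. (u i - emp_mean u n) * (v i - emp_mean v n)) =
    (\<Sum>i=1..n. u i * v i) - (\<Sum>i=1..n. u i) * (\<Sum>i=1..n. v i) / real n"
proof -
  have "(\<Sum>i=1..n. (u i - emp_mean u n) * (v i - emp_mean v n)) =
      (\<Sum>i=1..n. u i * v i) - emp_mean u n * (\<Sum>i=1..n. v i) - emp_mean v n * (\<Sum>i=1..n. u i) + real n * (emp_mean u n * emp_mean v n)"
    by (simp add: algebra_simps sum.distrib sum_subtractf sum_distrib_left)
  also have "\<dots> = (\<Sum>i=1..n. u i * v i) - (\<Sum>i=1..n. u i) * (\<Sum>i=1..n. v i) / real n"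
    unfolding emp_mean_def using assms by (simp add: field_simps)
  finally show ?thesis .
qed

lemma emp_mean_affine:
  assumes "n > 0"
  shows "emp_mean (\<lambda>i. m + s * x i) n = m + s * emp_mean x n"
  using assms by (simp add: emp_mean_def sum.distrib sum_distrib_left field_simps)

lemma pearson_affine:
  assumes "s > 0" "t > 0"
  shows "pearson (\<lambda>i. m + s * x i) (\<lambda>i. l + t * y i) n = pearson x y n"
proof (cases "n = 0")
  case True
  then show ?thesis by (simp add: pearson_def)
next
  case False
  have 1: "m + s * x i - emp_mean (\<lambda>i. m + s * x i) n = s * (x i - emp_mean x n)" for i
    using False by (simp add: emp_mean_affine algebra_simps)
  have 2: "l + t * y i - emp_mean (\<lambda>i. l + t * y i) n = t * (y i - emp_mean y n)" for i
    using False by (simp add: emp_mean_affine algebra_simps)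
  have "(\<Sum>i=1..n. (s * (x i - emp_mean x n)) * (t * (y i - emp_mean y n))) =
      (s * t) * (\<Sum>i=1..n. (x i - emp_mean x n) * (y i - emp_mean y n))"
    unfolding sum_distrib_left by (intro sum.cong) (auto simp: mult_ac)
  moreover have "(\<Sum>i=1..n. (s * (x i - emp_mean x n))\<^sup>2) * (\<Sum>i=1..n. (t * (y i - emp_mean y n))\<^sup>2) =
      (s * t)\<^sup>2 * ((\<Sum>i=1..n. (x i - emp_mean x n)\<^sup>2) * (\<Sum>i=1..n. (y i - emp_mean y n)\<^sup>2))"
    by (simp add: power_mult_distrib sum_distrib_left[symmetric] mult_ac)
  ultimately show ?thesis
    using assms unfolding pearson_def 1 2 by (simp add: real_sqrt_mult)
qed

text \<open>Relative to the direction of the centred first sample, the centred second sample has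
  component \<open>\<rho> a + s z\<close> along it and length \<open>s b\<close> across it; the
  coefficient is the cosine of the angle. The means \<open>p\<close>, \<open>q\<close> drop out, and
  \<open>a > 0\<close> permits cancelling the length of the first sample.\<close>

lemma pearson_suff_stat:
  assumes st: "suff_stat k x = ((p, q), (a, z, b))" and a: "a > 0"
  shows "pearson (\<lambda>i. fst (x i)) (\<lambda>i. \<rho> * fst (x i) + s * snd (x i)) (Suc k) =
    (\<rho> * a + s * z) / sqrt ((\<rho> * a + s * z)\<^sup>2 + (s * b)\<^sup>2)"
proof -
  let ?n = "Suc k"
  let ?u = "\<lambda>i. fst (x i)" and ?v = "\<lambda>i. snd (x i)"
  note eq = suff_stat_eq[OF st]
  have rt: "sqrt r * g * (sqrt r * h) / r = g * h" if "r > 0" for r g h :: real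
  proof -
    have "sqrt r * g * (sqrt r * h) = (sqrt r)\<^sup>2 * (g * h)" unfolding power2_eq_square by algebra
    then show ?thesis using that by (simp only: \<open>sqrt r * g * (sqrt r * h) = (sqrt r)\<^sup>2 * (g * h)\<close>) simp
  qed
  have pr: "(\<Sum>i=1..?n. ?u i) * (\<Sum>i=1..?n. ?v i) / real ?n = p * q"
    "(\<Sum>i=1..?n. ?u i) * (\<Sum>i=1..?n. ?u i) / real ?n = p\<^sup>2"
    "(\<Sum>i=1..?n. ?v i) * (\<Sum>i=1..?n. ?v i) / real ?n = q\<^sup>2"
    unfolding eq(1,2)[symmetric] by (simp_all only: rt power2_eq_square of_nat_0_less_iff zero_less_Suc)
  have A: "(\<Sum>i=1..?n. (?u i - emp_mean ?u ?n) * (?u i - emp_mean ?u ?n)) = a\<^sup>2"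
    unfolding eq(3) by (subst sum_centered_product) (simp_all only: pr zero_less_Suc, simp only: power2_eq_square)
  have C: "(\<Sum>i=1..?n. (?u i - emp_mean ?u ?n) * (?v i - emp_mean ?v ?n)) = a * z"
    unfolding eq(4) by (subst sum_centered_product) (simp_all only: pr zero_less_Suc)
  have D: "(\<Sum>i=1..?n. (?v i - emp_mean ?v ?n) * (?v i - emp_mean ?v ?n)) = z\<^sup>2 + b\<^sup>2"
    unfolding eq(5) by (subst sum_centered_product) (simp_all only: pr zero_less_Suc, simp only: power2_eq_square)
  have m: "emp_mean (\<lambda>i. \<rho> * ?u i + s * ?v i) ?n = \<rho> * emp_mean ?u ?n + s * emp_mean ?v ?n"
    unfolding emp_mean_def by (simp only: sum.distrib sum_distrib_left[symmetric] add_divide_distrib times_divide_eq_right)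
  have w: "\<rho> * ?u i + s * ?v i - emp_mean (\<lambda>i. \<rho> * ?u i + s * ?v i) ?n =
      \<rho> * (?u i - emp_mean ?u ?n) + s * (?v i - emp_mean ?v ?n)" for i
    unfolding m by (simp add: algebra_simps)
  have N: "(\<Sum>i=1..?n. (?u i - emp_mean ?u ?n) * (\<rho> * (?u i - emp_mean ?u ?n) + s * (?v i - emp_mean ?v ?n))) = a * (\<rho> * a + s * z)"
  proof -
    have "(\<Sum>i=1..?n. (?u i - emp_mean ?u ?n) * (\<rho> * (?u i - emp_mean ?u ?n) + s * (?v i - emp_mean ?v ?n))) =
        \<rho> * (\<Sum>i=1..?n. (?u i - emp_mean ?u ?n) * (?u i - emp_mean ?u ?n)) + s * (\<Sum>i=1..?n. (?u i - emp_mean ?u ?n) * (?v i - emp_mean ?v ?n))"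
      unfolding sum_distrib_left sum.distrib[symmetric] by (intro sum.cong) (auto simp: algebra_simps)
    then show ?thesis unfolding A C by (simp add: power2_eq_square algebra_simps)
  qed
  have E: "(\<Sum>i=1..?n. (\<rho> * (?u i - emp_mean ?u ?n) + s * (?v i - emp_mean ?v ?n))\<^sup>2) = (\<rho> * a + s * z)\<^sup>2 + (s * b)\<^sup>2"
  proof -
    have "(\<Sum>i=1..?n. (\<rho> * (?u i - emp_mean ?u ?n) + s * (?v i - emp_mean ?v ?n))\<^sup>2) =
        \<rho>\<^sup>2 * (\<Sum>i=1..?n. (?u i - emp_mean ?u ?n) * (?u i - emp_mean ?u ?n)) + 2 * \<rho> * s * (\<Sum>i=1..?n. (?u i - emp_mean ?u ?n) * (?v i - emp_mean ?v ?n))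
        + s\<^sup>2 * (\<Sum>i=1..?n. (?v i - emp_mean ?v ?n) * (?v i - emp_mean ?v ?n))"
      unfolding sum_distrib_left sum.distrib[symmetric] by (intro sum.cong) (auto simp: algebra_simps power2_eq_square)
    then show ?thesis unfolding A C D by (simp add: power2_eq_square algebra_simps)
  qed
  have A': "(\<Sum>i=1..?n. (?u i - emp_mean ?u ?n)\<^sup>2) = a\<^sup>2"
    using A by (simp only: power2_eq_square)
  show ?thesis
    unfolding pearson_def w N E A' using a by (simp add: real_sqrt_mult)
qed

text \<open>A bound on the cosine of an angle is rewritten as a bound on its cotangent. As
  \<open>c\<close> and \<open>D\<close> are positive, either inequality forces \<open>N\<close> to
  be positive, so both may be squared.\<close>

lemma ge_ratio_iff:
  fixes N D c :: real
  assumes "D > 0" "0 < c" "c < 1"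
  shows "c \<le> N / sqrt (N\<^sup>2 + D\<^sup>2) \<longleftrightarrow> c / sqrt (1 - c\<^sup>2) * D \<le> N"
proof -
  have S: "sqrt (N\<^sup>2 + D\<^sup>2) > 0" using assms by (simp add: add_nonneg_pos)
  have c2: "1 - c\<^sup>2 > 0" using assms by (simp add: power_less_one_iff abs_square_less_1)
  have "c \<le> N / sqrt (N\<^sup>2 + D\<^sup>2) \<longleftrightarrow> c * sqrt (N\<^sup>2 + D\<^sup>2) \<le> N"
    using S by (simp add: pos_le_divide_eq)
  also have "\<dots> \<longleftrightarrow> N \<ge> 0 \<and> (c * sqrt (N\<^sup>2 + D\<^sup>2))\<^sup>2 \<le> N\<^sup>2"
    using mult_pos_pos[OF assms(2) S] by (auto intro: power2_le_imp_le power_mono)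
  also have "(c * sqrt (N\<^sup>2 + D\<^sup>2))\<^sup>2 \<le> N\<^sup>2 \<longleftrightarrow> (c * D)\<^sup>2 \<le> (sqrt (1 - c\<^sup>2) * N)\<^sup>2"
    using c2 by (simp add: power_mult_distrib algebra_simps)
  also have "N \<ge> 0 \<and> (c * D)\<^sup>2 \<le> (sqrt (1 - c\<^sup>2) * N)\<^sup>2 \<longleftrightarrow> c * D \<le> sqrt (1 - c\<^sup>2) * N"
  proof -
    have "c * D > 0" using assms by simp
    moreover have "sqrt (1 - c\<^sup>2) > 0" using c2 by simp
    ultimately have "N \<ge> 0 \<and> (c * D)\<^sup>2 \<le> (sqrt (1 - c\<^sup>2) * N)\<^sup>2 \<longleftrightarrow> sqrt (1 - c\<^sup>2) * N \<ge> 0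
      \<and> (c * D)\<^sup>2 \<le> (sqrt (1 - c\<^sup>2) * N)\<^sup>2"
      by (simp add: zero_le_mult_iff)
    also have "\<dots> \<longleftrightarrow> c * D \<le> sqrt (1 - c\<^sup>2) * N"
      using \<open>c * D > 0\<close> by (auto intro: power2_le_imp_le power_mono simp del: real_sqrt_ge_0_iff zero_le_mult_iff)
    finally show ?thesis .
  qed
  also have "\<dots> \<longleftrightarrow> c / sqrt (1 - c\<^sup>2) * D \<le> N"
    using c2 by (simp add: pos_divide_le_eq mult.commute)
  finally show ?thesis .
qed

text \<open>The sample size starts at 3 so that \<open>a\<close> and \<open>b\<close> have at least
  two and one degrees of freedom and are almost surely positive. Outside the null event
  \<open>?Z\<close> the quotient formula and the cotangent criterion turn the event into a
  half-space condition on \<open>(a, z, b)\<close>.\<close>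

lemma pearson_law:
  assumes c: "0 < c" "c < 1" and s: "s > 0"
  shows "(\<integral>\<^sup>+x. indicator {x. c \<le> pearson (\<lambda>i. fst (x i)) (\<lambda>i. \<rho> * fst (x i) + s * snd (x i)) (Suc (Suc (Suc m)))} x
      \<partial>(\<Pi>\<^sub>M i\<in>{1..Suc (Suc (Suc m))}. gauss2)) =
    (\<integral>\<^sup>+a. \<integral>\<^sup>+z. \<integral>\<^sup>+b. indicator {(a, z, b). c / sqrt (1 - c\<^sup>2) * b - \<rho> / s * a \<le> z} (a, z, b)
      \<partial>chi (Suc m) \<partial>gauss \<partial>chi (Suc (Suc m)))"
proof -
  let ?Z = "{(a, z, b). a \<le> 0 \<or> b \<le> 0} :: (real \<times> real \<times> real) set"
  let ?E = "{(a, z, b). c / sqrt (1 - c\<^sup>2) * b - \<rho> / s * a \<le> z}"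
  let ?P = "\<Pi>\<^sub>M i\<in>{1..Suc (Suc (Suc m))}. gauss2"
  interpret G2: pair_prob_space gauss gauss ..
  let ?B = "borel3 :: (real \<times> real \<times> real) measure"
  have law: "(\<integral>\<^sup>+x. f (snd (suff_stat (Suc (Suc m)) x)) \<partial>?P) =
      (\<integral>\<^sup>+a. \<integral>\<^sup>+z. \<integral>\<^sup>+b. f (a, z, b) \<partial>chi (Suc m) \<partial>gauss \<partial>chi (Suc (Suc m)))"
    if [measurable]: "f \<in> borel_measurable ?B" for f
    by (subst suff_stat_law[where f = "\<lambda>t. f (snd t)"])
      (auto simp: nn_integral_bartlett_law_Suc G2.emeasure_space_1)
  have "{d \<in> space ?B. fst d \<le> 0 \<or> snd (snd d) \<le> 0} \<in> sets ?B" by measurable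
  then have [measurable]: "?Z \<in> sets ?B"
    by (simp add: space_pair_measure split_beta')
  have "(\<integral>\<^sup>+x. indicator ?Z (snd (suff_stat (Suc (Suc m)) x)) \<partial>?P) =
      (\<integral>\<^sup>+a. \<integral>\<^sup>+z. \<integral>\<^sup>+b. indicator ?Z (a, z, b) \<partial>chi (Suc m) \<partial>gauss \<partial>chi (Suc (Suc m)))"
    by (rule law) measurable
  also have "\<dots> = 0"
  proof -
    have "AE b in chi (Suc m). indicator ?Z (a, z, b) = (0::ennreal)" if "a > 0" for a z :: real
      using AE_chi_pos by eventually_elim (use that in auto)
    then have "(\<integral>\<^sup>+b. indicator ?Z (a, z, b) \<partial>chi (Suc m)) = 0" if "a > 0" for a z :: real
      using that by (subst nn_integral_0_iff_AE) auto
    then have "AE a in chi (Suc (Suc m)). (\<integral>\<^sup>+z. \<integral>\<^sup>+b. indicator ?Z (a, z, b) \<partial>chi (Suc m) \<partial>gauss) = 0"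
      by (intro eventually_mono[OF AE_chi_pos]) simp
    then show ?thesis
      by (subst nn_integral_0_iff_AE) auto
  qed
  finally have z: "(\<integral>\<^sup>+x. indicator ?Z (snd (suff_stat (Suc (Suc m)) x)) \<partial>?P) = 0" .
  have "AE x in ?P. indicator ?Z (snd (suff_stat (Suc (Suc m)) x)) = (0::ennreal)"
    by (rule nn_integral_0_iff_AE[THEN iffD1, OF _ z]) measurable
  then have "AE x in ?P. indicator {x. c \<le> pearson (\<lambda>i. fst (x i)) (\<lambda>i. \<rho> * fst (x i) + s * snd (x i)) (Suc (Suc (Suc m)))} x =
      (indicator ?E (snd (suff_stat (Suc (Suc m)) x)) :: ennreal)"
  proof eventually_elim
    case (elim x)
    obtain p q a z b where stx: "suff_stat (Suc (Suc m)) x = ((p, q), (a, z, b))" by (metis surj_pair)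
    with elim have ab: "a > 0" "b > 0" by (auto simp: indicator_def not_le[symmetric] simp del: not_le suff_stat.simps split: if_splits)
    have "c / sqrt (1 - c\<^sup>2) * (s * b) - \<rho> * a = s * (c / sqrt (1 - c\<^sup>2) * b - \<rho> / s * a)"
      using s by (simp add: right_diff_distrib)
    then have "c / sqrt (1 - c\<^sup>2) * (s * b) \<le> \<rho> * a + s * z \<longleftrightarrow> s * (c / sqrt (1 - c\<^sup>2) * b - \<rho> / s * a) \<le> s * z"
      by linarith
    then have "c / sqrt (1 - c\<^sup>2) * (s * b) \<le> \<rho> * a + s * z \<longleftrightarrow> c / sqrt (1 - c\<^sup>2) * b - \<rho> / s * a \<le> z"
      using s by simp
    then show ?case
      using ge_ratio_iff[of "s * b" c "\<rho> * a + s * z"] ab s c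
      by (simp add: indicator_def pearson_suff_stat[OF stx] stx del: suff_stat.simps)
  qed
  then have "(\<integral>\<^sup>+x. indicator {x. c \<le> pearson (\<lambda>i. fst (x i)) (\<lambda>i. \<rho> * fst (x i) + s * snd (x i)) (Suc (Suc (Suc m)))} x \<partial>?P) =
      (\<integral>\<^sup>+x. indicator ?E (snd (suff_stat (Suc (Suc m)) x)) \<partial>?P)"
    by (rule nn_integral_cong_AE)
  also have "\<dots> = (\<integral>\<^sup>+a. \<integral>\<^sup>+z. \<integral>\<^sup>+b. indicator ?E (a, z, b)
      \<partial>chi (Suc m) \<partial>gauss \<partial>chi (Suc (Suc m)))"
    by (rule law) measurable
  finally show ?thesis .
qed

section \<open>A double integral for the tail\<close>

definition phase :: "real \<Rightarrow> real \<Rightarrow> real \<Rightarrow> real" where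
  "phase \<theta> t s = sqrt ((1 + \<theta>\<^sup>2) * (1 + t\<^sup>2)) * (s + 1 / s) - 2 * \<theta> * t"

lemma sqrt_one_plus_square_gt: "\<theta> * t < sqrt ((1 + \<theta>\<^sup>2) * (1 + t\<^sup>2))"
proof (rule real_less_rsqrt)
  show "(\<theta> * t)\<^sup>2 < (1 + \<theta>\<^sup>2) * (1 + t\<^sup>2)"
    by (simp add: algebra_simps power_mult_distrib) (meson add_pos_nonneg add_nonneg_nonneg zero_le_power2 zero_less_one)
qed

lemma phase_pos:
  assumes "s > 0"
  shows "phase \<theta> t s > 0"
proof -
  have "s + 1 / s = 2 + (s - 1)\<^sup>2 / s"
    using assms by (simp add: field_simps power2_eq_square)
  then have "s + 1 / s \<ge> 2" using assms by simp
  then have "sqrt ((1 + \<theta>\<^sup>2) * (1 + t\<^sup>2)) * 2 \<le> sqrt ((1 + \<theta>\<^sup>2) * (1 + t\<^sup>2)) * (s + 1 / s)"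
    by (intro mult_left_mono) auto
  with sqrt_one_plus_square_gt[of \<theta> t] show ?thesis
    unfolding phase_def by linarith
qed

lemma phase_measurable [measurable (raw)]:
  assumes [measurable]: "f \<in> borel_measurable M" "g \<in> borel_measurable M"
  shows "(\<lambda>x. phase \<theta> (f x) (g x)) \<in> borel_measurable M"
  unfolding phase_def by measurable

text \<open>The substitution \<open>z = b t - \<theta> a\<close> turns the event into
  \<open>t \<ge> \<tau>\<close>, as \<open>b > 0\<close>. The exponent is then a quadratic form in
  \<open>(a, b)\<close>; with the ratio \<open>a / b\<close> as a new variable it becomes
  \<open>b^2\<close> times a function of that ratio and \<open>t\<close>, so \<open>b\<close> can be
  integrated out in closed form. The powers of \<open>a\<close>, \<open>b\<close> and the two
  Jacobians together leave \<open>b ^ (2 * m + 3)\<close>.\<close>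

lemma chi_gauss_chi_integral:
  "(\<integral>\<^sup>+a. \<integral>\<^sup>+z. \<integral>\<^sup>+b. indicator {(a, z, b). \<tau> * b - \<theta> * a \<le> z} (a, z, b)
      \<partial>chi (Suc m) \<partial>gauss \<partial>chi (Suc (Suc m))) =
    ennreal (real (Suc m) * 2 ^ Suc m / pi) *
    (\<integral>\<^sup>+t. \<integral>\<^sup>+s. ennreal (1 / (s * phase \<theta> t s ^ Suc (Suc m))) * indicator {0<..} s * indicator {\<tau>..} t
      \<partial>lborel \<partial>lborel)"
proof -
  let ?F = "\<lambda>t s. ennreal (1 / (s * phase \<theta> t s ^ Suc (Suc m))) * indicator {0<..} s * indicator {\<tau>..} t"
  let ?C = "real (Suc m) * 2 ^ Suc m / pi"
  note sf = lborel.sigma_finite_measure_axioms gauss.sigma_finite_measure_axioms chi.sigma_finite_measure_axioms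
  define K where "K = 1 / (half_moment (Suc m) * half_moment m * sqrt pi)"
  have em: "ennreal p * (ennreal x * i) = ennreal (p * x) * i" if "0 \<le> p" for p x i
    using that by (simp add: ennreal_mult' mult.assoc)
  have K: "K > 0" by (simp add: K_def half_moment_pos)
  let ?B = "borel3 :: (real \<times> real \<times> real) measure"
  have "{d \<in> space ?B. \<tau> * snd (snd d) - \<theta> * fst d \<le> fst (snd d)} \<in> sets ?B" by measurable
  then have [measurable]: "{(a, z, b). \<tau> * b - \<theta> * a \<le> z} \<in> sets ?B"
    by (simp add: space_pair_measure split_beta')
  define G where "G a b t = ennreal (K * (a ^ Suc m * b ^ Suc m * exp (- a\<^sup>2 - b\<^sup>2 - (b * t - \<theta> * a)\<^sup>2))) *
      indicator {0<..} a * indicator {0<..} b * indicator {\<tau>..} t" for a b t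
  have [measurable (raw)]: "(\<lambda>x. G (f x) (g x) (h x)) \<in> borel_measurable M"
    if [measurable]: "f \<in> borel_measurable M" "g \<in> borel_measurable M" "h \<in> borel_measurable M"
    for f g h and M :: "'m measure"
    unfolding G_def by measurable
  have "(\<integral>\<^sup>+a. \<integral>\<^sup>+z. \<integral>\<^sup>+b. indicator {(a, z, b). \<tau> * b - \<theta> * a \<le> z} (a, z, b)
    \<partial>chi (Suc m) \<partial>gauss \<partial>chi (Suc (Suc m))) =
      (\<integral>\<^sup>+a. \<integral>\<^sup>+b. \<integral>\<^sup>+z. indicator {(a, z, b). \<tau> * b - \<theta> * a \<le> z} (a, z, b)
        \<partial>gauss \<partial>chi (Suc m) \<partial>chi (Suc (Suc m)))"
    by (intro nn_integral_cong nn_integral_swap sf) measurable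
  also have "\<dots> = (\<integral>\<^sup>+a. \<integral>\<^sup>+b. \<integral>\<^sup>+z. ennreal (a ^ Suc m * exp (- a\<^sup>2) / half_moment (Suc m)) * indicator {0<..} a *
      (ennreal (b ^ m * exp (- b\<^sup>2) / half_moment m) * indicator {0<..} b *
      (ennreal (exp (- z\<^sup>2) / sqrt pi) * indicator {(a, z, b). \<tau> * b - \<theta> * a \<le> z} (a, z, b))) \<partial>lborel \<partial>lborel \<partial>lborel)"
    by (simp add: nn_integral_chi_Suc nn_integral_gauss nn_integral_cmult)
  also have "\<dots> = (\<integral>\<^sup>+a. \<integral>\<^sup>+b. \<integral>\<^sup>+t. G a b t \<partial>lborel \<partial>lborel \<partial>lborel)"
  proof (rule nn_integral_cong, rule nn_integral_cong)
    fix a b :: real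
    show "(\<integral>\<^sup>+z. ennreal (a ^ Suc m * exp (- a\<^sup>2) / half_moment (Suc m)) * indicator {0<..} a *
      (ennreal (b ^ m * exp (- b\<^sup>2) / half_moment m) * indicator {0<..} b *
      (ennreal (exp (- z\<^sup>2) / sqrt pi) * indicator {(a, z, b). \<tau> * b - \<theta> * a \<le> z} (a, z, b))) \<partial>lborel) =
      (\<integral>\<^sup>+t. G a b t \<partial>lborel)" (is "(\<integral>\<^sup>+z. ?f z \<partial>lborel) = _")
    proof (cases "a > 0 \<and> b > 0")
      case True
      have "(\<integral>\<^sup>+z. ?f z \<partial>lborel) = ennreal \<bar>b\<bar> * (\<integral>\<^sup>+t. ?f (- \<theta> * a + b * t) \<partial>lborel)"
        using True by (intro nn_integral_real_affine) auto
      also have "\<dots> = (\<integral>\<^sup>+t. ennreal b * ?f (- \<theta> * a + b * t) \<partial>lborel)"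
        using True by (simp add: nn_integral_cmult)
      also have "\<dots> = (\<integral>\<^sup>+t. G a b t \<partial>lborel)"
      proof (rule nn_integral_cong)
        fix t
        have le: "\<tau> * b - \<theta> * a \<le> - \<theta> * a + b * t \<longleftrightarrow> \<tau> \<le> t"
          using True by (auto simp: mult.commute)
        have "b * (a ^ Suc m * exp (- a\<^sup>2) / half_moment (Suc m) * (b ^ m * exp (- b\<^sup>2) / half_moment m * (exp (- (- \<theta> * a + b * t)\<^sup>2) / sqrt pi))) =
          K * (a ^ Suc m * b ^ Suc m * (exp (- a\<^sup>2) * exp (- b\<^sup>2) * exp (- (b * t - \<theta> * a)\<^sup>2)))"
          by (simp add: K_def mult_ac)
        also have "exp (- a\<^sup>2) * exp (- b\<^sup>2) * exp (- (b * t - \<theta> * a)\<^sup>2) = exp (- a\<^sup>2 - b\<^sup>2 - (b * t - \<theta> * a)\<^sup>2)"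
          by (simp add: exp_add[symmetric])
        finally show "ennreal b * ?f (- \<theta> * a + b * t) = G a b t"
          using True half_moment_pos[of m] half_moment_pos[of "Suc m"] le
          by (auto simp: G_def indicator_def ennreal_mult'[symmetric] ennreal_mult''[symmetric])
      qed
      finally show ?thesis .
    next
      case False
      then have "indicator {0<..} a * indicator {0<..} b = (0::ennreal)" by (auto simp: indicator_def)
      then have "G a b t = 0" for t by (auto simp: G_def)
      moreover from False have "?f = (\<lambda>_. 0)" by (intro ext) (auto simp: indicator_def)
      ultimately show ?thesis by (simp only: nn_integral_const mult_zero_left)
    qed
  qed
  also have "\<dots> = (\<integral>\<^sup>+a. \<integral>\<^sup>+t. \<integral>\<^sup>+b. G a b t \<partial>lborel \<partial>lborel \<partial>lborel)"
    by (intro nn_integral_cong nn_integral_swap sf) measurable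
  also have "\<dots> = (\<integral>\<^sup>+t. \<integral>\<^sup>+a. \<integral>\<^sup>+b. G a b t \<partial>lborel \<partial>lborel \<partial>lborel)"
    by (intro nn_integral_swap sf) measurable
  also have "\<dots> = (\<integral>\<^sup>+t. \<integral>\<^sup>+b. \<integral>\<^sup>+a. G a b t \<partial>lborel \<partial>lborel \<partial>lborel)"
    by (intro nn_integral_cong nn_integral_swap sf) measurable
  also have "\<dots> = (\<integral>\<^sup>+t. \<integral>\<^sup>+s. ennreal ?C * ?F t s \<partial>lborel \<partial>lborel)"
  proof (rule nn_integral_cong)
    fix t :: real
    \<comment> \<open>This scale balances the coefficients \<open>1 + \<theta>^2\<close> of
      \<open>a^2\<close> and \<open>1 + t^2\<close> of \<open>b^2\<close>. With
      \<open>a = b r s\<close> the form becomes symmetric under \<open>s \<rightarrow> 1 / s\<close>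
      up to the factor \<open>s\<close>, which places the minimum of \<open>phase\<close> in
      \<open>s\<close> at 1 for every \<open>t\<close>.\<close>
    define r where "r = sqrt ((1 + t\<^sup>2) / (1 + \<theta>\<^sup>2))"
    have p: "1 + t\<^sup>2 > 0" "1 + \<theta>\<^sup>2 > 0" by (simp_all add: add_pos_nonneg)
    have r: "r > 0" using p by (simp add: r_def)
    have r2: "(1 + \<theta>\<^sup>2) * r\<^sup>2 = 1 + t\<^sup>2" using p by (simp add: r_def)
    have rE: "r * sqrt ((1 + \<theta>\<^sup>2) * (1 + t\<^sup>2)) = 1 + t\<^sup>2"
      using p by (simp add: r_def real_sqrt_mult real_sqrt_divide)
    define H where "H s = r * s * phase \<theta> t s" for s
    have H: "(b * r * s)\<^sup>2 + b\<^sup>2 + (b * t - \<theta> * (b * r * s))\<^sup>2 = b\<^sup>2 * H s" if "s > 0" for b s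
    proof -
      have "H s = r * sqrt ((1 + \<theta>\<^sup>2) * (1 + t\<^sup>2)) * (s * s + 1) - 2 * \<theta> * t * r * s"
        using that by (simp add: H_def phase_def field_simps)
      also have "\<dots> = (1 + t\<^sup>2) * (s\<^sup>2 + 1) - 2 * \<theta> * t * r * s"
        by (simp only: rE power2_eq_square[of s])
      also have "\<dots> = (1 + \<theta>\<^sup>2) * r\<^sup>2 * s\<^sup>2 + (1 + t\<^sup>2) - 2 * \<theta> * t * r * s"
        by (simp add: r2 distrib_left)
      finally have Hs: "H s = (1 + \<theta>\<^sup>2) * r\<^sup>2 * s\<^sup>2 + (1 + t\<^sup>2) - 2 * \<theta> * t * r * s" .
      show ?thesis unfolding Hs by algebra
    qed
    have Hp: "H s > 0" if "s > 0" for s using that r phase_pos[OF that] by (simp add: H_def)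
    define F where "F b s = ennreal (K * (r ^ Suc (Suc m) * s ^ Suc m * (b ^ (2 * m + 3) * exp (- (b\<^sup>2 * H s))))) *
       indicator {0<..} s * indicator {0<..} b * indicator {\<tau>..} t" for b s
    have [measurable]: "(\<lambda>(b, s). F b s) \<in> borel_measurable (borel \<Otimes>\<^sub>M borel)"
      unfolding F_def H_def by measurable
    have "(\<integral>\<^sup>+b. \<integral>\<^sup>+a. G a b t \<partial>lborel \<partial>lborel) = (\<integral>\<^sup>+b. \<integral>\<^sup>+s. F b
      s \<partial>lborel \<partial>lborel)"
    proof (rule nn_integral_cong)
      fix b :: real
      show "(\<integral>\<^sup>+a. G a b t \<partial>lborel) = (\<integral>\<^sup>+s. F b s \<partial>lborel)"
      proof (cases "b > 0")
        case True
        have "(\<integral>\<^sup>+a. G a b t \<partial>lborel) = ennreal \<bar>b * r\<bar> * (\<integral>\<^sup>+s. G (0 + b * r * s) b t \<partial>lborel)"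
          using True r by (intro nn_integral_real_affine) auto
        also have "\<dots> = (\<integral>\<^sup>+s. ennreal (b * r) * G (b * r * s) b t \<partial>lborel)"
          using True r by (simp add: nn_integral_cmult)
        also have "\<dots> = (\<integral>\<^sup>+s. F b s \<partial>lborel)"
        proof (rule nn_integral_cong)
          fix s
          show "ennreal (b * r) * G (b * r * s) b t = F b s"
          proof (cases "s > 0")
            case s: True
            have e: "- (b * r * s)\<^sup>2 - b\<^sup>2 - (b * t - \<theta> * (b * r * s))\<^sup>2 = - (b\<^sup>2 * H s)"
              using H[OF s, of b] by linarith
            have "b * r * (K * ((b * r * s) ^ Suc m * b ^ Suc m * exp (- (b\<^sup>2 * H s)))) =
               K * (r ^ Suc (Suc m) * s ^ Suc m * ((b * b ^ Suc m * b ^ Suc m) * exp (- (b\<^sup>2 * H s))))"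
              by (simp add: power_mult_distrib mult_ac)
            also have "b * b ^ Suc m * b ^ Suc m = b ^ (2 * m + 3)"
              by (simp add: power_add[symmetric] mult_2 eval_nat_numeral)
            finally have fin: "b * r * (K * ((b * r * s) ^ Suc m * b ^ Suc m * exp (- (b\<^sup>2 * H s)))) =
               K * (r ^ Suc (Suc m) * s ^ Suc m * (b ^ (2 * m + 3) * exp (- (b\<^sup>2 * H s))))" .
            have G1: "G (b * r * s) b t = ennreal (K * ((b * r * s) ^ Suc m * b ^ Suc m * exp (- (b\<^sup>2 * H s)))) * indicator {\<tau>..} t"
              unfolding G_def e using True r s by simp
            have F1: "F b s = ennreal (K * (r ^ Suc (Suc m) * s ^ Suc m * (b ^ (2 * m + 3) * exp (- (b\<^sup>2 * H s))))) * indicator {\<tau>..} t"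
              unfolding F_def using True s by simp
            have "0 \<le> b * r" using True r by simp
            then show ?thesis
              unfolding G1 F1 fin[symmetric] by (rule em)
          next
            case False
            have "0 < b * r" using True r by simp
            then have "\<not> 0 < b * r * s" using False zero_less_mult_pos[of "b * r" s] by blast
            then show ?thesis using False by (simp add: G_def F_def)
          qed
        qed
        finally show ?thesis .
      qed (simp add: G_def F_def)
    qed
    also have "\<dots> = (\<integral>\<^sup>+s. \<integral>\<^sup>+b. F b s \<partial>lborel \<partial>lborel)"
      by (intro nn_integral_swap sf) measurable
    also have "\<dots> = (\<integral>\<^sup>+s. ennreal ?C * ?F t s \<partial>lborel)"
    proof (rule nn_integral_cong)
      fix s :: real
      show "(\<integral>\<^sup>+b. F b s \<partial>lborel) = ennreal ?C * ?F t s"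
      proof (cases "s > 0")
        case s: True
        \<comment> \<open>Scaling \<open>b\<close> by \<open>1 / h\<close> frees the exponential
          from \<open>s\<close> and \<open>t\<close>; a half-line moment of odd order
          remains.\<close>
        define h where "h = sqrt (H s)"
        have h: "h > 0" "h\<^sup>2 = H s" using Hp[OF s] by (simp_all add: h_def)
        define C where "C = K * (r ^ Suc (Suc m) * s ^ Suc m) / h ^ (2 * m + 4)"
        have Cp: "C \<ge> 0" using K r s h by (simp add: C_def)
        have "(\<integral>\<^sup>+b. F b s \<partial>lborel) = ennreal \<bar>1 / h\<bar> * (\<integral>\<^sup>+x. F (0 + 1 / h * x) s \<partial>lborel)"
          using h by (intro nn_integral_real_affine) auto
        also have "\<dots> = (\<integral>\<^sup>+x. ennreal (1 / h) * F (x / h) s \<partial>lborel)"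
          using h by (simp add: nn_integral_cmult)
        also have "\<dots> = (\<integral>\<^sup>+x. ennreal C * indicator {\<tau>..} t * (ennreal (x ^ (2 * m + 3) * exp (- x\<^sup>2)) * indicator {0<..} x) \<partial>lborel)"
        proof (rule nn_integral_cong)
          fix x
          have e: "(x / h)\<^sup>2 * H s = x\<^sup>2" using h(1) by (simp add: power_divide h(2)[symmetric])
          show "ennreal (1 / h) * F (x / h) s = ennreal C * indicator {\<tau>..} t * (ennreal (x ^ (2 * m + 3) * exp (- x\<^sup>2)) * indicator {0<..} x)"
          proof (cases "x > 0 \<and> t \<ge> \<tau>")
            case True
            have "1 / h * (K * (r ^ Suc (Suc m) * s ^ Suc m * ((x / h) ^ (2 * m + 3) * exp (- x\<^sup>2)))) =
              K * (r ^ Suc (Suc m) * s ^ Suc m) / (h * h ^ (2 * m + 3)) * (x ^ (2 * m + 3) * exp (- x\<^sup>2))"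
              by (simp add: power_divide)
            also have "h * h ^ (2 * m + 3) = h ^ (2 * m + 4)" by (simp add: eval_nat_numeral)
            finally have fin: "1 / h * (K * (r ^ Suc (Suc m) * s ^ Suc m * ((x / h) ^ (2 * m + 3) * exp (- x\<^sup>2)))) =
              C * (x ^ (2 * m + 3) * exp (- x\<^sup>2))" by (simp only: C_def)
            have F1: "F (x / h) s = ennreal (K * (r ^ Suc (Suc m) * s ^ Suc m * ((x / h) ^ (2 * m + 3) * exp (- x\<^sup>2))))"
              unfolding F_def e using True s h by simp
            have "0 \<le> 1 / h" using h by simp
            then have "ennreal (1 / h) * F (x / h) s = ennreal (C * (x ^ (2 * m + 3) * exp (- x\<^sup>2)))"
              unfolding F1 fin[symmetric] by (simp only: ennreal_mult')
            then show ?thesis using True Cp by (simp add: ennreal_mult')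
          next
            case False
            have "0 < x / h \<longleftrightarrow> 0 < x" using h by (simp add: zero_less_divide_iff)
            then show ?thesis using False by (auto simp: F_def indicator_def)
          qed
        qed
        also have "\<dots> = ennreal C * indicator {\<tau>..} t * ennreal (half_moment (2 * m + 3))"
          by (subst nn_integral_cmult) (auto simp: nn_integral_half_moment)
        also have "\<dots> = ennreal (C * half_moment (2 * m + 3)) * indicator {\<tau>..} t"
          using Cp half_moment_pos[of "2 * m + 3"] by (simp add: ennreal_mult'' mult_ac)
        \<comment> \<open>By duplication \<open>K\<close> equals
          \<open>4 * 2 ^ m / (pi * fact m)\<close>, and the remaining moment is
          \<open>fact (Suc m) / 2\<close>; their product is the stated constant.\<close>
        also have "C * half_moment (2 * m + 3) = real (Suc m) * 2 ^ Suc m / pi * (1 / (s * phase \<theta> t s ^ Suc (Suc m)))"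
        proof -
          have n: "2 * m + 4 = 2 * Suc (Suc m)" by simp
          have "h ^ (2 * m + 4) = H s ^ Suc (Suc m)"
            unfolding n power_mult h(2) ..
          also have "\<dots> = r ^ Suc (Suc m) * s ^ Suc m * (s * phase \<theta> t s ^ Suc (Suc m))"
            by (simp add: H_def power_mult_distrib mult_ac)
          finally have Cq: "C = K * (1 / (s * phase \<theta> t s ^ Suc (Suc m)))"
            using r s by (simp add: C_def)
          have hq: "half_moment (2 * m + 3) = fact (Suc m) / 2"
            using half_moment_odd[of "Suc m"] by (simp add: numeral_3_eq_3)
          have Kq: "K = 4 * 2 ^ m / (pi * fact m)"
            using half_moment_product[of m] by (simp add: K_def mult.commute[of "half_moment (Suc m)"])
          show ?thesis unfolding Cq hq Kq by simp
        qed
        finally have fin: "(\<integral>\<^sup>+b. F b s \<partial>lborel) =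
          ennreal (real (Suc m) * 2 ^ Suc m / pi * (1 / (s * phase \<theta> t s ^ Suc (Suc m)))) * indicator {\<tau>..} t" .
        have p: "0 \<le> real (Suc m) * 2 ^ Suc m / pi" by simp
        have i: "indicator {0<..} s = (1::ennreal)" using s by simp
        show ?thesis
          unfolding fin em[OF p, symmetric] by (simp only: i mult_1_right)
      qed (simp add: F_def)
    qed
    finally show "(\<integral>\<^sup>+b. \<integral>\<^sup>+a. G a b t \<partial>lborel \<partial>lborel) = (\<integral>\<^sup>+s. ennreal ?C * ?F t s \<partial>lborel)" .
  qed
  also have "\<dots> = ennreal ?C *
    (\<integral>\<^sup>+t. \<integral>\<^sup>+s. ?F t s \<partial>lborel \<partial>lborel)"
    by (simp add: nn_integral_cmult)
  finally show ?thesis .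
qed

section \<open>Laplace asymptotics\<close>

text \<open>The base varies freely with the index, so the limit is taken in the exponent, where
  \<open>ln a\<close> is squeezed between \<open>(a - 1) / a\<close> and
  \<open>a - 1\<close>.\<close>

lemma tendsto_power_exp:
  fixes a :: "nat \<Rightarrow> real" and N :: "nat \<Rightarrow> nat"
  assumes ge: "\<And>i. a i \<ge> 1" and lim: "(\<lambda>i. real (N i) * (a i - 1)) \<longlonglongrightarrow> z" and a: "a \<longlonglongrightarrow> 1"
  shows "(\<lambda>i. a i ^ N i) \<longlonglongrightarrow> exp z"
proof -
  have "(\<lambda>i. real (N i) * ln (a i)) \<longlonglongrightarrow> z"
  proof (rule tendsto_sandwich)
    show "\<forall>\<^sub>F i in sequentially. real (N i) * (a i - 1) / a i \<le> real (N i) * ln (a i)"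
    proof (rule always_eventually, rule allI)
      fix i
      have "ln (1 / a i) \<le> 1 / a i - 1" by (rule ln_le_minus_one) (use ge[of i] in simp)
      then have "(a i - 1) / a i \<le> ln (a i)" using ge[of i] by (simp add: ln_div diff_divide_distrib)
      from mult_left_mono[OF this, of "real (N i)"]
      show "real (N i) * (a i - 1) / a i \<le> real (N i) * ln (a i)" by simp
    qed
    show "\<forall>\<^sub>F i in sequentially. real (N i) * ln (a i) \<le> real (N i) * (a i - 1)"
      by (intro always_eventually allI mult_left_mono ln_le_minus_one) (use ge in \<open>auto intro: less_le_trans[OF zero_less_one]\<close>)
    show "(\<lambda>i. real (N i) * (a i - 1) / a i) \<longlonglongrightarrow> z"
      using tendsto_divide[OF lim a] by simp
  qed (rule lim)
  then have "(\<lambda>i. exp (real (N i) * ln (a i))) \<longlonglongrightarrow> exp z" by (rule tendsto_exp)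
  moreover have "exp (real (N i) * ln (a i)) = a i ^ N i" for i
    using ge[of i] by (simp add: exp_of_nat_mult)
  ultimately show ?thesis by simp
qed

section \<open>Model integrals for the limit and for its majorant\<close>

lemma nn_integral_inverse_one_plus_square:
  "(\<integral>\<^sup>+x. ennreal (inverse (1 + x\<^sup>2)) \<partial>lborel) < \<infinity>"
proof -
  let ?f = "\<lambda>x::real. ennreal (inverse (1 + x\<^sup>2))"
  have I: "(\<integral>\<^sup>+x. ?f x * indicator {0..} x \<partial>lborel) = ennreal (pi / 2 - arctan 0)"
    by (rule nn_integral_FTC_atLeast) (auto intro!: derivative_eq_intros tendsto_arctan_at_top simp: add_nonneg_eq_0_iff field_simps)
  have "(\<integral>\<^sup>+x. ?f x \<partial>lborel) \<le> (\<integral>\<^sup>+x. ?f x * indicator {0..} x + ?f (- x) * indicator {0..} (- x) \<partial>lborel)"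
    by (intro nn_integral_mono) (auto simp: indicator_def)
  also have "\<dots> = (\<integral>\<^sup>+x. ?f x * indicator {0..} x \<partial>lborel) + (\<integral>\<^sup>+x. ?f (- x) * indicator {0..} (- x) \<partial>lborel)"
    by (rule nn_integral_add) auto
  also have "(\<integral>\<^sup>+x. ?f (- x) * indicator {0..} (- x) \<partial>lborel) = (\<integral>\<^sup>+x. ?f x * indicator {0..} x \<partial>lborel)"
    by (subst (2) nn_integral_real_affine[where c = "-1" and t = 0]) simp_all
  finally show ?thesis unfolding I by (simp add: ennreal_plus[symmetric] order_le_less_trans del: ennreal_plus)
qed

lemma nn_integral_exp_minus_half_line:
  assumes "\<alpha> > 0"
  shows "(\<integral>\<^sup>+x. ennreal (exp (- (\<alpha> * x))) * indicator {0..} x \<partial>lborel) = ennreal (1 / \<alpha>)"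
proof -
  have "(\<integral>\<^sup>+x. ennreal (exp (- (\<alpha> * x))) * indicator {0..} x \<partial>lborel) = ennreal (0 - (- exp (- (\<alpha> * 0)) / \<alpha>))"
  proof (rule nn_integral_FTC_atLeast)
    show "((\<lambda>x. - exp (- (\<alpha> * x)) / \<alpha>) \<longlongrightarrow> 0) at_top"
      using assms by real_asymp
  qed (use assms in \<open>auto intro!: derivative_eq_intros\<close>)
  then show ?thesis by simp
qed

lemma nn_integral_exp_minus_square:
  assumes "\<beta> > 0"
  shows "(\<integral>\<^sup>+x. ennreal (exp (- (\<beta> * x\<^sup>2))) \<partial>lborel) = ennreal (sqrt (pi / \<beta>))"
proof -
  have "1 = (\<integral>\<^sup>+x. 1 \<partial>gauss)" by (simp add: gauss.emeasure_space_1[simplified])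
  also have "\<dots> = (\<integral>\<^sup>+x. ennreal (exp (- x\<^sup>2) / sqrt pi) \<partial>lborel)"
    by (subst nn_integral_gauss) auto
  also have "\<dots> = ennreal (sqrt \<beta>) * (\<integral>\<^sup>+x. ennreal (exp (- (0 + sqrt \<beta> * x)\<^sup>2) / sqrt pi) \<partial>lborel)"
    using assms by (subst nn_integral_real_affine[where c = "sqrt \<beta>" and t = 0]) auto
  also have "\<dots> = (\<integral>\<^sup>+x. ennreal (sqrt \<beta> / sqrt pi) * ennreal (exp (- (\<beta> * x\<^sup>2))) \<partial>lborel)"
    using assms
    by (subst nn_integral_cmult[symmetric])
      (auto simp: ennreal_mult'[symmetric] power_mult_distrib intro!: nn_integral_cong)
  also have "\<dots> = ennreal (sqrt \<beta> / sqrt pi) * (\<integral>\<^sup>+x. ennreal (exp (- (\<beta> * x\<^sup>2))) \<partial>lborel)"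
    by (subst nn_integral_cmult) auto
  finally have e: "ennreal (sqrt \<beta> / sqrt pi) * (\<integral>\<^sup>+x. ennreal (exp (- (\<beta> * x\<^sup>2))) \<partial>lborel) = 1" by simp
  have "(\<integral>\<^sup>+x. ennreal (exp (- (\<beta> * x\<^sup>2))) \<partial>lborel) =
      ennreal (sqrt (pi / \<beta>)) * (ennreal (sqrt \<beta> / sqrt pi) * (\<integral>\<^sup>+x. ennreal (exp (- (\<beta> * x\<^sup>2))) \<partial>lborel))"
    using assms by (simp add: mult.assoc[symmetric] ennreal_mult[symmetric] real_sqrt_divide)
  then show ?thesis unfolding e by simp
qed

text \<open>Writing \<open>s + 1 / s\<close> as \<open>2 + (s - 1)^2 / s\<close> separates the value
  at the minimiser \<open>s = 1\<close> from a nonnegative quadratic excess.\<close>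

lemma phase_split:
  assumes "s > 0"
  shows "phase \<theta> t s = 2 * (sqrt (1 + \<theta>\<^sup>2) * sqrt (1 + t\<^sup>2) - \<theta> * t) + sqrt (1 + \<theta>\<^sup>2) * sqrt (1 + t\<^sup>2) * ((s - 1)\<^sup>2 / s)"
proof -
  have "s + 1 / s = 2 + (s - 1)\<^sup>2 / s"
    using assms by (simp add: field_simps power2_eq_square)
  then show ?thesis unfolding phase_def real_sqrt_mult by (simp add: algebra_simps)
qed

text \<open>The constants are the local data of \<open>phase\<close> at \<open>(\<tau>, 1)\<close>:
  its value is \<open>2 * G0\<close>, its derivative in \<open>t\<close> is \<open>2 * D\<close>, so
  \<open>\<alpha>\<close> is the logarithmic derivative in \<open>t\<close>, and
  \<open>\<beta>\<close> is half the logarithmic second derivative in \<open>s\<close>. The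
  condition \<open>D > 0\<close> says that \<open>phase\<close> grows from the boundary
  \<open>t = \<tau>\<close> inwards.\<close>

context
  fixes \<theta> \<tau> G0 D \<alpha> \<beta> :: real
  assumes D_def: "D = sqrt (1 + \<theta>\<^sup>2) * \<tau> / sqrt (1 + \<tau>\<^sup>2) - \<theta>" and D_pos: "D > 0"
    and G0_def: "G0 = sqrt (1 + \<theta>\<^sup>2) * sqrt (1 + \<tau>\<^sup>2) - \<theta> * \<tau>"
    and alpha_def: "\<alpha> = D / G0"
    and beta_def: "\<beta> = sqrt (1 + \<theta>\<^sup>2) * sqrt (1 + \<tau>\<^sup>2) / (2 * G0)"
begin

lemma G0_pos: "G0 > 0"
  using sqrt_one_plus_square_gt[of \<theta> \<tau>] by (simp add: G0_def real_sqrt_mult)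

lemma alpha_pos: "\<alpha> > 0"
  using D_pos G0_pos by (simp add: alpha_def)

lemma beta_pos: "\<beta> > 0"
  using G0_pos by (simp add: beta_def add_pos_nonneg)

text \<open>In \<open>t\<close> the bound is the tangent line at \<open>\<tau>\<close> of the convex
  function \<open>sqrt (1 + t^2)\<close>, obtained from Cauchy-Schwarz for
  \<open>(1, \<tau>)\<close> and \<open>(1, t)\<close>. In \<open>s\<close> the coefficient of the
  excess is bounded below by 1. The estimate serves both the pointwise limit, where the base has to
  be at least 1, and the domination.\<close>

lemma phase_ge:
  assumes t: "t \<ge> \<tau>" and s: "s > 0"
  shows "phase \<theta> t s / (2 * G0) \<ge> 1 + \<alpha> * (t - \<tau>) + (s - 1)\<^sup>2 / s / (2 * G0)"
proof -
  have p: "1 + \<tau>\<^sup>2 > 0" "1 + t\<^sup>2 > 0" by (simp_all add: add_pos_nonneg)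
  have "(1 + \<tau> * t)\<^sup>2 \<le> (1 + \<tau>\<^sup>2) * (1 + t\<^sup>2)"
  proof -
    have "(1 + \<tau>\<^sup>2) * (1 + t\<^sup>2) - (1 + \<tau> * t)\<^sup>2 = (t - \<tau>)\<^sup>2" by algebra
    then show ?thesis using zero_le_power2[of "t - \<tau>"] by linarith
  qed
  then have "1 + \<tau> * t \<le> sqrt (1 + \<tau>\<^sup>2) * sqrt (1 + t\<^sup>2)"
    unfolding real_sqrt_mult[symmetric] by (rule real_le_rsqrt)
  moreover have "1 + \<tau> * t = sqrt (1 + \<tau>\<^sup>2) * (sqrt (1 + \<tau>\<^sup>2) + \<tau> / sqrt (1 + \<tau>\<^sup>2) * (t - \<tau>))"
    using p by (simp add: distrib_left) (simp add: algebra_simps power2_eq_square)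
  ultimately have "sqrt (1 + \<tau>\<^sup>2) * (sqrt (1 + \<tau>\<^sup>2) + \<tau> / sqrt (1 + \<tau>\<^sup>2) * (t - \<tau>)) \<le> sqrt (1 +
    \<tau>\<^sup>2) * sqrt (1 + t\<^sup>2)"
    by simp
  then have "sqrt (1 + \<tau>\<^sup>2) + \<tau> / sqrt (1 + \<tau>\<^sup>2) * (t - \<tau>) \<le> sqrt (1 + t\<^sup>2)"
    using p by simp
  then have "sqrt (1 + \<theta>\<^sup>2) * (sqrt (1 + \<tau>\<^sup>2) + \<tau> / sqrt (1 + \<tau>\<^sup>2) * (t - \<tau>)) \<le> sqrt (1 + \<theta>\<^sup>2) * sqrt (1 + t\<^sup>2)"
    by (intro mult_left_mono) auto
  moreover have "sqrt (1 + \<theta>\<^sup>2) * (sqrt (1 + \<tau>\<^sup>2) + \<tau> / sqrt (1 + \<tau>\<^sup>2) * (t - \<tau>)) - \<theta> * t = G0 + D * (t - \<tau>)"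
    by (simp add: G0_def D_def algebra_simps)
  ultimately have 1: "G0 + D * (t - \<tau>) \<le> sqrt (1 + \<theta>\<^sup>2) * sqrt (1 + t\<^sup>2) - \<theta> * t" by linarith
  have "1 * ((s - 1)\<^sup>2 / s) \<le> sqrt (1 + \<theta>\<^sup>2) * sqrt (1 + t\<^sup>2) * ((s - 1)\<^sup>2 / s)"
    using s mult_mono[of 1 "sqrt (1 + \<theta>\<^sup>2)" 1 "sqrt (1 + t\<^sup>2)"] by (intro mult_right_mono) auto
  then have "2 * (G0 + D * (t - \<tau>)) + (s - 1)\<^sup>2 / s \<le> phase \<theta> t s"
    unfolding phase_split[OF s] using 1 by (intro add_mono mult_left_mono) auto
  then have "(2 * (G0 + D * (t - \<tau>)) + (s - 1)\<^sup>2 / s) / (2 * G0) \<le> phase \<theta> t s / (2 * G0)"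
    using G0_pos by (intro divide_right_mono) auto
  moreover have "(2 * (G0 + D * (t - \<tau>)) + (s - 1)\<^sup>2 / s) / (2 * G0) = 1 + \<alpha> * (t - \<tau>) + (s - 1)\<^sup>2 / s / (2 * G0)"
    using G0_pos by (simp add: alpha_def add_divide_distrib)
  ultimately show ?thesis by simp
qed

lemma phase_scaled_tendsto:
  fixes N :: "nat \<Rightarrow> nat"
  assumes N: "filterlim N at_top sequentially" "\<And>i. N i > 0" and x: "x \<ge> 0"
    and s: "\<And>i. 1 + y / sqrt (N i) > 0"
  shows "(\<lambda>i. (phase \<theta> (\<tau> + x / N i) (1 + y / sqrt (N i)) / (2 * G0)) ^ N i) \<longlonglongrightarrow> exp (\<alpha> * x + \<beta> * y\<^sup>2)"
proof (rule tendsto_power_exp)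
  let ?g = "\<lambda>i. phase \<theta> (\<tau> + x / N i) (1 + y / sqrt (N i))"
  have N': "filterlim (\<lambda>i. real (N i)) at_top sequentially"
    by (rule filterlim_compose[OF filterlim_real_sequentially N(1)])
  have N'': "filterlim (\<lambda>i. sqrt (real (N i))) at_top sequentially"
    by (rule filterlim_compose[OF sqrt_at_top N'])
  have x0: "(\<lambda>i. x / real (N i)) \<longlonglongrightarrow> 0" for x
    by (rule tendsto_divide_0[OF tendsto_const]) (rule filterlim_at_top_imp_at_infinity[OF N'])
  have y0: "(\<lambda>i. y / sqrt (real (N i))) \<longlonglongrightarrow> 0"
    by (rule tendsto_divide_0[OF tendsto_const]) (rule filterlim_at_top_imp_at_infinity[OF N''])
  have p: "1 + t\<^sup>2 > 0" for t :: real by (simp add: add_pos_nonneg)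
  define A where "A i = sqrt (1 + (\<tau> + x / N i)\<^sup>2)" for i
  define B where "B = sqrt (1 + \<tau>\<^sup>2)"
  define E where "E = sqrt (1 + \<theta>\<^sup>2)"
  have Bp: "B > 0" using p by (simp add: B_def)
  have Ap: "A i > 0" for i using p by (simp add: A_def)
  have A: "A \<longlonglongrightarrow> B"
    using tendsto_real_sqrt[OF tendsto_add[OF tendsto_const[of 1] tendsto_power[OF tendsto_add[OF tendsto_const[of \<tau>] x0[of x]], of 2]]]
    by (simp add: A_def[abs_def] B_def)
  \<comment> \<open>Multiplying by the conjugate gives the exact increment of the square root, so no
    Taylor remainder has to be controlled.\<close>
  have AB: "real (N i) * (A i - B) = (2 * \<tau> * x + x\<^sup>2 / N i) / (A i + B)" for i
  proof -
    have "(A i - B) * (A i + B) = (\<tau> + x / N i)\<^sup>2 - \<tau>\<^sup>2"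
      using p by (simp add: A_def B_def algebra_simps)
    then have "real (N i) * (A i - B) * (A i + B) = N i * ((\<tau> + x / N i)\<^sup>2 - \<tau>\<^sup>2)" by simp
    also have "\<dots> = 2 * \<tau> * x + x\<^sup>2 / N i"
      using N(2)[of i] by (simp add: power2_eq_square field_simps)
    finally show ?thesis using Ap[of i] Bp by (simp add: eq_divide_eq)
  qed
  have "(\<lambda>i. real (N i) * (A i - B)) \<longlonglongrightarrow> \<tau> * x / B"
    unfolding AB
    using tendsto_divide[OF tendsto_add[OF tendsto_const[of "2 * \<tau> * x"] x0[of "x\<^sup>2"]] tendsto_add[OF A tendsto_const[of B]]] Bp
    by simp
  then have lim1: "(\<lambda>i. real (N i) * (A i - B) * E - \<theta> * x) \<longlonglongrightarrow> \<tau> * x / B * E - \<theta> * x"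
    by (intro tendsto_intros)
  have lim2: "(\<lambda>i. E * A i * (y\<^sup>2 / (1 + y / sqrt (N i)))) \<longlonglongrightarrow> E * B * y\<^sup>2"
    using tendsto_mult[OF tendsto_mult[OF tendsto_const[of E] A]
        tendsto_divide[OF tendsto_const[of "y\<^sup>2"] tendsto_add[OF tendsto_const[of 1] y0]]] by simp
  have eq: "real (N i) * (?g i / (2 * G0) - 1) =
      (2 * (real (N i) * (A i - B) * E - \<theta> * x) + E * A i * (y\<^sup>2 / (1 + y / sqrt (N i)))) / (2 * G0)" for i
  proof -
    have "?g i - 2 * G0 =
        2 * ((A i - B) * E - \<theta> * x / N i) + E * A i * ((y\<^sup>2 / N i) / (1 + y / sqrt (N i)))"
      unfolding phase_split[OF s] G0_def A_def[symmetric] B_def[symmetric] E_def[symmetric]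
      using N(2)[of i] by (simp add: power_divide algebra_simps)
    then have "real (N i) * (?g i - 2 * G0) =
        real (N i) * (2 * ((A i - B) * E - \<theta> * x / N i) + E * A i * ((y\<^sup>2 / N i) / (1 + y / sqrt (N i))))" by simp
    also have "\<dots> = 2 * (real (N i) * (A i - B) * E - \<theta> * x) + E * A i * (y\<^sup>2 / (1 + y / sqrt (N i)))"
    proof -
      have "n * (2 * (a * E - \<theta> * x / n) + E * b * ((y\<^sup>2 / n) / S)) = 2 * (n * a * E - \<theta> * x) + E * b * (y\<^sup>2 / S)"
        if "n > 0" for n a b S :: real
        using that by (simp add: algebra_simps)
      then show ?thesis using N(2)[of i] by simp
    qed
    finally have "real (N i) * (?g i - 2 * G0) / (2 * G0) =
        (2 * (real (N i) * (A i - B) * E - \<theta> * x) + E * A i * (y\<^sup>2 / (1 + y / sqrt (N i)))) / (2 * G0)" by (rule arg_cong)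
    moreover have "n * (g / d - 1) = n * (g - d) / d" if "d > 0" for n g d :: real
      using that by (simp add: field_simps)
    ultimately show ?thesis using G0_pos by simp
  qed
  have "(\<lambda>i. (2 * (real (N i) * (A i - B) * E - \<theta> * x) + E * A i * (y\<^sup>2 / (1 + y / sqrt (N i)))) / (2 * G0)) \<longlonglongrightarrow>
      (2 * (\<tau> * x / B * E - \<theta> * x) + E * B * y\<^sup>2) / (2 * G0)"
    using G0_pos by (intro tendsto_intros lim1 lim2) auto
  moreover have "(2 * (\<tau> * x / B * E - \<theta> * x) + E * B * y\<^sup>2) / (2 * G0) = \<alpha> * x + \<beta> * y\<^sup>2"
    using G0_pos by (simp add: alpha_def beta_def D_def B_def E_def add_divide_distrib algebra_simps diff_divide_distrib)
  ultimately show lim: "(\<lambda>i. real (N i) * (?g i / (2 * G0) - 1)) \<longlonglongrightarrow> \<alpha> * x + \<beta> * y\<^sup>2"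
    unfolding eq by simp
  show "?g i / (2 * G0) \<ge> 1" for i
  proof -
    have "0 \<le> \<alpha> * (\<tau> + x / N i - \<tau>)" using alpha_pos x by simp
    moreover have "0 \<le> (1 + y / sqrt (N i) - 1)\<^sup>2 / (1 + y / sqrt (N i)) / (2 * G0)"
      using s[of i] G0_pos by (intro divide_nonneg_pos) auto
    moreover have "\<tau> \<le> \<tau> + x / N i" using x by simp
    ultimately show ?thesis using phase_ge[OF _ s, of "\<tau> + x / N i" i] by linarith
  qed
  have "(\<lambda>i. real (N i) * (?g i / (2 * G0) - 1) * (1 / real (N i))) \<longlonglongrightarrow> (\<alpha> * x + \<beta> * y\<^sup>2) * 0"
    by (intro tendsto_mult lim x0)
  then have "(\<lambda>i. ?g i / (2 * G0) - 1) \<longlonglongrightarrow> 0"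
    using N(2) by (simp add: less_imp_neq[symmetric])
  from tendsto_add[OF this tendsto_const[of 1]]
  show "(\<lambda>i. ?g i / (2 * G0)) \<longlonglongrightarrow> 1" by simp
qed

text \<open>The majorant must not depend on \<open>N\<close> and must control
  \<open>1 / \<sigma>\<close> near \<open>\<sigma> = 0\<close>. There the excess \<open>w\<close> is
  large as well, so \<open>1 / \<sigma>\<close> is at most a constant times
  \<open>1 + q / N\<close>, and one of the \<open>N\<close> factors in the denominator pays for it.
  A single binomial term of degree 4 of the remaining power gives decay of order 4 in
  \<open>q\<close>, enough for decay of order 2 in each of \<open>x\<close> and \<open>y\<close>.
  The condition \<open>N \<ge> 5\<close> ensures that the exponent \<open>N - 1\<close> reaches that
  degree.\<close>

lemma phase_scaled_bound:
  assumes N: "N \<ge> 5" and x: "x \<ge> 0" and s: "1 + y / sqrt (real N) > 0"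
  shows "1 / ((1 + y / sqrt N) * (phase \<theta> (\<tau> + x / N) (1 + y / sqrt N) / (2 * G0)) ^ N) \<le>
    3 * (2 + 2 * G0) * (3 + 512 * G0\<^sup>2) * (inverse (1 + (\<alpha> / 8 * x)\<^sup>2) * inverse (1 + y\<^sup>2))"
proof -
  define \<sigma> where "\<sigma> = 1 + y / sqrt N"
  let ?g = "phase \<theta> (\<tau> + x / N) \<sigma> / (2 * G0)"
  define w where "w = y\<^sup>2 / \<sigma>"
  define q where "q = \<alpha> * x + w / (2 * G0)"
  have N0: "real N > 0" using N by simp
  have \<sigma>: "\<sigma> > 0" using s by (simp add: \<sigma>_def)
  have w0: "w \<ge> 0" using \<sigma> by (simp add: w_def)
  have q0: "q \<ge> 0" using w0 x alpha_pos G0_pos by (simp add: q_def)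
  have ws: "(\<sigma> - 1)\<^sup>2 / \<sigma> = w / N" by (simp add: w_def \<sigma>_def power_divide)
  have "\<bar>y\<bar> / sqrt N \<le> \<bar>y\<bar> / 1"
    using N by (intro divide_left_mono) auto
  then have \<sigma>_le: "\<sigma> \<le> 1 + \<bar>y\<bar>"
    unfolding \<sigma>_def using divide_right_mono[OF abs_ge_self[of y], of "sqrt N"] by simp
  \<comment> \<open>As \<open>\<sigma>\<close> is at most \<open>1 + \<bar>y\<bar>\<close>, the
    excess \<open>w\<close> grows at least linearly in \<open>\<bar>y\<bar>\<close>; decay in
    \<open>w\<close> is thus decay in \<open>y\<close>.\<close>
  have "(\<bar>y\<bar> - 1) * (1 + \<bar>y\<bar>) \<le> y\<^sup>2"
    by (simp add: algebra_simps power2_eq_square)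
  then have "\<bar>y\<bar> - 1 \<le> y\<^sup>2 / (1 + \<bar>y\<bar>)"
    by (subst pos_le_divide_eq) auto
  also have "\<dots> \<le> w"
    unfolding w_def using \<sigma>_le \<sigma> by (intro divide_left_mono) auto
  finally have wy: "\<bar>y\<bar> \<le> 1 + w" by simp
  \<comment> \<open>The identity
    \<open>\<sigma> + 1 / \<sigma> = 2 + (\<sigma> - 1)^2 / \<sigma>\<close> bounds the singular
    factor by the excess itself.\<close>
  have inv: "1 / \<sigma> \<le> 2 + w / N"
  proof -
    have "\<sigma> + 1 / \<sigma> = 2 + (\<sigma> - 1)\<^sup>2 / \<sigma>"
      using \<sigma> by (simp add: field_simps power2_eq_square)
    then show ?thesis using \<sigma> unfolding ws by linarith
  qed
  have C: "2 + w / N \<le> (2 + 2 * G0) * (1 + q / N)"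
  proof -
    have "(2 + 2 * G0) * (w / (2 * G0) / N) = w / (G0 * N) + w / N"
      using G0_pos N0 by (simp add: field_simps)
    then have "2 + w / N \<le> 2 + 2 * G0 + (2 + 2 * G0) * (w / (2 * G0) / N)"
      using G0_pos w0 N0 by simp
    also have "\<dots> \<le> (2 + 2 * G0) * (1 + q / N)"
      using G0_pos x alpha_pos by (simp add: q_def add_divide_distrib distrib_left)
    finally show ?thesis .
  qed
  have "\<tau> \<le> \<tau> + x / N" using x by simp
  from phase_ge[OF this \<sigma>] have g: "1 + q / N \<le> ?g"
    unfolding ws by (simp add: q_def add_divide_distrib mult.commute)
  have qN: "1 + q / N > 0" using q0 by (simp add: add_pos_nonneg)
  obtain k where k: "N = Suc k" using N by (cases N) auto
  \<comment> \<open>The terms of degree 0 and 4 of the binomial sum are kept.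
    \<open>k choose 4\<close> is at least \<open>(k / 4) ^ 4\<close>, and
    \<open>k / N \<ge> 1 / 2\<close> yields the 8.\<close>
  have pw: "1 + (q / 8) ^ 4 \<le> (1 + q / N) ^ k"
  proof -
    have "(q / 8) ^ 4 \<le> (real k / 4 * (q / N)) ^ 4"
    proof (rule power_mono)
      have "1 / 8 \<le> real k / (4 * real N)" using N k by (simp add: field_simps)
      from mult_right_mono[OF this q0] show "q / 8 \<le> real k / 4 * (q / N)" by simp
    qed (use q0 in simp)
    also have "\<dots> = (real k / 4) ^ 4 * (q / N) ^ 4" by (rule power_mult_distrib)
    also have "\<dots> \<le> real (k choose 4) * (q / N) ^ 4"
      using binomial_ge_n_over_k_pow_k[of 4 k, where ?'a = real] N k by (intro mult_right_mono) auto
    finally have "1 + (q / 8) ^ 4 \<le> (\<Sum>i\<in>{0, 4}. real (k choose i) * (q / N) ^ i)" by simp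
    also have "\<dots> \<le> (\<Sum>i\<le>k. real (k choose i) * (q / N) ^ i)"
      using N k q0 by (intro sum_mono2) auto
    also have "\<dots> = (1 + q / N) ^ k"
      using binomial_ring[of "q / N" 1 k] by (simp add: add.commute)
    finally show ?thesis .
  qed
  define X where "X = \<alpha> / 8 * x"
  define Y where "Y = w / (16 * G0)"
  have XY: "X \<ge> 0" "Y \<ge> 0" "q / 8 = X + Y" using x alpha_pos G0_pos w0 by (simp_all add: X_def Y_def q_def)
  \<comment> \<open>With \<open>P = (X + Y)^2\<close> the left side is at most
    \<open>1 + P + P^2\<close>, and \<open>2 * P \<le> 1 + P^2\<close>.\<close>
  have prod: "(1 + X\<^sup>2) * (1 + Y\<^sup>2) \<le> 3 * (1 + (q / 8) ^ 4)"
  proof -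
    define P where "P = (X + Y)\<^sup>2"
    have 1: "X\<^sup>2 + Y\<^sup>2 \<le> P" using XY by (simp add: P_def power2_sum)
    have "X * Y \<le> P" using XY by (simp add: P_def power2_sum)
    then have "(X * Y)\<^sup>2 \<le> P\<^sup>2" using XY by (intro power_mono) auto
    moreover have "2 * P \<le> 1 + P\<^sup>2" using sum_squares_bound[of P 1] by simp
    moreover have "P\<^sup>2 = (q / 8) ^ 4" by (simp add: P_def XY(3) power_mult[symmetric])
    moreover have "(1 + X\<^sup>2) * (1 + Y\<^sup>2) = 1 + (X\<^sup>2 + Y\<^sup>2) + (X * Y)\<^sup>2" by (simp add: power_mult_distrib algebra_simps)
    ultimately show ?thesis using 1 zero_le_power2[of P] unfolding distrib_left by linarith
  qed
  \<comment> \<open>Since \<open>w = 16 * G0 * Y\<close>, the term \<open>2 * w^2\<close> becomes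
    \<open>512 * G0^2 * Y^2\<close>.\<close>
  have y: "1 + y\<^sup>2 \<le> (3 + 512 * G0\<^sup>2) * (1 + Y\<^sup>2)"
  proof -
    have "y\<^sup>2 \<le> (1 + w)\<^sup>2" using wy w0 abs_le_square_iff[of y "1 + w"] by simp
    also have "\<dots> \<le> 2 + 2 * w\<^sup>2" using sum_squares_bound[of w 1] by (simp add: power2_sum)
    finally have "1 + y\<^sup>2 \<le> 3 + 2 * w\<^sup>2" by simp
    also have "2 * w\<^sup>2 = 512 * G0\<^sup>2 * Y\<^sup>2" using G0_pos by (simp add: Y_def power_divide power_mult_distrib)
    also have "3 + 512 * G0\<^sup>2 * Y\<^sup>2 \<le> (3 + 512 * G0\<^sup>2) * (1 + Y\<^sup>2)"
      by (simp add: algebra_simps)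
    finally show ?thesis .
  qed
  have X1: "1 + X\<^sup>2 > 0" and Y1: "1 + Y\<^sup>2 > 0" and y1: "1 + y\<^sup>2 > 0" by (simp_all add: add_pos_nonneg)
  have "1 / (\<sigma> * ?g ^ N) = 1 / \<sigma> * (1 / ?g ^ N)"
    by simp
  also have "\<dots> \<le> ((2 + 2 * G0) * (1 + q / N)) * (1 / (1 + q / N) ^ N)"
  proof (rule mult_mono)
    show "1 / \<sigma> \<le> (2 + 2 * G0) * (1 + q / N)" using inv C by linarith
    show "1 / ?g ^ N \<le> 1 / (1 + q / N) ^ N"
      using g qN by (intro divide_left_mono power_mono mult_pos_pos zero_less_power) auto
    have "?g \<ge> 0" using g qN by linarith
    then show "0 \<le> 1 / ?g ^ N" by simp
    show "0 \<le> (2 + 2 * G0) * (1 + q / N)" using G0_pos qN by simp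
  qed
  also have "\<dots> = (2 + 2 * G0) / (1 + q / N) ^ k"
    using qN unfolding k by (simp del: of_nat_Suc)
  also have "\<dots> \<le> (2 + 2 * G0) / (1 + (q / 8) ^ 4)"
    using pw G0_pos qN by (intro divide_left_mono mult_pos_pos zero_less_power) (auto intro: add_pos_nonneg)
  also have "\<dots> = 3 * (2 + 2 * G0) / (3 * (1 + (q / 8) ^ 4))"
    by (rule mult_divide_mult_cancel_left[symmetric]) simp
  also have "\<dots> \<le> 3 * (2 + 2 * G0) / ((1 + X\<^sup>2) * (1 + Y\<^sup>2))"
    using prod G0_pos X1 Y1 by (intro divide_left_mono mult_pos_pos) (auto intro: add_pos_nonneg)
  also have "\<dots> = 3 * (2 + 2 * G0) * (inverse (1 + X\<^sup>2) * (1 / (1 + Y\<^sup>2)))" by (simp add: divide_simps)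
  also have "\<dots> \<le> 3 * (2 + 2 * G0) * (inverse (1 + X\<^sup>2) * ((3 + 512 * G0\<^sup>2) * inverse (1 + y\<^sup>2)))"
  proof (intro mult_left_mono)
    show "1 / (1 + Y\<^sup>2) \<le> (3 + 512 * G0\<^sup>2) * inverse (1 + y\<^sup>2)"
      using y y1 Y1 by (simp add: divide_simps)
  qed (use G0_pos X1 in auto)
  finally show ?thesis
    unfolding \<sigma>_def X_def by (simp only: mult_ac)
qed

text \<open>The factor \<open>N * sqrt N\<close> undoes the Jacobians of the scalings in
  \<open>t\<close> and \<open>s\<close>, and \<open>(2 * G0) ^ N\<close> normalises the minimum of
  \<open>phase\<close> to 1. The limit integrand \<open>v\<close> is a product, so its integral is
  that of an exponential on a half-line times a full Gaussian integral.\<close>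

lemma phase_laplace:
  "(\<lambda>m. ennreal ((2 * G0) ^ Suc (Suc m) * (real (Suc (Suc m)) * sqrt (real (Suc (Suc m))))) *
     (\<integral>\<^sup>+t. \<integral>\<^sup>+s. ennreal (1 / (s * phase \<theta> t s ^ Suc (Suc m))) * indicator {0<..} s * indicator {\<tau>..} t
       \<partial>lborel \<partial>lborel))
   \<longlonglongrightarrow> ennreal (1 / \<alpha> * sqrt (pi / \<beta>))"
proof -
  let ?I = "\<lambda>N. (\<integral>\<^sup>+t. \<integral>\<^sup>+s. ennreal (1 / (s * phase \<theta> t s ^ N)) * indicator {0<..} s * indicator
    {\<tau>..} t \<partial>lborel \<partial>lborel)"
  let ?L2 = "lborel \<Otimes>\<^sub>M lborel :: (real \<times> real) measure"
  define u where "u N = (\<lambda>(x, y). ennreal (1 / ((1 + y / sqrt (real N)) * (phase \<theta> (\<tau> + x / real N) (1 + y / sqrt (real N)) / (2 * G0)) ^ N)) *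
    indicator {0<..} (1 + y / sqrt (real N)) * indicator {0..} x)" for N
  define v where "v = (\<lambda>(x, y). ennreal (exp (- (\<alpha> * x))) * indicator {0..} x * ennreal (exp (- (\<beta> * y\<^sup>2))))"
  define w where "w = (\<lambda>(x, y). ennreal (3 * (2 + 2 * G0) * (3 + 512 * G0\<^sup>2)) * (ennreal (inverse (1 + (\<alpha> / 8 * x)\<^sup>2)) *
    ennreal (inverse (1 + y\<^sup>2))))"
  have [measurable]: "u N \<in> borel_measurable ?L2" "v \<in> borel_measurable ?L2" "w \<in> borel_measurable ?L2" for N
    unfolding u_def v_def w_def by measurable
  have scale: "ennreal ((2 * G0) ^ N * (real N * sqrt (real N))) * ?I N = (\<integral>\<^sup>+z. u N z \<partial>?L2)" if N: "N > 0" for N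
  proof -
    let ?f = "\<lambda>t s. ennreal (1 / (s * phase \<theta> t s ^ N)) * indicator {0<..} s * indicator {\<tau>..} t"
    have N0: "real N > 0" using N by simp
    have "?I N = ennreal \<bar>1 / real N\<bar> * (\<integral>\<^sup>+x. \<integral>\<^sup>+s. ?f (\<tau> + 1 / real N * x) s \<partial>lborel \<partial>lborel)"
      using N by (intro nn_integral_real_affine) auto
    also have "\<dots> = ennreal \<bar>1 / real N\<bar> * (\<integral>\<^sup>+x. ennreal \<bar>1 / sqrt (real N)\<bar> * (\<integral>\<^sup>+y. ?f
      (\<tau> + 1 / real N * x) (1 + 1 / sqrt (real N) * y) \<partial>lborel) \<partial>lborel)"
      using N by (intro arg_cong[where f = "\<lambda>x. _ * x"] nn_integral_cong nn_integral_real_affine) auto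
    finally have I: "?I N = ennreal (1 / real N) * (\<integral>\<^sup>+x. ennreal (1 / sqrt (real N)) * (\<integral>\<^sup>+y. ?f (\<tau> + x / real
      N) (1 + y / sqrt (real N)) \<partial>lborel) \<partial>lborel)"
      by simp
    have "ennreal ((2 * G0) ^ N * (real N * sqrt (real N))) * ?I N =
        (\<integral>\<^sup>+x. \<integral>\<^sup>+y. ennreal ((2 * G0) ^ N * (real N * sqrt (real N))) * (ennreal (1 / real N) * (ennreal (1 / sqrt
          (real N)) * ?f (\<tau> + x / real N) (1 + y / sqrt (real N)))) \<partial>lborel \<partial>lborel)"
      unfolding I by (simp add: nn_integral_cmult)
    also have "\<dots> = (\<integral>\<^sup>+x. \<integral>\<^sup>+y. u N (x, y) \<partial>lborel \<partial>lborel)"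
    proof (rule nn_integral_cong, rule nn_integral_cong)
      fix x y :: real
      define s where "s = 1 + y / sqrt (real N)"
      define t where "t = \<tau> + x / real N"
      have "indicator {\<tau>..} t = (indicator {0..} x :: ennreal)"
        using N0 by (simp add: t_def indicator_def zero_le_divide_iff)
      moreover have "ennreal ((2 * G0) ^ N * (real N * sqrt (real N))) * (ennreal (1 / real N) * (ennreal (1 / sqrt (real N)) * ennreal (1 / (s * phase \<theta> t s ^ N)))) =
          ennreal (1 / (s * (phase \<theta> t s / (2 * G0)) ^ N))" if "s > 0"
      proof -
        have "(2 * G0) ^ N * (real N * sqrt (real N)) * (1 / real N * (1 / sqrt (real N) * (1 / (s * phase \<theta> t s ^ N)))) = 1 / (s * (phase \<theta> t s / (2 * G0)) ^ N)"
          using N0 G0_pos by (simp add: power_divide)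
        then show ?thesis
          using that N0 G0_pos phase_pos[OF that, of \<theta> t] by (simp add: ennreal_mult[symmetric] del: of_nat_0_less_iff)
      qed
      ultimately show "ennreal ((2 * G0) ^ N * (real N * sqrt (real N))) * (ennreal (1 / real N) * (ennreal (1 / sqrt (real N)) * ?f (\<tau> + x /
        real N) (1 + y / sqrt (real N)))) = u N (x, y)"
        unfolding u_def s_def[symmetric] t_def[symmetric] prod.case
        by (cases "s > 0") (simp_all add: mult.assoc[symmetric])
    qed
    also have "\<dots> = (\<integral>\<^sup>+z. u N z \<partial>?L2)"
      by (rule lborel.nn_integral_fst) measurable
    finally show ?thesis .
  qed
  have "(\<lambda>i. \<integral>\<^sup>+z. u (i + 5) z \<partial>?L2) \<longlonglongrightarrow> (\<integral>\<^sup>+z. v z \<partial>?L2)"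
  proof (rule nn_integral_dominated_convergence)
    show "AE z in ?L2. u (i + 5) z \<le> w z" for i
    proof (rule AE_I2)
      fix z :: "real \<times> real"
      obtain x y where z: "z = (x, y)" by (cases z)
      show "u (i + 5) z \<le> w z"
      proof (cases "x \<ge> 0 \<and> 1 + y / sqrt (real (i + 5)) > 0")
        case True
        have e: "w z = ennreal (3 * (2 + 2 * G0) * (3 + 512 * G0\<^sup>2) * (inverse (1 + (\<alpha> / 8 * x)\<^sup>2) * inverse (1 + y\<^sup>2)))"
          using G0_pos unfolding w_def z prod.case by (subst ennreal_mult[symmetric], simp, simp, subst ennreal_mult[symmetric]) auto
        have "5 \<le> i + 5" by simp
        from phase_scaled_bound[OF this, of x y] True show ?thesis
          unfolding e by (simp add: u_def z ennreal_leI del: of_nat_add)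
      next
        case False
        then show ?thesis by (auto simp: u_def z indicator_def)
      qed
    qed
    show "(\<integral>\<^sup>+z. w z \<partial>?L2) < \<infinity>"
    proof -
      have A: "(\<integral>\<^sup>+x. ennreal (inverse (1 + (\<alpha> / 8 * x)\<^sup>2)) \<partial>lborel) < \<infinity>"
      proof -
        have "(\<integral>\<^sup>+x. ennreal (inverse (1 + x\<^sup>2)) \<partial>lborel) = ennreal \<bar>\<alpha> / 8\<bar> * (\<integral>\<^sup>+x.
          ennreal (inverse (1 + (0 + \<alpha> / 8 * x)\<^sup>2)) \<partial>lborel)"
          using alpha_pos by (intro nn_integral_real_affine) auto
        then have "ennreal \<bar>\<alpha> / 8\<bar> * (\<integral>\<^sup>+x. ennreal (inverse (1 + (\<alpha> / 8 * x)\<^sup>2)) \<partial>lborel) < \<infinity>"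
          using nn_integral_inverse_one_plus_square by simp
        then show ?thesis
          using alpha_pos by (auto simp: ennreal_mult_less_top)
      qed
      have "(\<integral>\<^sup>+z. w z \<partial>?L2) = (\<integral>\<^sup>+x. \<integral>\<^sup>+y. w (x, y) \<partial>lborel \<partial>lborel)"
        by (rule lborel.nn_integral_fst[symmetric]) measurable
      also have "\<dots> = ennreal (3 * (2 + 2 * G0) * (3 + 512 * G0\<^sup>2)) * ((\<integral>\<^sup>+x. ennreal (inverse (1 + (\<alpha> / 8 *
        x)\<^sup>2)) \<partial>lborel) * (\<integral>\<^sup>+y. ennreal (inverse (1 + y\<^sup>2)) \<partial>lborel))"
        unfolding w_def prod.case by (simp add: nn_integral_cmult nn_integral_multc)
      also have "\<dots> < \<infinity>"
        using A nn_integral_inverse_one_plus_square by (simp add: ennreal_mult_less_top)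
      finally show ?thesis .
    qed
    show "AE z in ?L2. (\<lambda>i. u (i + 5) z) \<longlonglongrightarrow> v z"
    proof (rule AE_I2)
      fix z :: "real \<times> real"
      obtain x y where z: "z = (x, y)" by (cases z)
      show "(\<lambda>i. u (i + 5) z) \<longlonglongrightarrow> v z"
      proof (cases "x \<ge> 0")
        case False
        then show ?thesis by (simp add: u_def v_def z)
      next
        case True
        have "\<forall>\<^sub>F i in sequentially. 1 + y / sqrt (real i) > 0"
          by (rule order_tendstoD(1)[where y = 1]) (real_asymp, simp)
        \<comment> \<open>For negative \<open>y\<close> the point \<open>1 + y / sqrt N\<close> lies
          in the domain only from some index on that depends on \<open>y\<close>; the pointwise
          limit is taken along the sequence shifted by it.\<close>
        then obtain k where k: "\<And>i. i \<ge> k \<Longrightarrow> 1 + y / sqrt (real i) > 0" by (auto simp: eventually_sequentially)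
        let ?N = "\<lambda>i. i + (k + 5)"
        let ?g = "\<lambda>i. phase \<theta> (\<tau> + x / real (?N i)) (1 + y / sqrt (real (?N i))) / (2 * G0)"
        have s: "1 + y / sqrt (real (?N i)) > 0" for i by (rule k) simp
        have Nlim: "filterlim ?N at_top sequentially" by (rule filterlim_add_const_nat_at_top)
        have "(\<lambda>i. (?g i) ^ ?N i) \<longlonglongrightarrow> exp (\<alpha> * x + \<beta> * y\<^sup>2)"
          by (rule phase_scaled_tendsto[OF Nlim _ True s]) simp
        moreover have "(\<lambda>i. 1 + y / sqrt (real (?N i))) \<longlonglongrightarrow> 1" by real_asymp
        ultimately have L: "(\<lambda>i. 1 / ((1 + y / sqrt (real (?N i))) * (?g i) ^ ?N i)) \<longlonglongrightarrow> 1 / (1 * exp (\<alpha> * x + \<beta> * y\<^sup>2))"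
          by (intro tendsto_divide tendsto_const tendsto_mult) auto
        have E: "1 / (1 * exp (\<alpha> * x + \<beta> * y\<^sup>2)) = exp (- (\<alpha> * x)) * exp (- (\<beta> * y\<^sup>2))"
          by (simp add: exp_add exp_minus field_simps)
        have "(\<lambda>i. ennreal (1 / ((1 + y / sqrt (real (?N i))) * (?g i) ^ ?N i))) \<longlonglongrightarrow> ennreal (exp (- (\<alpha> * x)) * exp (- (\<beta> * y\<^sup>2)))"
          unfolding E[symmetric] by (rule tendsto_ennrealI[OF L])
        then have "(\<lambda>i. u (?N i) z) \<longlonglongrightarrow> v z"
          using True s by (simp add: u_def v_def z ennreal_mult del: of_nat_add)
        then have "(\<lambda>i. u ((i + k) + 5) z) \<longlonglongrightarrow> v z" by (simp only: add.assoc)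
        then show ?thesis by (rule LIMSEQ_offset[where f = "\<lambda>i. u (i + 5) z"])
      qed
    qed
  qed measurable
  moreover have "(\<integral>\<^sup>+z. v z \<partial>?L2) = ennreal (1 / \<alpha> * sqrt (pi / \<beta>))"
  proof -
    have "(\<integral>\<^sup>+z. v z \<partial>?L2) = (\<integral>\<^sup>+x. \<integral>\<^sup>+y. v (x, y) \<partial>lborel \<partial>lborel)"
      by (rule lborel.nn_integral_fst[symmetric]) measurable
    also have "\<dots> = (\<integral>\<^sup>+x. ennreal (exp (- (\<alpha> * x))) * indicator {0..} x \<partial>lborel) * (\<integral>\<^sup>+y.
      ennreal (exp (- (\<beta> * y\<^sup>2))) \<partial>lborel)"
      unfolding v_def prod.case by (simp add: nn_integral_cmult nn_integral_multc)
    also have "\<dots> = ennreal (1 / \<alpha> * sqrt (pi / \<beta>))"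
      unfolding nn_integral_exp_minus_half_line[OF alpha_pos] nn_integral_exp_minus_square[OF beta_pos]
      using alpha_pos beta_pos by (subst ennreal_mult) auto
    finally show ?thesis .
  qed
  ultimately have "(\<lambda>i. \<integral>\<^sup>+z. u (i + 5) z \<partial>?L2) \<longlonglongrightarrow> ennreal (1 / \<alpha> * sqrt (pi / \<beta>))"
    by (simp only:)
  moreover have "ennreal ((2 * G0) ^ Suc (Suc (i + 3)) * (real (Suc (Suc (i + 3))) * sqrt (real (Suc (Suc (i + 3)))))) * ?I (Suc (Suc (i + 3))) =
    (\<integral>\<^sup>+z. u (i + 5) z \<partial>?L2)" for i
  proof -
    have "Suc (Suc (i + 3)) = i + 5" by simp
    then show ?thesis using scale[of "i + 5"] by (simp only:)
  qed
  ultimately have "(\<lambda>i. ennreal ((2 * G0) ^ Suc (Suc (i + 3)) * (real (Suc (Suc (i + 3))) * sqrt (real (Suc (Suc (i + 3)))))) * ?I (Suc (Suc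
    (i + 3)))) \<longlonglongrightarrow> ennreal (1 / \<alpha> * sqrt (pi / \<beta>))"
    by (simp only:)
  then show ?thesis
    by (rule LIMSEQ_offset)
qed

end

section \<open>Standardizing a Gaussian vector\<close>

text \<open>Divided by its total mass, a weight becomes a probability density, to which Levy's
  uniqueness theorem applies. The masses on both sides agree by \<open>a = 0\<close>; if they
  vanish, normalising is impossible, but both integrals are 0.\<close>

lemma char_determines_weighted_law:
  fixes \<mu> :: "'a measure" and \<nu> :: "'b measure"
  assumes "finite_measure \<mu>" "finite_measure \<nu>"
    and [measurable]: "X \<in> borel_measurable \<mu>" "g \<in> borel_measurable \<mu>" "Y \<in> borel_measurable \<nu>" "h \<in> borel_measurable \<nu>"
    and g: "\<And>x. 0 \<le> g x" "\<And>x. g x \<le> B" and h: "\<And>x. 0 \<le> h x" "\<And>x. h x \<le> B"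
    and ch: "\<And>a. (\<integral>x. iexp (a * X x) * complex_of_real (g x) \<partial>\<mu>) = (\<integral>y. iexp (a * Y y) * complex_of_real (h y) \<partial>\<nu>)"
    and A [measurable]: "A \<in> sets borel"
  shows "(\<integral>x. indicator A (X x) * g x \<partial>\<mu>) = (\<integral>y. indicator A (Y y) * h y \<partial>\<nu>)"
proof -
  interpret M: finite_measure \<mu> by fact
  interpret N: finite_measure \<nu> by fact
  have ig: "integrable \<mu> g" using g by (intro M.integrable_const_bound[where B = B]) auto
  have ih: "integrable \<nu> h" using h by (intro N.integrable_const_bound[where B = B]) auto
  define c where "c = (\<integral>x. g x \<partial>\<mu>)"
  have ch': "c = (\<integral>x. h x \<partial>\<nu>)"
    using ch[of 0] by (simp add: c_def)
  have c0: "c \<ge> 0" unfolding c_def using g by (intro Bochner_Integration.integral_nonneg) auto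
  show ?thesis
  proof (cases "c = 0")
    case True
    have "AE x in \<mu>. g x = 0" using Bochner_Integration.integral_nonneg_eq_0_iff_AE[OF ig] g True by (simp add: c_def)
    then have "(\<integral>x. indicator A (X x) * g x \<partial>\<mu>) = (\<integral>x. 0 \<partial>\<mu>)"
      by (intro integral_cong_AE) auto
    moreover have "AE x in \<nu>. h x = 0" using Bochner_Integration.integral_nonneg_eq_0_iff_AE[OF ih] h True ch' by simp
    then have "(\<integral>x. indicator A (Y x) * h x \<partial>\<nu>) = (\<integral>x. 0 \<partial>\<nu>)"
      by (intro integral_cong_AE) auto
    ultimately show ?thesis by simp
  next
    case False
    with c0 have c: "c > 0" by simp
    define P where "P = distr (density \<mu> (\<lambda>x. ennreal (g x / c))) borel X"
    define Q where "Q = distr (density \<nu> (\<lambda>x. ennreal (h x / c))) borel Y"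
    have eP: "emeasure P S = ennreal ((\<integral>x. indicator S (X x) * g x \<partial>\<mu>) / c)" if [measurable]: "S \<in> sets borel" for S
    proof -
      have "emeasure P S = (\<integral>\<^sup>+x. ennreal (g x / c) * indicator (X -` S \<inter> space \<mu>) x \<partial>\<mu>)"
        unfolding P_def by (subst emeasure_distr) (auto simp: emeasure_density)
      also have "\<dots> = (\<integral>\<^sup>+x. ennreal (indicator S (X x) * g x / c) \<partial>\<mu>)"
        by (intro nn_integral_cong) (auto simp: indicator_def)
      also have "\<dots> = ennreal (\<integral>x. indicator S (X x) * g x / c \<partial>\<mu>)"
        using g c order_trans[OF g] by (intro nn_integral_eq_integral integrable_divide M.integrable_const_bound[where B = B]) (auto simp: indicator_def)
      finally show ?thesis by simp
    qed
    have eQ: "emeasure Q S = ennreal ((\<integral>x. indicator S (Y x) * h x \<partial>\<nu>) / c)" if [measurable]: "S \<in> sets borel" for S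
    proof -
      have "emeasure Q S = (\<integral>\<^sup>+x. ennreal (h x / c) * indicator (Y -` S \<inter> space \<nu>) x \<partial>\<nu>)"
        unfolding Q_def by (subst emeasure_distr) (auto simp: emeasure_density)
      also have "\<dots> = (\<integral>\<^sup>+x. ennreal (indicator S (Y x) * h x / c) \<partial>\<nu>)"
        by (intro nn_integral_cong) (auto simp: indicator_def)
      also have "\<dots> = ennreal (\<integral>x. indicator S (Y x) * h x / c \<partial>\<nu>)"
        using h c order_trans[OF h] by (intro nn_integral_eq_integral integrable_divide N.integrable_const_bound[where B = B]) (auto simp: indicator_def)
      finally show ?thesis by simp
    qed
    have "real_distribution P"
      using c eP[of UNIV] by (intro real_distribution.intro real_distribution_axioms.intro prob_spaceI) (auto simp: P_def c_def)
    moreover have "real_distribution Q"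
      using c eQ[of UNIV] by (intro real_distribution.intro real_distribution_axioms.intro prob_spaceI) (auto simp: Q_def ch')
    moreover have "char P = char Q"
    proof
      fix t
      have "char P t = (\<integral>x. (g x / c) *\<^sub>R iexp (t * X x) \<partial>\<mu>)"
        unfolding char_def P_def using g c
        by (subst integral_distr, simp, simp, subst integral_density) auto
      also have "\<dots> = (\<integral>x. iexp (t * X x) * complex_of_real (g x) / complex_of_real c \<partial>\<mu>)"
        by (simp add: scaleR_conv_of_real mult.commute)
      also have "\<dots> = (\<integral>x. iexp (t * X x) * complex_of_real (g x) \<partial>\<mu>) / complex_of_real c" by simp
      also have "\<dots> = (\<integral>x. iexp (t * Y x) * complex_of_real (h x) / complex_of_real c \<partial>\<nu>)" unfolding ch by simp
      also have "\<dots> = (\<integral>x. (h x / c) *\<^sub>R iexp (t * Y x) \<partial>\<nu>)"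
        by (simp add: scaleR_conv_of_real mult.commute)
      also have "\<dots> = char Q t"
        unfolding char_def Q_def using h c
        by (subst integral_distr, simp, simp, subst integral_density) auto
      finally show "char P t = char Q t" .
    qed
    ultimately have "P = Q" by (rule Levy_uniqueness)
    then have "ennreal ((\<integral>x. indicator A (X x) * g x \<partial>\<mu>) / c) = ennreal ((\<integral>x. indicator A (Y x) * h x \<partial>\<nu>) / c)"
      using eP[OF A] eQ[OF A] by simp
    moreover have "(\<integral>x. indicator A (X x) * g x \<partial>\<mu>) / c \<ge> 0" "(\<integral>x. indicator A (Y x) * h x \<partial>\<nu>) / c \<ge> 0"
      using g h c by (auto intro!: divide_nonneg_pos Bochner_Integration.integral_nonneg)
    ultimately show ?thesis using c by simp
  qed
qed

text \<open>The one-dimensional uniqueness theorem is applied twice: to \<open>U\<close> under the positive weights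
  \<open>1 + cos (b V)\<close> and \<open>1 + sin (b V)\<close>, and then to \<open>V\<close> under the weights \<open>indicator A U\<close>.\<close>

lemma joint_law_from_char:
  assumes "prob_space M" and [measurable]: "U \<in> borel_measurable M" "V \<in> borel_measurable M"
    and "real_distribution N1" "real_distribution N2"
    and joint: "\<And>a b. (\<integral>\<omega>. iexp (a * U \<omega> + b * V \<omega>) \<partial>M) = char N1 a * char N2 b"
  shows "distr M (borel \<Otimes>\<^sub>M borel) (\<lambda>\<omega>. (U \<omega>, V \<omega>)) = N1 \<Otimes>\<^sub>M N2"
proof -
  interpret M: prob_space M by fact
  interpret N1: real_distribution N1 by fact
  interpret N2: real_distribution N2 by fact
  have iJ: "integrable M (\<lambda>\<omega>. iexp (a * U \<omega> + b * V \<omega>))" for a b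
    by (intro M.integrable_const_bound[where B = 1]) auto
  have split: "iexp (p + q) = iexp p * iexp q" for p q
    by (simp add: exp_add distrib_left)
  have cosb: "\<bar>Re (char N2 b)\<bar> \<le> 1" "\<bar>Im (char N2 b)\<bar> \<le> 1" for b
    using N2.cmod_char_le_1[of b] abs_Re_le_cmod[of "char N2 b"] abs_Im_le_cmod[of "char N2 b"] by linarith+
  have conj: "char N2 (- b) = cnj (char N2 b)" for b
  proof -
    have "char N2 (- b) = (\<integral>x. cnj (iexp (b * x)) \<partial>N2)" by (simp add: char_def exp_cnj)
    also have "\<dots> = cnj (char N2 b)" unfolding char_def by (rule Bochner_Integration.integral_cnj)
    finally show ?thesis .
  qed
  have I1: "(\<integral>\<omega>. indicator A (U \<omega>) * (1::real) \<partial>M) = (\<integral>x. indicator A x * 1 \<partial>N1)" if "A \<in> sets borel" for A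
  proof (rule char_determines_weighted_law[where B = 1])
    fix a show "(\<integral>x. iexp (a * U x) * complex_of_real 1 \<partial>M) = (\<integral>y. iexp (a * y) * complex_of_real 1 \<partial>N1)"
      using joint[of a 0] unfolding N2.char_zero by (simp add: char_def)
  qed (use that in \<open>auto intro: M.finite_measure_axioms N1.finite_measure_axioms\<close>)
  \<comment> \<open>Averaging the joint characteristic function at \<open>b\<close> and
    \<open>- b\<close> produces the cosine, and its value at 0 in the second argument produces the
    summand 1.\<close>
  have Ic: "(\<integral>\<omega>. indicator A (U \<omega>) * (1 + cos (b * V \<omega>)) \<partial>M) = (\<integral>x. indicator A x * (1 + Re (char N2 b)) \<partial>N1)"
    if "A \<in> sets borel" for A b
  proof (rule char_determines_weighted_law[where B = 2])
    fix a
    have "(\<integral>\<omega>. iexp (a * U \<omega>) * complex_of_real (1 + cos (b * V \<omega>)) \<partial>M) =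
        (\<integral>\<omega>. iexp (a * U \<omega> + 0 * V \<omega>) + (iexp (a * U \<omega> + b * V \<omega>) + iexp (a * U \<omega> + (- b) * V \<omega>)) / 2 \<partial>M)"
    proof (intro Bochner_Integration.integral_cong refl)
      fix \<omega>
      have "complex_of_real (cos (b * V \<omega>)) = (iexp (b * V \<omega>) + iexp (- (b * V \<omega>))) / 2"
        unfolding cos_of_real[symmetric] cos_exp_eq by simp
      then have "iexp (a * U \<omega>) * complex_of_real (1 + cos (b * V \<omega>)) =
          iexp (a * U \<omega>) + (iexp (a * U \<omega>) * iexp (b * V \<omega>) + iexp (a * U \<omega>) * iexp (- (b * V \<omega>))) / 2"
        by (simp only: of_real_add of_real_1) (simp only: distrib_left times_divide_eq_right mult_1_right)
      then show "iexp (a * U \<omega>) * complex_of_real (1 + cos (b * V \<omega>)) =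
          iexp (a * U \<omega> + 0 * V \<omega>) + (iexp (a * U \<omega> + b * V \<omega>) + iexp (a * U \<omega> + (- b) * V \<omega>)) / 2"
        by (simp only: split mult_minus_left mult_zero_left add_0_right)
    qed
    also have "\<dots> = char N1 a * char N2 0 + (char N1 a * char N2 b + char N1 a * char N2 (- b)) / 2"
      by (simp only: Bochner_Integration.integral_add[OF iJ integrable_divide[OF Bochner_Integration.integrable_add[OF iJ iJ]]]
          integral_divide_zero Bochner_Integration.integral_add[OF iJ iJ] joint)
    also have "\<dots> = char N1 a * complex_of_real (1 + Re (char N2 b))"
      unfolding conj by (simp add: N2.char_zero complex_eq_iff algebra_simps)
    also have "\<dots> = (\<integral>y. iexp (a * y) * complex_of_real (1 + Re (char N2 b)) \<partial>N1)"
      by (simp add: char_def)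
    finally show "(\<integral>\<omega>. iexp (a * U \<omega>) * complex_of_real (1 + cos (b * V \<omega>)) \<partial>M) =
        (\<integral>y. iexp (a * y) * complex_of_real (1 + Re (char N2 b)) \<partial>N1)" .
  next
    fix \<omega> show "0 \<le> 1 + cos (b * V \<omega>)" "1 + cos (b * V \<omega>) \<le> 2"
      using cos_ge_minus_one[of "b * V \<omega>"] cos_le_one[of "b * V \<omega>"] by linarith+
  qed (use that cosb[of b] in \<open>auto intro: M.finite_measure_axioms N1.finite_measure_axioms\<close>)
  have Is: "(\<integral>\<omega>. indicator A (U \<omega>) * (1 + sin (b * V \<omega>)) \<partial>M) = (\<integral>x. indicator A x * (1 + Im (char N2 b)) \<partial>N1)"
    if "A \<in> sets borel" for A b
  proof (rule char_determines_weighted_law[where B = 2])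
    fix a
    have "(\<integral>\<omega>. iexp (a * U \<omega>) * complex_of_real (1 + sin (b * V \<omega>)) \<partial>M) =
        (\<integral>\<omega>. iexp (a * U \<omega> + 0 * V \<omega>) + (iexp (a * U \<omega> + b * V \<omega>) - iexp (a * U \<omega> + (- b) * V
          \<omega>)) / (2 * \<i>) \<partial>M)"
    proof (intro Bochner_Integration.integral_cong refl)
      fix \<omega>
      have "complex_of_real (sin (b * V \<omega>)) = (iexp (b * V \<omega>) - iexp (- (b * V \<omega>))) / (2 * \<i>)"
        unfolding sin_of_real[symmetric] sin_exp_eq by simp
      then have "iexp (a * U \<omega>) * complex_of_real (1 + sin (b * V \<omega>)) =
          iexp (a * U \<omega>) + (iexp (a * U \<omega>) * iexp (b * V \<omega>) - iexp (a * U \<omega>) * iexp (- (b * V \<omega>))) / (2 * \<i>)"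
        by (simp only: of_real_add of_real_1) (simp only: distrib_left right_diff_distrib times_divide_eq_right mult_1_right)
      then show "iexp (a * U \<omega>) * complex_of_real (1 + sin (b * V \<omega>)) =
          iexp (a * U \<omega> + 0 * V \<omega>) + (iexp (a * U \<omega> + b * V \<omega>) - iexp (a * U \<omega> + (- b) * V \<omega>)) / (2 * \<i>)"
        by (simp only: split mult_minus_left mult_zero_left add_0_right)
    qed
    also have "\<dots> = char N1 a * char N2 0 + (char N1 a * char N2 b - char N1 a * char N2 (- b)) / (2 * \<i>)"
      by (simp only: Bochner_Integration.integral_add[OF iJ integrable_divide[OF Bochner_Integration.integrable_diff[OF iJ iJ]]]
          integral_divide_zero Bochner_Integration.integral_diff[OF iJ iJ] joint)
    also have "\<dots> = char N1 a * complex_of_real (1 + Im (char N2 b))"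
    proof -
      have "(char N2 b - cnj (char N2 b)) / (2 * \<i>) = complex_of_real (Im (char N2 b))"
        by (simp add: complex_eq_iff)
      then have "(char N1 a * char N2 b - char N1 a * cnj (char N2 b)) / (2 * \<i>) = char N1 a * complex_of_real (Im (char N2 b))"
        by (simp only: right_diff_distrib[symmetric] times_divide_eq_right[symmetric])
      then show ?thesis unfolding conj by (simp add: N2.char_zero distrib_left)
    qed
    also have "\<dots> = (\<integral>y. iexp (a * y) * complex_of_real (1 + Im (char N2 b)) \<partial>N1)"
      by (simp add: char_def)
    finally show "(\<integral>\<omega>. iexp (a * U \<omega>) * complex_of_real (1 + sin (b * V \<omega>)) \<partial>M) =
        (\<integral>y. iexp (a * y) * complex_of_real (1 + Im (char N2 b)) \<partial>N1)" .
  next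
    fix \<omega> show "0 \<le> 1 + sin (b * V \<omega>)" "1 + sin (b * V \<omega>) \<le> 2"
      using sin_ge_minus_one[of "b * V \<omega>"] sin_le_one[of "b * V \<omega>"] by linarith+
  qed (use that cosb[of b] in \<open>auto intro: M.finite_measure_axioms N1.finite_measure_axioms\<close>)
  have bounded: "integrable M f" if "f \<in> borel_measurable M" "\<And>x. \<bar>f x\<bar> \<le> 1" for f :: "_ \<Rightarrow> real"
    using that by (intro M.integrable_const_bound[where B = 1]) auto
  have J: "(\<integral>\<omega>. indicator B (V \<omega>) * indicator A (U \<omega>) \<partial>M) = (\<integral>y. indicator B y * measure N1 A \<partial>N2)"
    if [measurable]: "A \<in> sets borel" "B \<in> sets borel" for A B
  proof (rule char_determines_weighted_law[where B = 1])
    fix b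
    have m1: "(\<integral>\<omega>. indicator A (U \<omega>) \<partial>M) = measure N1 A" using I1[of A] by simp
    have e: "(\<integral>x. indicator A x * K \<partial>N1) = measure N1 A * K" for K :: real by simp
    \<comment> \<open>Subtracting the law of \<open>U\<close> removes the summand 1 that had made
      the weight nonnegative.\<close>
    have mc: "(\<integral>\<omega>. indicator A (U \<omega>) * cos (b * V \<omega>) \<partial>M) = measure N1 A * Re (char N2 b)"
    proof -
      have "(\<integral>\<omega>. indicator A (U \<omega>) * (1 + cos (b * V \<omega>)) \<partial>M) = (\<integral>\<omega>. indicator A (U \<omega>)
        \<partial>M) + (\<integral>\<omega>. indicator A (U \<omega>) * cos (b * V \<omega>) \<partial>M)"
        unfolding distrib_left mult_1_right
        by (intro Bochner_Integration.integral_add bounded) (auto simp: indicator_def)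
      then have "measure N1 A * (1 + Re (char N2 b)) = measure N1 A + (\<integral>\<omega>. indicator A (U \<omega>) * cos (b * V \<omega>) \<partial>M)"
        unfolding m1 Ic[OF that(1)] e by simp
      then show ?thesis by (simp add: distrib_left)
    qed
    have ms: "(\<integral>\<omega>. indicator A (U \<omega>) * sin (b * V \<omega>) \<partial>M) = measure N1 A * Im (char N2 b)"
    proof -
      have "(\<integral>\<omega>. indicator A (U \<omega>) * (1 + sin (b * V \<omega>)) \<partial>M) = (\<integral>\<omega>. indicator A (U \<omega>)
        \<partial>M) + (\<integral>\<omega>. indicator A (U \<omega>) * sin (b * V \<omega>) \<partial>M)"
        unfolding distrib_left mult_1_right
        by (intro Bochner_Integration.integral_add bounded) (auto simp: indicator_def)
      then have "measure N1 A * (1 + Im (char N2 b)) = measure N1 A + (\<integral>\<omega>. indicator A (U \<omega>) * sin (b * V \<omega>) \<partial>M)"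
        unfolding m1 Is[OF that(1)] e by simp
      then show ?thesis by (simp add: distrib_left)
    qed
    have "(\<integral>\<omega>. iexp (b * V \<omega>) * complex_of_real (indicator A (U \<omega>)) \<partial>M) =
        (\<integral>\<omega>. complex_of_real (indicator A (U \<omega>) * cos (b * V \<omega>)) + \<i> * complex_of_real (indicator A (U \<omega>) *
          sin (b * V \<omega>)) \<partial>M)"
      by (intro Bochner_Integration.integral_cong refl) (simp add: complex_eq_iff Re_exp Im_exp)
    also have "\<dots> = complex_of_real (measure N1 A * Re (char N2 b)) + \<i> * complex_of_real (measure N1 A * Im (char N2 b))"
      unfolding mc[symmetric] ms[symmetric]
      by (subst Bochner_Integration.integral_add)
        (auto intro!: integrable_mult_right integrable_of_real bounded simp: indicator_def simp del: of_real_mult)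
    also have "\<dots> = char N2 b * complex_of_real (measure N1 A)"
      by (simp add: complex_eq_iff)
    also have "\<dots> = (\<integral>y. iexp (b * y) * complex_of_real (measure N1 A) \<partial>N2)"
      by (simp add: char_def)
    finally show "(\<integral>\<omega>. iexp (b * V \<omega>) * complex_of_real (indicator A (U \<omega>)) \<partial>M) = (\<integral>y. iexp (b * y)
      * complex_of_real (measure N1 A) \<partial>N2)" .
  qed (auto simp: indicator_def intro: M.finite_measure_axioms N2.finite_measure_axioms)
  show ?thesis
  proof (rule pair_measure_eqI[symmetric])
    fix A B assume "A \<in> sets N1" "B \<in> sets N2"
    then have [measurable]: "A \<in> sets borel" "B \<in> sets borel" by simp_all
    have "emeasure (distr M (borel \<Otimes>\<^sub>M borel) (\<lambda>\<omega>. (U \<omega>, V \<omega>))) (A \<times> B) = emeasure M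
      ((\<lambda>\<omega>. (U \<omega>, V \<omega>)) -` (A \<times> B) \<inter> space M)"
      by (rule emeasure_distr) auto
    also have "\<dots> = ennreal (measure M ((\<lambda>\<omega>. (U \<omega>, V \<omega>)) -` (A \<times> B) \<inter> space M))"
      by (rule M.emeasure_eq_measure)
    also have "measure M ((\<lambda>\<omega>. (U \<omega>, V \<omega>)) -` (A \<times> B) \<inter> space M) = (\<integral>\<omega>. indicator
      ((\<lambda>\<omega>. (U \<omega>, V \<omega>)) -` (A \<times> B) \<inter> space M) \<omega> \<partial>M)"
      by simp
    also have "\<dots> = (\<integral>\<omega>. indicator B (V \<omega>) * indicator A (U \<omega>) \<partial>M)"
      by (intro Bochner_Integration.integral_cong refl) (auto simp: indicator_def)
    also have "\<dots> = measure N2 B * measure N1 A" unfolding J[OF \<open>A \<in> sets borel\<close> \<open>B \<in> sets borel\<close>] by simp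
    finally show "emeasure N1 A * emeasure N2 B = emeasure (distr M (borel \<Otimes>\<^sub>M borel) (\<lambda>\<omega>. (U \<omega>, V \<omega>))) (A \<times> B)"
      by (simp add: N1.emeasure_eq_measure N2.emeasure_eq_measure ennreal_mult mult.commute)
  qed (auto intro: N1.sigma_finite_measure_axioms N2.sigma_finite_measure_axioms sets_pair_measure_cong)
qed

section \<open>Gaussian characteristic functions and the standardised pair\<close>

lemma normal_char:
  assumes "prob_space M" and \<sigma>: "\<sigma> > 0" and D: "distributed M lborel Z (normal_density \<mu> \<sigma>)"
  shows "(\<integral>\<omega>. iexp (t * Z \<omega>) \<partial>M) = iexp (t * \<mu>) * exp (- (t * \<sigma>)\<^sup>2 / 2)"
proof -
  interpret prob_space M by fact
  have [measurable]: "Z \<in> borel_measurable M" using D by (auto simp: distributed_def)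
  let ?W = "\<lambda>\<omega>. (Z \<omega> - \<mu>) / \<sigma>"
  have W: "distributed M lborel ?W std_normal_density"
    using D \<sigma> normal_standard_normal_convert[of \<sigma> Z \<mu>] by simp
  have "distr M borel ?W = distr M lborel ?W" by (rule distr_cong) auto
  also have "\<dots> = std_normal_distribution"
    using W by (simp add: distributed_def)
  finally have d: "distr M borel ?W = std_normal_distribution" .
  have "(\<integral>\<omega>. iexp (t * Z \<omega>) \<partial>M) = (\<integral>\<omega>. iexp (t * \<mu>) * iexp (t * \<sigma> * ?W \<omega>) \<partial>M)"
    using \<sigma> by (intro Bochner_Integration.integral_cong refl) (simp add: exp_add[symmetric] field_simps)
  also have "\<dots> = iexp (t * \<mu>) * (\<integral>\<omega>. iexp (t * \<sigma> * ?W \<omega>) \<partial>M)" by simp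
  also have "(\<integral>\<omega>. iexp (t * \<sigma> * ?W \<omega>) \<partial>M) = char (distr M borel ?W) (t * \<sigma>)"
    unfolding char_def by (subst integral_distr) auto
  also have "\<dots> = exp (- (t * \<sigma>)\<^sup>2 / 2)"
    unfolding d char_std_normal_distribution by simp
  finally show ?thesis .
qed

text \<open>A Dirac mass obeys the Gaussian formula with variance 0. Treating both cases at once
  allows linear combinations to be used without asking which of them degenerate.\<close>

lemma gaussian_rv_moments:
  assumes "prob_space M" and Z: "gaussian_rv M Z"
  shows "integrable M Z" and "integrable M (\<lambda>\<omega>. (Z \<omega>)\<^sup>2)"
    and "(\<integral>\<omega>. iexp (Z \<omega>) \<partial>M) = iexp (\<integral>\<omega>. Z \<omega> \<partial>M) * exp (- prob_space.variance M Z / 2)"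
proof -
  interpret prob_space M by fact
  have [measurable]: "Z \<in> borel_measurable M" using Z by (simp add: gaussian_rv_def)
  have "integrable M Z \<and> integrable M (\<lambda>\<omega>. (Z \<omega>)\<^sup>2) \<and>
      (\<integral>\<omega>. iexp (Z \<omega>) \<partial>M) = iexp (\<integral>\<omega>. Z \<omega> \<partial>M) * exp (- variance Z / 2)"
  proof (cases "\<exists>m. distr M borel Z = return borel m")
    case True
    then obtain m where m: "distr M borel Z = return borel m" by blast
    have "AE x in distr M borel Z. x = m" unfolding m by (subst AE_return) auto
    then have ae: "AE \<omega> in M. Z \<omega> = m" by (subst (asm) AE_distr_iff) auto
    have "integrable M Z" by (rule integrable_cong_AE[THEN iffD2, of _ _ "\<lambda>_. m"]) (use ae in auto)
    moreover have "integrable M (\<lambda>\<omega>. (Z \<omega>)\<^sup>2)"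
      by (rule integrable_cong_AE[THEN iffD2, of _ _ "\<lambda>_. m\<^sup>2"]) (use ae in auto)
    moreover have E: "(\<integral>\<omega>. Z \<omega> \<partial>M) = (\<integral>\<omega>. m \<partial>M)"
      by (rule integral_cong_AE) (use ae in auto)
    moreover have "variance Z = (\<integral>\<omega>. 0 \<partial>M)"
      by (rule integral_cong_AE) (use ae E in \<open>auto simp: prob_space\<close>)
    moreover have "(\<integral>\<omega>. iexp (Z \<omega>) \<partial>M) = (\<integral>\<omega>. iexp m \<partial>M)"
      by (rule integral_cong_AE) (use ae in auto)
    ultimately show ?thesis by (simp add: prob_space)
  next
    case False
    then obtain m s where s: "s > 0" and D: "distributed M lborel Z (normal_density m s)"
      using Z by (auto simp: gaussian_rv_def)
    have "integrable M (\<lambda>\<omega>. (Z \<omega> - m) ^ k)" for k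
      using distributed_integrable[OF D, of "\<lambda>x. (x - m) ^ k"] integrable_normal_moment[OF s, of m k] by simp
    from this[of 1] this[of 2] have i: "integrable M (\<lambda>\<omega>. Z \<omega> - m)" "integrable M (\<lambda>\<omega>. (Z \<omega> - m)\<^sup>2)" by simp_all
    have "integrable M (\<lambda>\<omega>. (Z \<omega> - m) + m)" by (intro Bochner_Integration.integrable_add i) auto
    then have iZ: "integrable M Z" by simp
    have "integrable M (\<lambda>\<omega>. (Z \<omega> - m)\<^sup>2 + (2 * m * Z \<omega> - m\<^sup>2))"
      by (intro Bochner_Integration.integrable_add Bochner_Integration.integrable_diff integrable_mult_right i iZ) auto
    then have "integrable M (\<lambda>\<omega>. (Z \<omega>)\<^sup>2)" by (simp add: power2_diff)
    then show ?thesis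
      using iZ normal_char[OF assms(1) s D, of 1] normal_distributed_expectation[OF s D] normal_distributed_variance[OF s D]
      by simp
  qed
  then show "integrable M Z" and "integrable M (\<lambda>\<omega>. (Z \<omega>)\<^sup>2)"
    and "(\<integral>\<omega>. iexp (Z \<omega>) \<partial>M) = iexp (\<integral>\<omega>. Z \<omega> \<partial>M) * exp (- variance Z / 2)" by blast+
qed

lemma char_gauss: "char gauss t = exp (- t\<^sup>2 / 4)"
proof -
  have "distr gauss lborel (\<lambda>x. x) = distr gauss gauss (\<lambda>x. x)" by (rule distr_cong) auto
  then have "distr gauss lborel (\<lambda>x. x) = density lborel (normal_density 0 (1 / sqrt 2))"
    by (simp add: gauss_eq_normal_density)
  then have "distributed gauss lborel (\<lambda>x. x) (normal_density 0 (1 / sqrt 2))"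
    unfolding distributed_def by auto
  from normal_char[OF prob_space_gauss _ this, of t] show ?thesis
    unfolding char_def by (simp add: power_divide)
qed

lemma real_distribution_gauss: "real_distribution gauss"
  by (intro real_distribution.intro real_distribution_axioms.intro prob_space_gauss) simp

text \<open>\<open>V\<close> is the normalised residual of the regression of \<open>Y\<close> on
  \<open>X\<close>. Every combination \<open>a U + b V\<close> is a centred combination of
  \<open>X\<close> and \<open>Y\<close> with variance \<open>(a^2 + b^2) / 2\<close>, so its
  characteristic function factors; independence follows from this product form. The
  \<open>sqrt 2\<close> matches the variance \<open>1 / 2\<close> of \<open>gauss\<close>.\<close>

lemma gaussian_vector2_standardize:
  assumes M: "prob_space M" and G: "gaussian_vector2 M X Y"
    and s1: "\<sigma>1 > 0" "\<sigma>1\<^sup>2 = prob_space.variance M X"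
    and s2: "\<sigma>2 > 0" "\<sigma>2\<^sup>2 = prob_space.variance M Y"
    and cov: "covariance M X Y = \<rho> * \<sigma>1 * \<sigma>2"
    and \<rho>: "\<rho>\<^sup>2 < 1"
    and U: "U = (\<lambda>\<omega>. (X \<omega> - (\<integral>\<omega>. X \<omega> \<partial>M)) / (sqrt 2 * \<sigma>1))"
    and V: "V = (\<lambda>\<omega>. ((Y \<omega> - (\<integral>\<omega>. Y \<omega> \<partial>M)) / (sqrt 2 * \<sigma>2) - \<rho> * U \<omega>) / sqrt (1 - \<rho>\<^sup>2))"
  shows "distr M (borel \<Otimes>\<^sub>M borel) (\<lambda>\<omega>. (U \<omega>, V \<omega>)) = gauss2"
proof (rule joint_law_from_char[OF M _ _ real_distribution_gauss real_distribution_gauss])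
  interpret prob_space M by fact
  define m1 where "m1 = (\<integral>\<omega>. X \<omega> \<partial>M)"
  define m2 where "m2 = (\<integral>\<omega>. Y \<omega> \<partial>M)"
  define s where "s = sqrt (1 - \<rho>\<^sup>2)"
  have s: "s > 0" "s\<^sup>2 = 1 - \<rho>\<^sup>2" using \<rho> by (simp_all add: s_def)
  have lin: "gaussian_rv M (\<lambda>\<omega>. a * X \<omega> + b * Y \<omega>)" for a b using G by (simp add: gaussian_vector2_def)
  have "gaussian_rv M X" "gaussian_rv M Y" "gaussian_rv M (\<lambda>\<omega>. X \<omega> + Y \<omega>)"
    using lin[of 1 0] lin[of 0 1] lin[of 1 1] by simp_all
  note gX = this(1) and gY = this(2) and gXY = this(3)
  have [measurable]: "X \<in> borel_measurable M" "Y \<in> borel_measurable M"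
    using gX gY by (simp_all add: gaussian_rv_def)
  note iX = gaussian_rv_moments(1,2)[OF M gX] and iY = gaussian_rv_moments(1,2)[OF M gY]
  \<comment> \<open>Polarisation: the product \<open>X Y\<close> is integrable because
    \<open>X + Y\<close> is Gaussian too.\<close>
  have "integrable M (\<lambda>\<omega>. ((X \<omega> + Y \<omega>)\<^sup>2 - (X \<omega>)\<^sup>2 - (Y \<omega>)\<^sup>2) / 2)"
    by (intro integrable_divide Bochner_Integration.integrable_diff gaussian_rv_moments(2)[OF M gXY] iX iY)
  then have iXY: "integrable M (\<lambda>\<omega>. X \<omega> * Y \<omega>)" by (simp add: power2_sum)
  have i1: "integrable M (\<lambda>\<omega>. (X \<omega> - m1)\<^sup>2)"
  proof -
    have "integrable M (\<lambda>\<omega>. (X \<omega>)\<^sup>2 - 2 * m1 * X \<omega> + m1\<^sup>2)"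
      by (intro Bochner_Integration.integrable_add Bochner_Integration.integrable_diff integrable_mult_right iX) auto
    then show ?thesis by (simp add: power2_diff algebra_simps)
  qed
  have i2: "integrable M (\<lambda>\<omega>. (Y \<omega> - m2)\<^sup>2)"
  proof -
    have "integrable M (\<lambda>\<omega>. (Y \<omega>)\<^sup>2 - 2 * m2 * Y \<omega> + m2\<^sup>2)"
      by (intro Bochner_Integration.integrable_add Bochner_Integration.integrable_diff integrable_mult_right iY) auto
    then show ?thesis by (simp add: power2_diff algebra_simps)
  qed
  have i3: "integrable M (\<lambda>\<omega>. (X \<omega> - m1) * (Y \<omega> - m2))"
  proof -
    have "integrable M (\<lambda>\<omega>. X \<omega> * Y \<omega> - m1 * Y \<omega> - m2 * X \<omega> + m1 * m2)"
      by (intro Bochner_Integration.integrable_add Bochner_Integration.integrable_diff integrable_mult_right iX iY iXY) auto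
    then show ?thesis by (simp add: algebra_simps)
  qed
  show "U \<in> borel_measurable M" unfolding U by measurable
  then show "V \<in> borel_measurable M" unfolding V by measurable
  fix a b :: real
  \<comment> \<open>\<open>A\<close> and \<open>B\<close> are the coefficients of
    \<open>(X - m1) / \<sigma>1\<close> and \<open>(Y - m2) / \<sigma>2\<close> in
    \<open>a U + b V\<close>.\<close>
  define A where "A = (a - b * \<rho> / s) / sqrt 2"
  define B where "B = b / (s * sqrt 2)"
  let ?Z = "\<lambda>\<omega>. A / \<sigma>1 * X \<omega> + B / \<sigma>2 * Y \<omega>"
  have EZ: "(\<integral>\<omega>. ?Z \<omega> \<partial>M) = A / \<sigma>1 * m1 + B / \<sigma>2 * m2"
    using Bochner_Integration.integral_add[OF integrable_mult_right[OF iX(1), of "A / \<sigma>1"] integrable_mult_right[OF iY(1), of "B / \<sigma>2"]]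
    unfolding m1_def m2_def by simp
  have "variance ?Z = (\<integral>\<omega>. (A / \<sigma>1)\<^sup>2 * (X \<omega> - m1)\<^sup>2 + (2 * (A / \<sigma>1) * (B / \<sigma>2) * ((X
    \<omega> - m1) * (Y \<omega> - m2)) + (B / \<sigma>2)\<^sup>2 * (Y \<omega> - m2)\<^sup>2) \<partial>M)"
    unfolding EZ by (intro Bochner_Integration.integral_cong refl) algebra
  also have "\<dots> = (A / \<sigma>1)\<^sup>2 * \<sigma>1\<^sup>2 + (2 * (A / \<sigma>1) * (B / \<sigma>2) * (\<rho> * \<sigma>1 * \<sigma>2) + (B /
    \<sigma>2)\<^sup>2 * \<sigma>2\<^sup>2)"
    unfolding s1(2) s2(2) cov[symmetric] covariance_def m1_def[symmetric] m2_def[symmetric]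
    by (subst Bochner_Integration.integral_add[OF integrable_mult_right[OF i1]
          Bochner_Integration.integrable_add[OF integrable_mult_right[OF i3] integrable_mult_right[OF i2]]],
        subst Bochner_Integration.integral_add[OF integrable_mult_right[OF i3] integrable_mult_right[OF i2]]) simp
  also have "\<dots> = A\<^sup>2 + 2 * \<rho> * A * B + B\<^sup>2"
    using s1(1) s2(1) by (simp add: power_divide)
  also have "\<dots> = (a\<^sup>2 + b\<^sup>2) / 2"
  proof -
    have "A\<^sup>2 + 2 * \<rho> * A * B + B\<^sup>2 = ((a - \<rho> * (b / s))\<^sup>2 + 2 * \<rho> * (a - \<rho> * (b / s)) * (b / s) + (b / s)\<^sup>2) / 2"
      using s by (simp add: A_def B_def power_divide power_mult_distrib add_divide_distrib mult_ac)
    also have "(a - \<rho> * x)\<^sup>2 + 2 * \<rho> * (a - \<rho> * x) * x + x\<^sup>2 = a\<^sup>2 + (1 - \<rho>\<^sup>2) * x\<^sup>2" for x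
      by algebra
    also have "(1 - \<rho>\<^sup>2) * (b / s)\<^sup>2 = b\<^sup>2" using s(1) by (simp add: s(2)[symmetric] power_divide)
    finally show ?thesis .
  qed
  finally have var: "variance ?Z = (a\<^sup>2 + b\<^sup>2) / 2" .
  have UV: "a * U \<omega> + b * V \<omega> = ?Z \<omega> - (A / \<sigma>1 * m1 + B / \<sigma>2 * m2)" for \<omega>
  proof -
    have "a * U \<omega> + b * V \<omega> = (a - b * \<rho> / s) * U \<omega> + b / s * ((Y \<omega> - m2) / (sqrt 2 * \<sigma>2))"
    proof -
      have "a * u + b * ((y - \<rho> * u) / s) = (a - b * \<rho> / s) * u + b / s * y" for u y
        by (simp add: left_diff_distrib right_diff_distrib diff_divide_distrib)
      then show ?thesis unfolding V m2_def[symmetric] s_def[symmetric] .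
    qed
    also have "(a - b * \<rho> / s) * U \<omega> = A / \<sigma>1 * (X \<omega> - m1)"
      unfolding U m1_def[symmetric] A_def by simp
    also have "b / s * ((Y \<omega> - m2) / (sqrt 2 * \<sigma>2)) = B / \<sigma>2 * (Y \<omega> - m2)"
      unfolding B_def by simp
    finally show ?thesis by (simp only: right_diff_distrib)
  qed
  have "(\<integral>\<omega>. iexp (a * U \<omega> + b * V \<omega>) \<partial>M) = (\<integral>\<omega>. iexp (?Z \<omega>) * iexp (- (A / \<sigma>1
    * m1 + B / \<sigma>2 * m2)) \<partial>M)"
    unfolding UV by (intro Bochner_Integration.integral_cong refl) (simp add: exp_add[symmetric] algebra_simps)
  also have "\<dots> = (\<integral>\<omega>. iexp (?Z \<omega>) \<partial>M) * iexp (- (A / \<sigma>1 * m1 + B / \<sigma>2 * m2))" by simp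
  also have "\<dots> = exp (- ((a\<^sup>2 + b\<^sup>2) / 2) / 2) * (iexp (A / \<sigma>1 * m1 + B / \<sigma>2 * m2) * iexp (- (A / \<sigma>1 * m1 + B / \<sigma>2 * m2)))"
    unfolding gaussian_rv_moments(3)[OF M lin] unfolding var unfolding EZ by (simp only: mult_ac)
  also have "iexp (A / \<sigma>1 * m1 + B / \<sigma>2 * m2) * iexp (- (A / \<sigma>1 * m1 + B / \<sigma>2 * m2)) = 1"
    by (simp only: exp_add[symmetric] distrib_left[symmetric] of_real_add[symmetric]) simp
  also have "exp (- ((a\<^sup>2 + b\<^sup>2) / 2) / 2) = exp (- a\<^sup>2 / 4) * exp (- b\<^sup>2 / 4)"
    by (simp add: exp_add[symmetric] field_simps)
  finally show "(\<integral>\<omega>. iexp (a * U \<omega> + b * V \<omega>) \<partial>M) = char gauss a * char gauss b"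
    by (simp add: char_gauss)
qed

section \<open>The Legendre transform\<close>

text \<open>One exceptional point splits the interval into two on whose interiors the derivative is
  positive. This admits the extreme case \<open>\<rho> = rho0\<close>, in which the derivative of
  \<open>slope\<close> has a zero.\<close>

lemma strict_mono_from_deriv_pos_except:
  fixes f f' :: "real \<Rightarrow> real"
  assumes ab: "a < b"
    and der: "\<And>x. a \<le> x \<Longrightarrow> x \<le> b \<Longrightarrow> (f has_real_derivative f' x) (at x)"
    and pos: "\<And>x. a \<le> x \<Longrightarrow> x \<le> b \<Longrightarrow> x \<noteq> z \<Longrightarrow> f' x > 0"
  shows "f a < f b"
proof -
  have step: "f u < f v" if "a \<le> u" "u < v" "v \<le> b" "z \<notin> {u<..<v}" for u v
  proof (rule DERIV_pos_imp_increasing_open[OF \<open>u < v\<close>])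
    fix x assume x: "u < x" "x < v"
    then have "x \<noteq> z" using that by auto
    then show "\<exists>y. (f has_real_derivative y) (at x) \<and> 0 < y"
      using der[of x] pos[of x] x that by (intro exI[of _ "f' x"]) auto
  next
    show "continuous_on {u..v} f"
    proof (rule continuous_at_imp_continuous_on, rule ballI)
      fix x assume "x \<in> {u..v}"
      then show "isCont f x" using der[of x] that by (intro DERIV_isCont) auto
    qed
  qed
  show ?thesis
  proof (cases "z \<in> {a<..<b}")
    case True
    have "f a < f z" by (rule step) (use True in auto)
    also have "f z < f b" by (rule step) (use True in auto)
    finally show ?thesis .
  qed (use step[of a b] ab in auto)
qed

text \<open>The quartic comes from squaring \<open>9 * rho0^2 - 3 = 2 * sqrt 3\<close>. It is the
  relation under which the numerator of the derivative of \<open>slope\<close> acquires a double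
  root.\<close>

lemma rho0_quartic: "27 * rho0 ^ 4 = 18 * rho0\<^sup>2 + 1" and rho0_ge: "rho0 \<ge> 0.84"
proof -
  have sq: "rho0\<^sup>2 = (3 + 2 * sqrt 3) / 9"
    unfolding rho0_def power_divide by simp
  have "rho0 ^ 4 = (rho0\<^sup>2)\<^sup>2" by simp
  also have "\<dots> = (21 + 12 * sqrt 3) / 81"
    unfolding sq power_divide power2_sum power_mult_distrib by simp
  finally have q4: "rho0 ^ 4 = (21 + 12 * sqrt 3) / 81" .
  show "27 * rho0 ^ 4 = 18 * rho0\<^sup>2 + 1" unfolding sq q4 by (simp add: field_simps)
  have "1.7 \<le> sqrt 3" by (rule real_le_rsqrt) (simp add: power2_eq_square)
  then have "(0.84)\<^sup>2 \<le> rho0\<^sup>2" unfolding sq by (simp add: power2_eq_square)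
  moreover have "rho0 \<ge> 0" by (simp add: rho0_def)
  ultimately show "rho0 \<ge> 0.84" by (rule power2_le_imp_le)
qed

context
  fixes \<rho> :: real
  assumes \<rho>0: "0 \<le> \<rho>" and \<rho>1: "\<rho> < 1" and \<rho>_le: "\<rho> \<le> rho0"
begin

text \<open>This is the derivative of \<open>Lstar \<rho>\<close>, and the critical point equation
  of \<open>hbar \<rho> l\<close> reads \<open>slope r = l\<close>; inverting \<open>slope\<close>
  gives \<open>r0\<close>.\<close>

definition slope :: "real \<Rightarrow> real" where
  "slope r = r / (1 - r\<^sup>2) - \<rho> / (1 - \<rho> * r)"

definition slope' :: "real \<Rightarrow> real" where
  "slope' r = (1 + r\<^sup>2) / (1 - r\<^sup>2)\<^sup>2 - (\<rho> / (1 - \<rho> * r))\<^sup>2"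

lemma one_minus_pos:
  assumes "-1 < r" "r < 1"
  shows "1 - r\<^sup>2 > 0" "1 - \<rho> * r > 0"
proof -
  show "1 - r\<^sup>2 > 0" using assms abs_square_less_1[of r] by (simp add: abs_less_iff)
  have "\<rho> * r \<le> \<rho>" using mult_left_mono[of r 1 \<rho>] \<rho>0 assms by simp
  then show "1 - \<rho> * r > 0" using \<rho>1 by linarith
qed

lemma hbar_deriv:
  assumes "-1 < r" "r < 1"
  shows "(hbar \<rho> l has_real_derivative l - slope r) (at r)"
proof -
  note p = one_minus_pos[OF assms]
  have 1: "((\<lambda>r. ln (1 - \<rho> * r)) has_real_derivative (- \<rho>) / (1 - \<rho> * r)) (at r)"
    using p by (auto intro!: derivative_eq_intros)
  have 2: "((\<lambda>r. ln (1 - r\<^sup>2)) has_real_derivative (- (2 * r)) / (1 - r\<^sup>2)) (at r)"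
    using p by (auto intro!: derivative_eq_intros)
  have "(hbar \<rho> l has_real_derivative l * 1 - (- \<rho>) / (1 - \<rho> * r) + 1 / 2 * ((- (2 * r)) / (1 - r\<^sup>2))) (at r)"
    unfolding hbar_def[abs_def]
    by (intro DERIV_add DERIV_diff DERIV_cmult DERIV_ident 1 2)
  then show ?thesis by (simp add: slope_def diff_diff_eq2)
qed

lemma slope_deriv:
  assumes "-1 < r" "r < 1"
  shows "(slope has_real_derivative slope' r) (at r)"
proof -
  note p = one_minus_pos[OF assms]
  have "(slope has_real_derivative (1 * (1 - r\<^sup>2) - r * (- 2 * r)) / ((1 - r\<^sup>2) * (1 - r\<^sup>2)) - (- (\<rho> * (- \<rho>)) / ((1 -
    \<rho> * r) * (1 - \<rho> * r)))) (at r)"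
    unfolding slope_def[abs_def] using p
    by (auto intro!: derivative_eq_intros simp: power2_eq_square)
  moreover have "(1 * (1 - r\<^sup>2) - r * (- 2 * r)) / ((1 - r\<^sup>2) * (1 - r\<^sup>2)) - (- (\<rho> * (- \<rho>)) / ((1 - \<rho> * r) * (1 - \<rho> * r))) = slope' r"
    by (simp add: slope'_def power_divide power2_eq_square)
  ultimately show ?thesis by simp
qed

text \<open>At the critical value \<open>rho0\<close> the numerator of \<open>slope'\<close> is, up to a positive factor,
  \<open>(3 rho0 r - 1)\<^sup>2 (9 rho0\<^sup>2 - 1 - 6 rho0 r)\<close>, so that \<open>slope'\<close> may vanish at \<open>1 / (3 rho0)\<close> only.\<close>

lemma slope'_pos:
  assumes "-1 < r" "r < 1" and z: "r \<noteq> 1 / (3 * rho0)"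
  shows "slope' r > 0"
proof -
  note p = one_minus_pos[OF assms(1,2)]
  define p0 where "p0 = rho0"
  have p0: "p0 \<ge> 0.84" "27 * p0 ^ 4 = 18 * p0\<^sup>2 + 1" "p0 < 1"
  proof -
    show "p0 \<ge> 0.84" "27 * p0 ^ 4 = 18 * p0\<^sup>2 + 1" using rho0_ge rho0_quartic by (simp_all add: p0_def)
    have "sqrt 3 < 3" by (rule real_less_lsqrt) auto
    then have "sqrt (3 + 2 * sqrt 3) < 3" by (intro real_less_lsqrt) auto
    then show "p0 < 1" by (simp add: p0_def rho0_def)
  qed
  have pr: "1 - p0 * r > 0"
  proof -
    have "p0 * r \<le> p0 * 1" using p0 assms by (intro mult_left_mono) auto
    then show ?thesis using p0(3) unfolding mult_1_right by linarith
  qed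
  have "27 * p0\<^sup>2 * ((1 + r\<^sup>2) * (1 - p0 * r)\<^sup>2 - p0\<^sup>2 * (1 - r\<^sup>2)\<^sup>2) = (3 * p0 * r - 1)\<^sup>2 * (9 * p0\<^sup>2 - 1 - 6 * p0 * r)"
  proof -
    have "27 * p0\<^sup>2 * ((1 + r\<^sup>2) * (1 - p0 * r)\<^sup>2 - p0\<^sup>2 * (1 - r\<^sup>2)\<^sup>2) - (3 * p0 * r - 1)\<^sup>2 * (9 * p0\<^sup>2 - 1 - 6 * p0 * r) =
      18 * p0\<^sup>2 + 1 - 27 * p0 ^ 4" by algebra
    then show ?thesis using p0(2) by simp
  qed
  moreover have "(3 * p0 * r - 1)\<^sup>2 > 0"
    using z p0 by (simp add: p0_def field_simps)
  moreover have "9 * p0\<^sup>2 - 1 - 6 * p0 * r > 0"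
  proof -
    have "6 * p0 * r \<le> 6 * p0 * 1" using p0 assms by (intro mult_left_mono) auto
    \<comment> \<open>The bound 0.84 lies above the positive root \<open>(1 + sqrt 2) / 3\<close> of
      \<open>9 * p^2 - 6 * p - 1\<close>.\<close>
    moreover have "9 * p0\<^sup>2 - 1 - 6 * p0 > 0"
    proof -
      have "0.84 * (9 * 0.84 - 6) \<le> p0 * (9 * p0 - 6)" using p0 by (intro mult_mono) auto
      then show ?thesis by (simp add: power2_eq_square algebra_simps)
    qed
    ultimately show ?thesis by linarith
  qed
  ultimately have "27 * p0\<^sup>2 * ((1 + r\<^sup>2) * (1 - p0 * r)\<^sup>2 - p0\<^sup>2 * (1 - r\<^sup>2)\<^sup>2) > 0" by simp
  then have "(1 + r\<^sup>2) * (1 - p0 * r)\<^sup>2 > p0\<^sup>2 * (1 - r\<^sup>2)\<^sup>2"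
    using p0 by (simp add: zero_less_mult_iff)
  then have "(p0 / (1 - p0 * r))\<^sup>2 < (1 + r\<^sup>2) / (1 - r\<^sup>2)\<^sup>2"
    using p(1) pr by (simp add: power_divide divide_less_eq less_divide_eq mult.commute)
  \<comment> \<open>The subtracted term is increasing in \<open>\<rho>\<close>, so all admissible
    values reduce to the critical one.\<close>
  moreover have "(\<rho> / (1 - \<rho> * r))\<^sup>2 \<le> (p0 / (1 - p0 * r))\<^sup>2"
  proof (rule power_mono)
    have "\<rho> * (1 - p0 * r) \<le> p0 * (1 - \<rho> * r)" using \<rho>_le by (simp add: p0_def algebra_simps)
    then show "\<rho> / (1 - \<rho> * r) \<le> p0 / (1 - p0 * r)" using p(2) pr by (simp add: divide_simps mult.commute)
    show "0 \<le> \<rho> / (1 - \<rho> * r)" using p(2) \<rho>0 by simp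
  qed
  ultimately show ?thesis by (simp add: slope'_def)
qed

lemma slope_less:
  assumes "-1 < a" "a < b" "b < 1"
  shows "slope a < slope b"
  by (rule strict_mono_from_deriv_pos_except[where f' = slope' and z = "1 / (3 * rho0)"])
    (use assms in \<open>auto intro!: slope_deriv slope'_pos\<close>)

lemma slope_inj:
  assumes "-1 < a" "a < 1" "-1 < b" "b < 1" "slope a = slope b"
  shows "a = b"
  using slope_less[of a b] slope_less[of b a] assms by (cases a b rule: linorder_cases) auto

lemma slope_surj: "\<exists>r. -1 < r \<and> r < 1 \<and> slope r = l"
proof -
  \<comment> \<open>\<open>C\<close> bounds the regular term
    \<open>\<rho> / (1 - \<rho> * r)\<close> for positive \<open>r\<close>. At distance
    \<open>e\<close> from 1 the singular term is at least \<open>1 / (4 * e) = B\<close>, which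
    exceeds \<open>\<bar>l\<bar> + C\<close> by 1, so \<open>- r\<close> and \<open>r\<close>
    bracket the level \<open>l\<close>.\<close>
  define C where "C = \<rho> / (1 - \<rho>)"
  have C: "C \<ge> 0" using \<rho>0 \<rho>1 by (simp add: C_def)
  define B where "B = \<bar>l\<bar> + C + 1"
  have B: "B \<ge> 1" using C by (simp add: B_def)
  define e where "e = 1 / (4 * B)"
  have e: "e > 0" "e \<le> 1 / 4" using B by (simp_all add: e_def divide_simps)
  define r where "r = 1 - e"
  have r: "r \<ge> 1 / 2" "r < 1" using e by (simp_all add: r_def)
  have "1 / (4 * e) = \<bar>l\<bar> + C + 1" using B by (simp add: e_def) (simp add: B_def)
  moreover have "1 / (4 * e) \<le> r / (1 - r\<^sup>2)"
  proof -
    have eq: "1 - r\<^sup>2 = e * (1 + r)" by (simp add: r_def power2_eq_square algebra_simps)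
    have "1 + r \<le> 4 * r" using r by simp
    then show ?thesis unfolding eq using e r by (simp add: divide_simps mult.commute)
  qed
  ultimately have big: "\<bar>l\<bar> + C + 1 \<le> r / (1 - r\<^sup>2)" by simp
  have "\<rho> / (1 - \<rho> * r) \<le> C"
    unfolding C_def using \<rho>0 \<rho>1 r mult_left_mono[of r 1 \<rho>] by (intro divide_left_mono mult_pos_pos) auto
  with big have up: "l \<le> slope r" unfolding slope_def by linarith
  have "\<rho> / (1 - \<rho> * (- r)) \<ge> 0" using \<rho>0 r by simp
  with big C have lo: "slope (- r) \<le> l" unfolding slope_def by simp
  have "continuous_on {- r..r} slope"
  proof (rule continuous_at_imp_continuous_on, rule ballI)
    fix x assume "x \<in> {- r..r}"
    then show "isCont slope x" using r by (intro DERIV_isCont[OF slope_deriv]) auto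
  qed
  with IVT'[of slope "- r" l r] lo up r obtain x where "- r \<le> x" "x \<le> r" "slope x = l" by auto
  then show ?thesis using r by (intro exI[of _ x]) auto
qed

lemma r0_props: "-1 < r0 \<rho> l" "r0 \<rho> l < 1" "slope (r0 \<rho> l) = l"
proof -
  have ex: "\<exists>!r. -1 < r \<and> r < 1 \<and> deriv (hbar \<rho> l) r = 0"
  proof (rule ex_ex1I)
    obtain r where r: "-1 < r" "r < 1" "slope r = l" using slope_surj by blast
    then show "\<exists>r. -1 < r \<and> r < 1 \<and> deriv (hbar \<rho> l) r = 0"
      using DERIV_imp_deriv[OF hbar_deriv[OF r(1,2)]] by (intro exI[of _ r]) simp
  next
    fix a b assume "-1 < a \<and> a < 1 \<and> deriv (hbar \<rho> l) a = 0" "-1 < b \<and> b < 1 \<and> deriv (hbar \<rho> l) b = 0"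
    then show "a = b"
      using DERIV_imp_deriv[OF hbar_deriv[of a l]] DERIV_imp_deriv[OF hbar_deriv[of b l]] slope_inj[of a b] by auto
  qed
  from theI'[OF ex] have t: "-1 < r0 \<rho> l \<and> r0 \<rho> l < 1 \<and> deriv (hbar \<rho> l) (r0 \<rho> l) = 0"
    unfolding r0_def .
  then show "-1 < r0 \<rho> l" "r0 \<rho> l < 1" by auto
  with t show "slope (r0 \<rho> l) = l"
    using DERIV_imp_deriv[OF hbar_deriv[of "r0 \<rho> l" l]] by simp
qed

lemma r0_slope:
  assumes "-1 < r" "r < 1"
  shows "r0 \<rho> (slope r) = r"
  by (rule slope_inj) (use r0_props[of "slope r"] assms in auto)

lemma isCont_r0: "isCont (r0 \<rho>) l"
proof -
  define x where "x = r0 \<rho> l"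
  have x: "-1 < x" "x < 1" "slope x = l" using r0_props by (simp_all add: x_def)
  have "isCont (r0 \<rho>) (slope x)"
  proof (rule isCont_inverse_function[where f = slope and x = x])
    show "0 < (1 - \<bar>x\<bar>) / 2" using x by auto
    fix z assume "\<bar>z - x\<bar> \<le> (1 - \<bar>x\<bar>) / 2"
    then have z: "-1 < z" "z < 1" using x by (auto simp: abs_if split: if_splits)
    show "r0 \<rho> (slope z) = z" by (rule r0_slope[OF z])
    show "isCont slope z" by (rule DERIV_isCont[OF slope_deriv[OF z]])
  qed
  then show ?thesis by (simp add: x)
qed

text \<open>As \<open>slope\<close> increases, the derivative \<open>l - slope\<close> changes sign
  once, from positive to negative. Up to a constant, \<open>Lfun\<close> is therefore a supremum of
  affine functions of \<open>l\<close>.\<close>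

lemma hbar_le_r0:
  assumes "-1 < r" "r < 1"
  shows "hbar \<rho> l r \<le> hbar \<rho> l (r0 \<rho> l)"
proof (cases "r \<le> r0 \<rho> l")
  case True
  show ?thesis
  proof (rule DERIV_nonneg_imp_nondecreasing[OF True])
    fix x assume x: "r \<le> x" "x \<le> r0 \<rho> l"
    with assms r0_props[of l] have x1: "-1 < x" "x < 1" by auto
    have "slope x \<le> l" using x slope_less[of x "r0 \<rho> l"] r0_props[of l] x1 by (cases "x = r0 \<rho> l") auto
    then show "\<exists>y. (hbar \<rho> l has_real_derivative y) (at x) \<and> 0 \<le> y"
      using hbar_deriv[OF x1, of l] by (intro exI[of _ "l - slope x"]) auto
  qed
next
  case False
  then have le: "r0 \<rho> l \<le> r" by simp
  show ?thesis
  proof (rule DERIV_nonpos_imp_nonincreasing[OF le])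
    fix x assume x: "r0 \<rho> l \<le> x" "x \<le> r"
    with assms r0_props[of l] have x1: "-1 < x" "x < 1" by auto
    have "l \<le> slope x" using x slope_less[of "r0 \<rho> l" x] r0_props[of l] x1 by (cases "x = r0 \<rho> l") auto
    then show "\<exists>y. (hbar \<rho> l has_real_derivative y) (at x) \<and> y \<le> 0"
      using hbar_deriv[OF x1, of l] by (intro exI[of _ "l - slope x"]) auto
  qed
qed

text \<open>\<open>Lfun\<close> is a Legendre transform, so its increments lie between the slopes \<open>r0\<close> at
  the two end points.\<close>

lemma Lfun_deriv: "(Lfun \<rho> has_real_derivative r0 \<rho> l) (at l)"
proof -
  \<comment> \<open>The maximiser for \<open>a\<close> is used as a competitor for \<open>b\<close>;
    \<open>hbar\<close> is affine in the parameter, so the difference is explicit.\<close>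
  have inc: "(b - a) * r0 \<rho> a \<le> Lfun \<rho> b - Lfun \<rho> a" for a b
  proof -
    have "hbar \<rho> b (r0 \<rho> a) = hbar \<rho> a (r0 \<rho> a) + (b - a) * r0 \<rho> a"
      by (simp add: hbar_def algebra_simps)
    then show ?thesis using hbar_le_r0[OF r0_props(1,2), of b a] by (simp add: Lfun_def)
  qed
  have bd: "\<bar>(Lfun \<rho> (l + h) - Lfun \<rho> l) / h - r0 \<rho> l\<bar> \<le> \<bar>r0 \<rho> (l + h) - r0 \<rho> l\<bar>" if "h \<noteq> 0" for h
  proof -
    have lo: "h * r0 \<rho> l \<le> Lfun \<rho> (l + h) - Lfun \<rho> l" using inc[of "l + h" l] by simp
    have hi: "Lfun \<rho> (l + h) - Lfun \<rho> l \<le> h * r0 \<rho> (l + h)" using inc[of l "l + h"] by simp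
    define Q where "Q = (Lfun \<rho> (l + h) - Lfun \<rho> l) / h"
    have Q: "Lfun \<rho> (l + h) - Lfun \<rho> l = h * Q" using that by (simp add: Q_def)
    show ?thesis
    proof (cases "h > 0")
      case True
      then show ?thesis using lo hi unfolding Q_def[symmetric] Q by simp
    next
      case False
      with that have "h < 0" by simp
      then show ?thesis using lo hi unfolding Q_def[symmetric] Q by (simp add: mult_le_cancel_left)
    qed
  qed
  have "(\<lambda>h. r0 \<rho> (l + h)) \<midarrow>0\<rightarrow> r0 \<rho> l"
    using isCont_r0[of l] unfolding isCont_iff .
  then have "(\<lambda>h. \<bar>r0 \<rho> (l + h) - r0 \<rho> l\<bar>) \<midarrow>0\<rightarrow> 0"
    by (intro tendsto_rabs_zero) (simp add: LIM_zero_iff)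
  then have "(\<lambda>h. (Lfun \<rho> (l + h) - Lfun \<rho> l) / h - r0 \<rho> l) \<midarrow>0\<rightarrow> 0"
    by (rule Lim_null_comparison[rotated]) (use bd in \<open>auto simp: eventually_at intro!: exI[of _ 1]\<close>)
  then show ?thesis unfolding DERIV_def by (simp add: LIM_zero_iff)
qed

lemma deriv_Lfun: "deriv (Lfun \<rho>) = r0 \<rho>"
  by (rule ext) (rule DERIV_imp_deriv[OF Lfun_deriv])

lemma lambda_c_eq:
  assumes "-1 < c" "c < 1"
  shows "lambda_c \<rho> c = slope c"
  unfolding lambda_c_def deriv_Lfun
  by (rule the_equality) (use r0_slope[OF assms] r0_props(3) in auto)

text \<open>The inverse function rule needs a nonzero derivative at \<open>c\<close> itself, and
  \<open>c\<close> may equal the point left out in \<open>slope'_pos\<close>. For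
  \<open>c > \<rho>\<close> a direct comparison works: \<open>\<rho> / (1 - \<rho> * c)\<close> lies
  below \<open>1 / (1 - c^2)\<close>.\<close>

lemma slope'_pos_above:
  assumes "\<rho> < c" "c < 1"
  shows "slope' c > 0"
proof -
  have c: "-1 < c" using assms \<rho>0 by simp
  note p = one_minus_pos[OF c assms(2)]
  have "\<rho> * (1 - c\<^sup>2) < 1 * (1 - \<rho> * c)"
  proof -
    have "\<rho> * (1 - c\<^sup>2) \<le> 1 * (1 - c\<^sup>2)" using p \<rho>1 by (intro mult_right_mono) auto
    also have "\<dots> < 1 - \<rho> * c"
    proof -
      have "\<rho> * c < c * c" using assms \<rho>0 by (intro mult_strict_right_mono) auto
      then show ?thesis by (simp add: power2_eq_square)
    qed
    finally show ?thesis by simp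
  qed
  then have "\<rho> / (1 - \<rho> * c) < 1 / (1 - c\<^sup>2)" using p by (simp add: divide_simps mult.commute)
  then have "(\<rho> / (1 - \<rho> * c))\<^sup>2 < (1 / (1 - c\<^sup>2))\<^sup>2"
    using p \<rho>0 by (intro power_strict_mono) auto
  also have "\<dots> \<le> (1 + c\<^sup>2) / (1 - c\<^sup>2)\<^sup>2"
    unfolding power_divide using p by (intro divide_right_mono) auto
  finally show ?thesis by (simp add: slope'_def)
qed

text \<open>The derivative of \<open>Lfun \<rho>\<close> is \<open>r0 \<rho>\<close>, the inverse
  function of \<open>slope\<close>; its second derivative is thus the reciprocal of the derivative
  of \<open>slope\<close>.\<close>

lemma sigma_c_eq:
  assumes "\<rho> < c" "c < 1"
  shows "sigma_c \<rho> c = sqrt (inverse (slope' c))"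
proof -
  have c: "-1 < c" using assms \<rho>0 by simp
  have "(r0 \<rho> has_real_derivative inverse (slope' c)) (at (slope c))"
  proof (rule DERIV_inverse_function[where f = slope])
    show "(slope has_real_derivative slope' c) (at (r0 \<rho> (slope c)))"
      using slope_deriv[OF c assms(2)] by (simp add: r0_slope[OF c assms(2)])
    show "slope c - 1 < slope c" "slope c < slope c + 1" by simp_all
  qed (use slope'_pos_above[OF assms] r0_props(3) isCont_r0 in auto)
  then show ?thesis
    unfolding sigma_c_def deriv_Lfun lambda_c_eq[OF c assms(2)] by (simp add: DERIV_imp_deriv)
qed

lemma deriv_deriv_hbar:
  assumes "-1 < c" "c < 1"
  shows "deriv (deriv (hbar \<rho> l)) c = - slope' c"
proof (rule DERIV_imp_deriv)
  have "((\<lambda>r. l - slope r) has_real_derivative - slope' c) (at c)"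
    using slope_deriv[OF assms] by (auto intro!: derivative_eq_intros)
  then show "(deriv (hbar \<rho> l) has_real_derivative - slope' c) (at c)"
    by (rule has_field_derivative_transform_within_open[where S = "{-1<..<1}"])
      (use assms DERIV_imp_deriv[OF hbar_deriv] in auto)
qed

lemma gbar_eq:
  assumes "-1 < c" "c < 1"
  shows "gbar \<rho> c = (1 - \<rho> * c) * sqrt (1 - \<rho> * c) / (sqrt (1 - \<rho>\<^sup>2) * (1 - c\<^sup>2)\<^sup>2)"
proof -
  note p = one_minus_pos[OF assms]
  have q: "1 - \<rho>\<^sup>2 > 0" using one_minus_pos(1)[of \<rho>] \<rho>0 \<rho>1 by simp
  have e1: "(1 - \<rho>\<^sup>2) powr (- 1 / 2) = inverse (sqrt (1 - \<rho>\<^sup>2))"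
    using q by (simp add: powr_minus powr_half_sqrt)
  have e2: "(1 - \<rho> * c) powr (3 / 2) = (1 - \<rho> * c) * sqrt (1 - \<rho> * c)"
    using p powr_add[of "1 - \<rho> * c" 1 "1 / 2"] by (simp add: powr_half_sqrt)
  have e3: "(1 - c\<^sup>2) powi (- 2) = inverse ((1 - c\<^sup>2)\<^sup>2)"
    by (simp add: power_int_minus)
  show ?thesis
    unfolding gbar_def e1 e2 e3 by (simp only: divide_inverse inverse_mult_distrib mult_ac)
qed

lemma gbar_pos:
  assumes "-1 < c" "c < 1"
  shows "gbar \<rho> c > 0"
proof -
  have "1 - \<rho>\<^sup>2 > 0" using one_minus_pos(1)[of \<rho>] \<rho>0 \<rho>1 by simp
  then show ?thesis
    unfolding gbar_eq[OF assms] using one_minus_pos[OF assms]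
    by (intro divide_pos_pos mult_pos_pos zero_less_power) auto
qed

lemma sldp_rhs_eq:
  assumes "\<rho> < c" "c < 1"
  shows "exp (- real n * Lstar \<rho> c + ln (gbar \<rho> (r0 \<rho> (lambda_c \<rho> c)))
               - 1/2 * ln \<bar>deriv (deriv (hbar \<rho> (lambda_c \<rho> c))) (r0 \<rho> (lambda_c \<rho> c))\<bar>)
         / (lambda_c \<rho> c * sigma_c \<rho> c * sqrt (2 * pi * real n)) =
    exp (- real n * Lstar \<rho> c) * gbar \<rho> c / (slope c * sqrt (2 * pi * real n))"
proof -
  have c: "-1 < c" using assms \<rho>0 by simp
  note p = one_minus_pos[OF c assms(2)]
  have k: "slope' c > 0" by (rule slope'_pos_above[OF assms])
  have g: "gbar \<rho> c > 0" by (rule gbar_pos[OF c assms(2)])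
  have "exp (- (1 / 2 * ln (slope' c))) = inverse (sqrt (slope' c))"
    using k by (simp add: exp_minus ln_sqrt[symmetric])
  moreover have "exp (- real n * Lstar \<rho> c + ln (gbar \<rho> c) - 1/2 * ln (slope' c)) =
      exp (- real n * Lstar \<rho> c) * exp (ln (gbar \<rho> c)) * exp (- (1 / 2 * ln (slope' c)))"
    by (simp only: exp_add[symmetric]) simp
  ultimately have E: "exp (- real n * Lstar \<rho> c + ln (gbar \<rho> c) - 1/2 * ln (slope' c)) =
      exp (- real n * Lstar \<rho> c) * gbar \<rho> c * inverse (sqrt (slope' c))"
    using g by simp
  have abs: "\<bar>- slope' c\<bar> = slope' c" using k by simp
  have cancel: "x * inverse w / (y * inverse w * z) = x / (y * z)" if "w > 0" for w x y z :: real
    using that by (simp add: divide_simps)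
  show ?thesis
    unfolding sigma_c_eq[OF assms] lambda_c_eq[OF c assms(2)] r0_slope[OF c assms(2)] deriv_deriv_hbar[OF c assms(2)]
      abs E real_sqrt_inverse
    by (rule cancel) (use k in simp)
qed

end

section \<open>Tail asymptotics\<close>

lemma pearson_cong:
  assumes "\<And>i. i \<in> {1..n} \<Longrightarrow> x i = x' i" "\<And>i. i \<in> {1..n} \<Longrightarrow> y i = y' i"
  shows "pearson x y n = pearson x' y' n"
proof -
  have "emp_mean x n = emp_mean x' n" "emp_mean y n = emp_mean y' n"
    using assms by (simp_all add: emp_mean_def)
  moreover have "(\<Sum>i=1..n. (x i - a) * (y i - b)) = (\<Sum>i=1..n. (x' i - a) * (y' i - b))"
    "(\<Sum>i=1..n. (x i - a)\<^sup>2) = (\<Sum>i=1..n. (x' i - a)\<^sup>2)"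
    "(\<Sum>i=1..n. (y i - b)\<^sup>2) = (\<Sum>i=1..n. (y' i - b)\<^sup>2)" for a b
    by (intro sum.cong refl; simp add: assms)+
  ultimately show ?thesis unfolding pearson_def by (simp only:)
qed

lemma pearson_measurable [measurable (raw)]:
  assumes [measurable]: "\<And>i. i \<in> {1..n} \<Longrightarrow> (\<lambda>\<omega>. x \<omega> i) \<in> borel_measurable M"
    "\<And>i. i \<in> {1..n} \<Longrightarrow> (\<lambda>\<omega>. y \<omega> i) \<in> borel_measurable M"
  shows "(\<lambda>\<omega>. pearson (x \<omega>) (y \<omega>) n) \<in> borel_measurable M"
  unfolding pearson_def emp_mean_def by measurable

text \<open>Each observation is passed through the affine map \<open>\<phi>\<close> that
  standardises \<open>(X, Y)\<close>. Independence and the common law make the transformed sample a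
  product of copies of \<open>gauss2\<close>, and undoing \<open>\<phi>\<close> changes each
  coordinate by a positive affine map only, which the correlation coefficient ignores.\<close>

lemma pearson_prob_eq:
  assumes M: "prob_space M" and G: "gaussian_vector2 M X Y"
    and s1: "\<sigma>1 > 0" "\<sigma>1\<^sup>2 = prob_space.variance M X"
    and s2: "\<sigma>2 > 0" "\<sigma>2\<^sup>2 = prob_space.variance M Y"
    and cov: "covariance M X Y = \<rho> * \<sigma>1 * \<sigma>2"
    and iid: "iid_sample M X Y Xs Ys"
    and \<rho>: "\<rho>\<^sup>2 < 1" and n: "n > 0"
  shows "ennreal (measure M {\<omega> \<in> space M. pearson (\<lambda>i. Xs i \<omega>) (\<lambda>i. Ys i \<omega>) n \<ge> c}) =
    (\<integral>\<^sup>+x. indicator {x. c \<le> pearson (\<lambda>i. fst (x i)) (\<lambda>i. \<rho> * fst (x i) + sqrt (1 - \<rho>\<^sup>2) * snd (x i)) n} x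
      \<partial>(\<Pi>\<^sub>M i\<in>{1..n}. gauss2))"
proof -
  interpret prob_space M by fact
  define m1 where "m1 = (\<integral>\<omega>. X \<omega> \<partial>M)"
  define m2 where "m2 = (\<integral>\<omega>. Y \<omega> \<partial>M)"
  define s where "s = sqrt (1 - \<rho>\<^sup>2)"
  have s: "s > 0" using \<rho> by (simp add: s_def)
  define \<phi> where "\<phi> p = ((fst p - m1) / (sqrt 2 * \<sigma>1), ((snd p - m2) / (sqrt 2 * \<sigma>2) - \<rho> * ((fst p - m1) / (sqrt 2 *
    \<sigma>1))) / s)" for p :: "real \<times> real"
  have \<phi>m [measurable]: "\<phi> \<in> borel \<Otimes>\<^sub>M borel \<rightarrow>\<^sub>M borel \<Otimes>\<^sub>M borel"
    unfolding \<phi>_def by measurable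
  have bp: "(borel :: (real \<times> real) measure) = borel \<Otimes>\<^sub>M borel" by (simp add: borel_prod)
  let ?XY = "\<lambda>i \<omega>. (Xs i \<omega>, Ys i \<omega>)"
  have ind: "indep_vars (\<lambda>_. borel \<Otimes>\<^sub>M borel) ?XY {1..}"
    and law: "\<And>i. i \<ge> 1 \<Longrightarrow> distr M (borel \<Otimes>\<^sub>M borel) (?XY i) = distr M (borel \<Otimes>\<^sub>M borel)
      (\<lambda>\<omega>. (X \<omega>, Y \<omega>))"
    using iid unfolding iid_sample_def bp by auto
  have XYm: "?XY i \<in> M \<rightarrow>\<^sub>M borel \<Otimes>\<^sub>M borel" if "i \<in> {1..n}" for i
    using ind that by (auto simp: indep_vars_def)
  have [measurable]: "X \<in> borel_measurable M" "Y \<in> borel_measurable M"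
    using G[unfolded gaussian_vector2_def, rule_format, of 1 0] G[unfolded gaussian_vector2_def, rule_format, of 0 1]
    by (simp_all add: gaussian_rv_def)
  define W where "W i \<omega> = \<phi> (Xs i \<omega>, Ys i \<omega>)" for i \<omega>
  have Wm: "W i \<in> M \<rightarrow>\<^sub>M borel \<Otimes>\<^sub>M borel" if "i \<in> {1..n}" for i
    unfolding W_def[abs_def] using measurable_compose[OF XYm[OF that], of \<phi>] by simp
  have std: "distr M (borel \<Otimes>\<^sub>M borel) (\<lambda>\<omega>. \<phi> (X \<omega>, Y \<omega>)) = gauss2"
    unfolding \<phi>_def fst_conv snd_conv m1_def m2_def s_def
    by (rule gaussian_vector2_standardize[OF M G s1 s2 cov \<rho> refl refl])
  have push: "distr (distr M (borel \<Otimes>\<^sub>M borel) Z) (borel \<Otimes>\<^sub>M borel) \<phi> = distr M (borel \<Otimes>\<^sub>M borel)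
    (\<lambda>\<omega>. \<phi> (Z \<omega>))"
    if "Z \<in> M \<rightarrow>\<^sub>M borel \<Otimes>\<^sub>M borel" for Z
    using distr_distr[OF \<phi>m that] unfolding comp_def .
  have Wlaw: "distr M (borel \<Otimes>\<^sub>M borel) (W i) = gauss2" if i: "i \<in> {1..n}" for i
  proof -
    have "distr M (borel \<Otimes>\<^sub>M borel) (W i) = distr (distr M (borel \<Otimes>\<^sub>M borel) (?XY i)) (borel \<Otimes>\<^sub>M borel) \<phi>"
      unfolding push[OF XYm[OF i]] W_def[abs_def] ..
    also have "\<dots> = distr (distr M (borel \<Otimes>\<^sub>M borel) (\<lambda>\<omega>. (X \<omega>, Y \<omega>))) (borel \<Otimes>\<^sub>M borel) \<phi>"
      using law[of i] i by simp
    also have "\<dots> = gauss2"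
      by (subst push) (simp_all add: std)
    finally show ?thesis .
  qed
  have "indep_vars (\<lambda>_. borel \<Otimes>\<^sub>M borel) ?XY {1..n}"
    by (rule indep_vars_subset[OF ind]) auto
  then have "indep_vars (\<lambda>_. borel \<Otimes>\<^sub>M borel) (\<lambda>i \<omega>. \<phi> (?XY i \<omega>)) {1..n}"
    by (rule indep_vars_compose2) measurable
  then have indW: "indep_vars (\<lambda>_. borel \<Otimes>\<^sub>M borel) W {1..n}"
    by (simp add: W_def[abs_def])
  let ?B = "\<Pi>\<^sub>M i\<in>{1..n}. borel \<Otimes>\<^sub>M borel :: (real \<times> real) measure"
  let ?R = "\<lambda>\<omega>. \<lambda>i\<in>{1..n}. W i \<omega>"
  have Rm [measurable]: "?R \<in> M \<rightarrow>\<^sub>M ?B"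
    by (intro measurable_restrict Wm)
  have "distr M ?B ?R = (\<Pi>\<^sub>M i\<in>{1..n}. distr M (borel \<Otimes>\<^sub>M borel) (W i))"
    using indep_vars_iff_distr_eq_PiM'[of "{1..n}" W "\<lambda>_. borel \<Otimes>\<^sub>M borel"] indW Wm n by auto
  also have "\<dots> = (\<Pi>\<^sub>M i\<in>{1..n}. gauss2)"
    by (rule PiM_cong) (auto simp: Wlaw)
  finally have D: "distr M ?B ?R = (\<Pi>\<^sub>M i\<in>{1..n}. gauss2)" .
  let ?r = "\<lambda>x. pearson (\<lambda>i. fst (x i)) (\<lambda>i. \<rho> * fst (x i) + s * snd (x i)) n"
  have comp [measurable]: "(\<lambda>x. x i) \<in> ?B \<rightarrow>\<^sub>M borel \<Otimes>\<^sub>M borel" if "i \<in> {1..n}" for i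
    using that by simp
  have rm [measurable]: "?r \<in> borel_measurable ?B"
  proof (rule pearson_measurable)
    fix i assume i: "i \<in> {1..n}"
    note [measurable] = comp[OF i]
    show "(\<lambda>x. fst (x i)) \<in> borel_measurable ?B" "(\<lambda>x. \<rho> * fst (x i) + s * snd (x i)) \<in> borel_measurable ?B"
      by measurable
  qed
  have req: "?r (?R \<omega>) = pearson (\<lambda>i. Xs i \<omega>) (\<lambda>i. Ys i \<omega>) n" for \<omega>
  proof -
    have "?r (?R \<omega>) = pearson (\<lambda>i. fst (W i \<omega>)) (\<lambda>i. \<rho> * fst (W i \<omega>) + s * snd (W i \<omega>)) n"
      by (rule pearson_cong) auto
    also have "\<dots> = pearson (\<lambda>i. m1 + sqrt 2 * \<sigma>1 * fst (W i \<omega>)) (\<lambda>i. m2 + sqrt 2 * \<sigma>2 * (\<rho> * fst (W i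
      \<omega>) + s * snd (W i \<omega>))) n"
      using s1 s2 by (intro pearson_affine[symmetric]) auto
    also have "(\<lambda>i. m1 + sqrt 2 * \<sigma>1 * fst (W i \<omega>)) = (\<lambda>i. Xs i \<omega>)"
      using s1 by (simp add: W_def \<phi>_def)
    also have "(\<lambda>i. m2 + sqrt 2 * \<sigma>2 * (\<rho> * fst (W i \<omega>) + s * snd (W i \<omega>))) = (\<lambda>i. Ys i \<omega>)"
      using s2 s by (simp add: W_def \<phi>_def)
    finally show ?thesis .
  qed
  have rmM: "(\<lambda>\<omega>. pearson (\<lambda>i. Xs i \<omega>) (\<lambda>i. Ys i \<omega>) n) \<in> borel_measurable M"
    using measurable_compose[OF Rm rm] unfolding req .
  then have S: "{\<omega> \<in> space M. c \<le> pearson (\<lambda>i. Xs i \<omega>) (\<lambda>i. Ys i \<omega>) n} \<in> sets M" by measurable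
  have im: "(\<lambda>x. indicator {x. c \<le> ?r x} x :: ennreal) \<in> borel_measurable ?B"
  proof -
    have "(\<lambda>x. indicator {c..} (?r x) :: ennreal) \<in> borel_measurable ?B" by measurable
    then show ?thesis by (simp add: indicator_def)
  qed
  have "ennreal (measure M {\<omega> \<in> space M. c \<le> pearson (\<lambda>i. Xs i \<omega>) (\<lambda>i. Ys i \<omega>) n}) =
      (\<integral>\<^sup>+\<omega>. indicator {\<omega> \<in> space M. c \<le> pearson (\<lambda>i. Xs i \<omega>) (\<lambda>i. Ys i \<omega>) n} \<omega> \<partial>M)"
    using S by (simp add: emeasure_eq_measure)
  also have "\<dots> = (\<integral>\<^sup>+\<omega>. indicator {x. c \<le> ?r x} (?R \<omega>) \<partial>M)"
    by (intro nn_integral_cong) (simp only: indicator_def mem_Collect_eq req simp_thms)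
  also have "\<dots> = (\<integral>\<^sup>+x. indicator {x. c \<le> ?r x} x \<partial>distr M ?B ?R)"
    by (rule nn_integral_distr[OF Rm, symmetric]) (simp only: measurable_distr_eq1 im)
  finally show ?thesis unfolding D s_def .
qed

theorem theorem3p3:
  fixes M :: "'a measure"
    and X Y :: "'a \<Rightarrow> real"
    and Xs Ys :: "nat \<Rightarrow> 'a \<Rightarrow> real"
    and \<sigma>1 \<sigma>2 \<rho> c :: real
  assumes "prob_space M"
    and "gaussian_vector2 M X Y"
    and "\<sigma>1 > 0" and "\<sigma>1\<^sup>2 = prob_space.variance M X"
    and "\<sigma>2 > 0" and "\<sigma>2\<^sup>2 = prob_space.variance M Y"
    and "covariance M X Y = \<rho> * \<sigma>1 * \<sigma>2"
    and "iid_sample M X Y Xs Ys"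
    and "0 \<le> \<rho>" and "\<rho> < c" and "c < 1" and "\<bar>\<rho>\<bar> \<le> rho0"
  shows "asymp_equiv
    (\<lambda>n. measure M {\<omega> \<in> space M. pearson (\<lambda>i. Xs i \<omega>) (\<lambda>i. Ys i \<omega>) n \<ge> c})
    sequentially
    (\<lambda>n. exp (- real n * Lstar \<rho> c + ln (gbar \<rho> (r0 \<rho> (lambda_c \<rho> c)))
               - 1/2 * ln \<bar>deriv (deriv (hbar \<rho> (lambda_c \<rho> c))) (r0 \<rho> (lambda_c \<rho> c))\<bar>)
         / (lambda_c \<rho> c * sigma_c \<rho> c * sqrt (2 * pi * real n)))"
proof -
  define P where "P n = measure M {\<omega> \<in> space M. pearson (\<lambda>i. Xs i \<omega>) (\<lambda>i. Ys i \<omega>) n \<ge> c}" for n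
  have c: "0 < c" "-1 < c" and \<rho>1: "\<rho> < 1" and \<rho>_le: "\<rho> \<le> rho0" using assms by auto
  note ctx = \<open>0 \<le> \<rho>\<close> \<rho>1 \<rho>_le
  define s where "s = sqrt (1 - \<rho>\<^sup>2)"
  define sc where "sc = sqrt (1 - c\<^sup>2)"
  have pc: "1 - c\<^sup>2 > 0" "1 - \<rho> * c > 0" using one_minus_pos[OF ctx, of c] c assms by auto
  have p\<rho>: "1 - \<rho>\<^sup>2 > 0" using one_minus_pos(1)[OF ctx, of \<rho>] ctx by simp
  have s: "s > 0" "s\<^sup>2 = 1 - \<rho>\<^sup>2" using p\<rho> by (simp_all add: s_def)
  have sc: "sc > 0" "sc\<^sup>2 = 1 - c\<^sup>2" using pc by (simp_all add: sc_def)
  \<comment> \<open>\<open>\<theta>\<close> and \<open>\<tau>\<close> are the tangents of the angles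
    with sines \<open>\<rho>\<close> and \<open>c\<close>; this is why
    \<open>sqrt (1 + \<theta>^2)\<close> and \<open>sqrt (1 + \<tau>^2)\<close> become the
    reciprocals of \<open>s\<close> and \<open>sc\<close>.\<close>
  define \<theta> where "\<theta> = \<rho> / s"
  define \<tau> where "\<tau> = c / sc"
  have "1 + \<theta>\<^sup>2 = (1 / s)\<^sup>2" using s p\<rho> by (simp add: \<theta>_def power_divide s(2) divide_simps)
  then have E1: "sqrt (1 + \<theta>\<^sup>2) = 1 / s" using s by (simp add: real_sqrt_unique)
  have "1 + \<tau>\<^sup>2 = (1 / sc)\<^sup>2" using sc pc by (simp add: \<tau>_def power_divide sc(2) divide_simps)
  then have E2: "sqrt (1 + \<tau>\<^sup>2) = 1 / sc" using sc by (simp add: real_sqrt_unique)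
  define D where "D = sqrt (1 + \<theta>\<^sup>2) * \<tau> / sqrt (1 + \<tau>\<^sup>2) - \<theta>"
  define G0 where "G0 = sqrt (1 + \<theta>\<^sup>2) * sqrt (1 + \<tau>\<^sup>2) - \<theta> * \<tau>"
  define \<alpha> where "\<alpha> = D / G0"
  define \<beta> where "\<beta> = sqrt (1 + \<theta>\<^sup>2) * sqrt (1 + \<tau>\<^sup>2) / (2 * G0)"
  have D: "D = (c - \<rho>) / s" unfolding D_def E1 E2 using sc by (simp add: \<tau>_def \<theta>_def diff_divide_distrib)
  have Dp: "D > 0" using D s assms by simp
  have G0: "G0 = (1 - \<rho> * c) / (s * sc)" unfolding G0_def E1 E2 by (simp add: \<tau>_def \<theta>_def diff_divide_distrib)
  have G0p: "G0 > 0" using G0 s sc pc by simp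
  have \<alpha>p: "\<alpha> > 0" using Dp G0p by (simp add: \<alpha>_def)
  have \<beta>: "\<beta> = 1 / (2 * (1 - \<rho> * c))" unfolding \<beta>_def E1 E2 G0 using s(1) sc(1) by simp
  define \<kappa> where "\<kappa> m = real (Suc m) * 2 ^ Suc m / pi" for m
  have \<kappa>p: "\<kappa> m > 0" for m by (simp add: \<kappa>_def)
  define J where "J m = (\<integral>\<^sup>+t. \<integral>\<^sup>+u. ennreal (1 / (u * phase \<theta> t u ^ Suc (Suc m))) * indicator {0<..} u *
    indicator {\<tau>..} t \<partial>lborel \<partial>lborel)" for m
  have "\<rho>\<^sup>2 < 1" using p\<rho> by simp
  have PJ: "ennreal (P (Suc (Suc (Suc m)))) = ennreal (\<kappa> m) * J m" for m
  proof -
    have "ennreal (P (Suc (Suc (Suc m)))) =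
      (\<integral>\<^sup>+x. indicator {x. c \<le> pearson (\<lambda>i. fst (x i)) (\<lambda>i. \<rho> * fst (x i) + s * snd (x i)) (Suc (Suc (Suc m)))} x
        \<partial>(\<Pi>\<^sub>M i\<in>{1..Suc (Suc (Suc m))}. gauss2))"
      unfolding P_def s_def
      by (rule pearson_prob_eq[OF assms(1-8) \<open>\<rho>\<^sup>2 < 1\<close>]) simp
    also have "\<dots> = (\<integral>\<^sup>+a. \<integral>\<^sup>+z. \<integral>\<^sup>+b. indicator {(a, z, b). \<tau> * b - \<theta> * a \<le> z} (a, z, b)
        \<partial>chi (Suc m) \<partial>gauss \<partial>chi (Suc (Suc m)))"
      unfolding \<tau>_def sc_def \<theta>_def by (rule pearson_law[OF c(1) \<open>c < 1\<close> s(1)])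
    also have "\<dots> = ennreal (\<kappa> m) * J m"
      unfolding \<kappa>_def J_def by (rule chi_gauss_chi_integral)
    finally show ?thesis .
  qed
  \<comment> \<open>The Laplace normalisation at \<open>N = m + 2\<close>, divided by the prefactor
    of the double integral; the sample size is \<open>n = m + 3\<close>.\<close>
  define A where "A m = (2 * G0) ^ Suc (Suc m) * (real (Suc (Suc m)) * sqrt (real (Suc (Suc m)))) / \<kappa> m" for m
  have Ap: "A m > 0" for m using G0p \<kappa>p[of m] by (simp add: A_def)
  have "(\<lambda>m. ennreal (A m * P (Suc (Suc (Suc m))))) \<longlonglongrightarrow> ennreal (1 / \<alpha> * sqrt (pi / \<beta>))"
  proof -
    have "ennreal (A m * P (Suc (Suc (Suc m)))) = ennreal ((2 * G0) ^ Suc (Suc m) * (real (Suc (Suc m)) * sqrt (real (Suc (Suc m))))) * J m" for m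
    proof -
      have "ennreal (A m * P (Suc (Suc (Suc m)))) = ennreal (A m) * ennreal (P (Suc (Suc (Suc m))))"
        using Ap[of m] by (intro ennreal_mult) (auto simp: P_def)
      also have "\<dots> = ennreal (A m) * ennreal (\<kappa> m) * J m" by (simp only: PJ mult.assoc)
      also have "ennreal (A m) * ennreal (\<kappa> m) = ennreal (A m * \<kappa> m)"
        using Ap[of m] \<kappa>p[of m] by (intro ennreal_mult[symmetric]) auto
      also have "A m * \<kappa> m = (2 * G0) ^ Suc (Suc m) * (real (Suc (Suc m)) * sqrt (real (Suc (Suc m))))"
        using \<kappa>p[of m] unfolding A_def by (simp del: of_nat_Suc power_Suc)
      finally show ?thesis .
    qed
    then show ?thesis
      using phase_laplace[OF D_def Dp G0_def \<alpha>_def \<beta>_def] unfolding J_def by simp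
  qed
  then have lim1: "(\<lambda>m. A m * P (Suc (Suc (Suc m)))) \<longlonglongrightarrow> 1 / \<alpha> * sqrt (pi / \<beta>)"
  proof (rule tendsto_ennrealD)
    show "\<forall>\<^sub>F m in sequentially. 0 \<le> A m * P (Suc (Suc (Suc m)))"
      using Ap by (intro always_eventually allI mult_nonneg_nonneg) (auto simp: P_def less_imp_le)
    show "0 \<le> 1 / \<alpha> * sqrt (pi / \<beta>)" using \<alpha>p pc unfolding \<beta> by simp
  qed
  \<comment> \<open>Three shifted indices meet here: \<open>m + 1\<close> from the prefactor,
    \<open>m + 2\<close> from the exponent and \<open>m + 3\<close> from the sample size.\<close>
  have lim2: "(\<lambda>m. (real m + 1) * sqrt (real m + 3) / ((real m + 2) * sqrt (real m + 2))) \<longlonglongrightarrow> 1"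
    by real_asymp
  have lim: "(\<lambda>m. A m * P (Suc (Suc (Suc m))) * ((real m + 1) * sqrt (real m + 3) / ((real m + 2) * sqrt (real m + 2))) * (G0 * slope \<rho>
    c * sqrt (2 * pi) / (2 * pi * gbar \<rho> c)))
    \<longlonglongrightarrow> 1 / \<alpha> * sqrt (pi / \<beta>) * 1 * (G0 * slope \<rho> c * sqrt (2 * pi) / (2 * pi * gbar \<rho> c))"
    by (rule tendsto_mult[OF tendsto_mult[OF lim1 lim2] tendsto_const])
  have kf: "slope \<rho> c = (c - \<rho>) / (sc\<^sup>2 * (1 - \<rho> * c))"
  proof -
    have "slope \<rho> c = (c * (1 - \<rho> * c) - \<rho> * (1 - c\<^sup>2)) / ((1 - c\<^sup>2) * (1 - \<rho> * c))"
      unfolding slope_def[OF ctx] using pc by (simp add: diff_frac_eq)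
    also have "c * (1 - \<rho> * c) - \<rho> * (1 - c\<^sup>2) = c - \<rho>" by (simp add: power2_eq_square algebra_simps)
    finally show ?thesis by (simp add: sc(2))
  qed
  have kp: "slope \<rho> c > 0" unfolding kf using sc(1) pc assms by (intro divide_pos_pos mult_pos_pos) auto
  have gb: "gbar \<rho> c = (1 - \<rho> * c) * sqrt (1 - \<rho> * c) / (s * (sc\<^sup>2)\<^sup>2)"
    using gbar_eq[OF ctx c(2) \<open>c < 1\<close>] by (simp add: s_def sc(2))
  have gp: "gbar \<rho> c > 0" by (rule gbar_pos[OF ctx c(2) \<open>c < 1\<close>])
  \<comment> \<open>Here the Laplace constant meets the claimed one: the additional
    \<open>G0\<close> is the factor by which the powers \<open>n\<close> and \<open>n - 1\<close>
    differ.\<close>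
  have one: "1 / \<alpha> * sqrt (pi / \<beta>) * 1 * (G0 * slope \<rho> c * sqrt (2 * pi) / (2 * pi * gbar \<rho> c)) = 1"
  proof -
    define q where "q = 1 - \<rho> * c"
    define d where "d = c - \<rho>"
    define w where "w = sqrt q"
    have q: "q > 0" "w > 0" "q = w * w" using pc by (simp_all add: q_def w_def)
    have d: "d > 0" using assms by (simp add: d_def)
    have r1: "sqrt (pi / \<beta>) = sqrt (2 * pi) * w"
      by (simp add: \<beta> real_sqrt_mult[symmetric] w_def q_def mult_ac)
    have r2: "1 / \<alpha> = q / (d * sc)" using s sc by (simp add: \<alpha>_def D G0 q_def d_def divide_simps)
    have "1 / \<alpha> * sqrt (pi / \<beta>) * 1 * (G0 * slope \<rho> c * sqrt (2 * pi) / (2 * pi * gbar \<rho> c)) =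
       q / (d * sc) * (sqrt (2 * pi) * w) * (q / (s * sc) * (d / (sc\<^sup>2 * q)) * sqrt (2 * pi) / (2 * pi * (q * w / (s * (sc\<^sup>2)\<^sup>2))))"
      unfolding r1 r2 G0 kf gb q_def[symmetric] d_def[symmetric] w_def[symmetric] by simp
    also have "\<dots> = (sqrt (2 * pi) * sqrt (2 * pi)) / (2 * pi)"
      using s(1) sc(1) q(1,2) d by (simp add: divide_simps power2_eq_square)
    also have "\<dots> = 1" by simp
    finally show ?thesis .
  qed
  define R where "R n = exp (- real n * Lstar \<rho> c) * gbar \<rho> c / (slope \<rho> c * sqrt (2 * pi * real n))" for n
  have eL: "exp (- real n * Lstar \<rho> c) = 1 / G0 ^ n" for n
  proof -
    have "exp (Lstar \<rho> c) = G0"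
      using G0p by (simp add: Lstar_def G0 s_def sc_def)
    then show ?thesis by (simp add: exp_minus exp_of_nat_mult inverse_eq_divide)
  qed
  have quot: "P (Suc (Suc (Suc m))) / R (Suc (Suc (Suc m))) =
     A m * P (Suc (Suc (Suc m))) * ((real m + 1) * sqrt (real m + 3) / ((real m + 2) * sqrt (real m + 2))) * (G0 * slope \<rho> c * sqrt (2 * pi) / (2 * pi * gbar \<rho> c))" for m
  proof -
    have n3: "real (Suc (Suc (Suc m))) = real m + 3" and n2: "real (Suc (Suc m)) = real m + 2" and n1: "real (Suc m) = real m + 1" by simp_all
    have nz: "real m + 1 > 0" "real m + 2 > 0" "real m + 3 > 0" by simp_all
    define x where "x = G0 ^ Suc (Suc m)"
    define v where "v = (2::real) ^ Suc m"
    have xv: "x > 0" "v > 0" using G0p by (simp_all add: x_def v_def)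
    define a1 where "a1 = real m + 1"
    define a2 where "a2 = real m + 2"
    define r2 where "r2 = sqrt (real m + 2)"
    define r3 where "r3 = sqrt (real m + 3)"
    have ar: "a1 > 0" "a2 > 0" "r2 > 0" "r3 > 0" by (simp_all add: a1_def a2_def r2_def r3_def)
    have "(2 * G0) ^ Suc (Suc m) = 2 * v * x" by (simp add: x_def v_def power_mult_distrib)
    then have A: "A m = 2 * v * x * (a2 * r2) / (a1 * v / pi)"
      unfolding A_def \<kappa>_def n1 n2 by (simp only: v_def a1_def a2_def r2_def)
    have G: "G0 ^ Suc (Suc (Suc m)) = G0 * x" by (simp add: x_def)
    have Rm: "R (Suc (Suc (Suc m))) = 1 / (G0 * x) * gbar \<rho> c / (slope \<rho> c * (sqrt (2 * pi) * r3))"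
      unfolding R_def eL G unfolding n3 real_sqrt_mult r3_def by (simp only: mult.assoc)
    show ?thesis
      unfolding A Rm r2_def[symmetric] r3_def[symmetric] unfolding a1_def[symmetric] a2_def[symmetric]
      using ar xv gp kp G0p pi_gt_zero by (simp add: divide_simps)
  qed
  \<comment> \<open>The exact formula holds from sample size 3 on; the finitely many smaller sizes
    do not affect the limit.\<close>
  have "(\<lambda>m. P (m + 3) / R (m + 3)) \<longlonglongrightarrow> 1"
    using lim unfolding one by (simp add: quot numeral_3_eq_3)
  then have "(\<lambda>n. P n / R n) \<longlonglongrightarrow> 1" by (rule LIMSEQ_offset)
  then have "asymp_equiv P sequentially R" by (rule asymp_equivI')
  moreover have "R = (\<lambda>n. exp (- real n * Lstar \<rho> c + ln (gbar \<rho> (r0 \<rho> (lambda_c \<rho> c)))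
               - 1/2 * ln \<bar>deriv (deriv (hbar \<rho> (lambda_c \<rho> c))) (r0 \<rho> (lambda_c \<rho> c))\<bar>)
         / (lambda_c \<rho> c * sigma_c \<rho> c * sqrt (2 * pi * real n)))"
    unfolding R_def[abs_def] using sldp_rhs_eq[OF ctx \<open>\<rho> < c\<close> \<open>c < 1\<close>] by auto
  ultimately show ?thesis unfolding P_def[abs_def] by simp
qed

end
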